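(* Let $X$ be an $F$-finite integral scheme of characteristic $p>0$, and let $\mathcal{D}$ be a Cartier subalgebra on $X$ with $\mathcal{D}_e\ne0$ for some $e>0$. Let $\mathrm{triv}_X$ denote the trivial valuation on the function field of $X$. Then $\mathcal{D}$ is: (1) sharply $F$-pure if and only if $A(\zeta;\mathcal{D})\ge0$ for all $\zeta\in X^\beth$; (2) strongly $F$-regular if and only if $A(\zeta;\mathcal{D})>0$ for all $\zeta\in X^\beth\setminus\{\mathrm{triv}_X\}$. Moreover, it suffices to check these conditions on trivial semivaluations: $\mathcal{D}$ is sharply $F$-pure if and only if $A(\mathrm{triv}_x;\mathcal{D})\ge0$ for all $x\in X$, and $\mathcal{D}$ is strongly $F$-regular if and only if $A(\mathrm{triv}_x;\mathcal{D})>0$ for all $x\in X$ other than the generic point, where $\mathrm{triv}_x\in X^\beth$ is the trivial valuation on $\kappa(x)$.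
   Context: Schemes are separated and noetherian. $X$ is $F$-finite if its Frobenius morphism is finite. Let $L$ be the function field of $X$. **Semivaluations.** $X^\beth$ is the set of pairs $\zeta=(w,x)$ with $x\in X$ and $w$ a real-valued valuation (values in $\mathbb{R}\cup\{+\infty\}$, possibly trivial) on $\kappa(x)$, centered on $X$, i.e. non-negative on a local ring $\mathcal{O}_{Z,z}$ of $Z=\overline{\{x\}}$ (reduced structure). For $f\in\mathcal{O}_{X,x}$, $\zeta(f)=w(f(x))$ where $f(x)\in\kappa(x)$ is the residue. The home of $\zeta$ is $x$; the center $c_X(\zeta)$ is the point $z\in Z$ such that the valuation ring of $w$ dominates $\mathcal{O}_{Z,z}$. $\mathrm{Val}_X$ denotes the semivaluations whose home is the generic point. **Cartier algebras.** A $p^{-e}$-linear map on $L$ is an additive $\psi:L\to L$ with $\psi(f^{p^e}g)=f\psi(g)$; it is a $p^{-e}$-linear map on $X$ if $\psi(\mathcal{O}_X)\subseteq\mathcal{O}_X$. $\mathcal{C}^X=\bigoplus_{e\ge0}\mathcal{C}^X_e$ is the sheaf of graded rings of $p^{-e}$-linear maps on open subsets of $X$, with composition as product, $\mathcal{C}^X_0=\mathcal{O}_X$. A Cartier subalgebra is a quasi-coherent sheaf of graded subrings $\mathcal{D}=\bigoplus\mathcal{D}_e\subseteq\mathcal{C}^X$ with $\mathcal{D}_0=\mathcal{O}_X$. $\mathcal{D}$ is sharply $F$-pure if for every $x\in X$ there are $e\ge1$ and $\psi\in(\mathcal{D}_e)_x$ surjective as a function $\mathcal{O}_{X,x}\to\mathcal{O}_{X,x}$.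 $\mathcal{D}$ is strongly $F$-regular if for every $x\in X$ and every nonzero $f\in\mathcal{O}_{X,x}$ there are $e\ge1$ and $\psi\in(\mathcal{D}_e)_x$ with $\psi(f)=1$. **Log discrepancies.** For a nonzero $p^{-e}$-linear $\psi:L\to L$ ($e\ge1$), $0\ne f\in L$, $v\in\mathrm{Val}_X$: $E(f,\psi,v)=\frac{v(f)-p^ev(\psi(f))}{p^e-1}$, $A(v;\psi)=\sup_{f\neq0,n\ge1}E(f,\psi^n,v)$, and $A(v;\mathcal{D})=\sup_{e\ge1}\sup_{0\ne\psi\in(\mathcal{D}_e)_x}A(v;\psi)$ with $x=c_X(v)$ (and $\sup\varnothing=-\infty$). A closed integral subscheme $Z\subseteq X$ with ideal $\mathcal{I}_Z$ is uniformly $\mathcal{D}$-compatible if $\psi(\mathcal{I}_{Z,x})\subseteq\mathcal{I}_{Z,x}$ for all $x\in X$, $e\ge1$, $\psi\in(\mathcal{D}_e)_x$; then each $\psi$ induces a $p^{-e}$-linear map $\psi\|_Z$ on $Z$, and these form a Cartier subalgebra $\mathcal{D}\|_Z$ on $Z$. For $\zeta\in X^\beth$ with home $x$ and $Z=\overline{\{x\}}$, $A(\zeta;\mathcal{D}):=A(\zeta;\mathcal{D}\|_Z)$ (viewing $\zeta\in\mathrm{Val}_Z$) if $Z$ is uniformly $\mathcal{D}$-compatible, and $A(\zeta;\mathcal{D}):=+\infty$ otherwise. *)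

theory Defs
  imports
    "HOL-Analysis.Abstract_Topology"
    "HOL-Library.Extended_Real"
    "HOL-Library.FuncSet"
    "HOL-Computational_Algebra.Primes"
    "HOL-Algebra.QuotRing"
    "HOL-Algebra.Ring_Divisibility"
    "HOL-Algebra.Generated_Rings"
begin

section \<open>Schemes\<close>

text \<open>Only the values of \<open>Sect\<close> and \<open>Rest\<close> at open sets carry meaning;
  \<open>Rest X U V\<close> is the restriction from \<open>U\<close> to \<open>V\<close>.\<close>

record ('x, 'a) ringed_space =
  Space :: "'x topology"
  Sect :: "'x set \<Rightarrow> 'a ring"
  Rest :: "'x set \<Rightarrow> 'x set \<Rightarrow> 'a \<Rightarrow> 'a"

abbreviation points :: "('x, 'a) ringed_space \<Rightarrow> 'x set"
  where "points X \<equiv> topspace (Space X)"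

abbreviation is_open :: "('x, 'a) ringed_space \<Rightarrow> 'x set \<Rightarrow> bool"
  where "is_open X U \<equiv> openin (Space X) U"

definition presheaf_of_rings :: "('x, 'a) ringed_space \<Rightarrow> bool" where
  "presheaf_of_rings X \<longleftrightarrow>
     (\<forall>U. is_open X U \<longrightarrow> cring (Sect X U)) \<and>
     (\<forall>U V. is_open X U \<and> is_open X V \<and> V \<subseteq> U \<longrightarrow> Rest X U V \<in> ring_hom (Sect X U) (Sect X V)) \<and>
     (\<forall>U. is_open X U \<longrightarrow> (\<forall>s\<in>carrier (Sect X U). Rest X U U s = s)) \<and>
     (\<forall>U V W. is_open X U \<and> is_open X V \<and> is_open X W \<and> W \<subseteq> V \<and> V \<subseteq> U \<longrightarrow>
        (\<forall>s\<in>carrier (Sect X U). Rest X V W (Rest X U V s) = Rest X U W s))"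

text \<open>The covering family \<open>\<U>\<close> may be empty, which forces the ring of sections over the empty
  set to be zero.\<close>

definition sheaf_of_rings :: "('x, 'a) ringed_space \<Rightarrow> bool" where
  "sheaf_of_rings X \<longleftrightarrow> presheaf_of_rings X \<and>
     (\<forall>\<U>. (\<forall>U\<in>\<U>. is_open X U) \<longrightarrow>
        (\<forall>s\<in>carrier (Sect X (\<Union>\<U>)). \<forall>t\<in>carrier (Sect X (\<Union>\<U>)).
           (\<forall>U\<in>\<U>. Rest X (\<Union>\<U>) U s = Rest X (\<Union>\<U>) U t) \<longrightarrow> s = t) \<and>
        (\<forall>s. (\<forall>U\<in>\<U>. s U \<in> carrier (Sect X U)) \<and>
             (\<forall>U\<in>\<U>. \<forall>V\<in>\<U>. Rest X U (U \<inter> V) (s U) = Rest X V (U \<inter> V) (s V)) \<longrightarrow>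
             (\<exists>t\<in>carrier (Sect X (\<Union>\<U>)). \<forall>U\<in>\<U>. Rest X (\<Union>\<U>) U t = s U)))"

definition spec_topology :: "('a, 'm) ring_scheme \<Rightarrow> 'a set topology" where
  "spec_topology R =
     topology_generated_by ((\<lambda>f. {P. primeideal P R \<and> f \<notin> P}) ` carrier R)"

text \<open>\<open>\<phi>\<close> exhibits \<open>S\<close> as the localization of \<open>R\<close> at the powers of \<open>f\<close>.\<close>

definition localization_away ::
  "('a, 'm) ring_scheme \<Rightarrow> 'a \<Rightarrow> ('b, 'n) ring_scheme \<Rightarrow> ('a \<Rightarrow> 'b) \<Rightarrow> bool" where
  "localization_away R f S \<phi> \<longleftrightarrow>
     \<phi> \<in> ring_hom R S \<and> \<phi> f \<in> Units S \<and>
     (\<forall>b\<in>carrier S. \<exists>a\<in>carrier R. \<exists>n::nat. b \<otimes>\<^bsub>S\<^esub> \<phi> f [^]\<^bsub>S\<^esub> n = \<phi> a) \<and>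
     (\<forall>a\<in>carrier R. \<phi> a = \<zero>\<^bsub>S\<^esub> \<longrightarrow> (\<exists>n::nat. f [^]\<^bsub>R\<^esub> n \<otimes>\<^bsub>R\<^esub> a = \<zero>\<^bsub>R\<^esub>))"

text \<open>\<open>U\<close> with the restricted structure sheaf is isomorphic to \<open>Spec R\<close>, where \<open>R\<close> is the ring of
  sections over \<open>U\<close>.  The structure sheaf of \<open>Spec R\<close> is the sheaf determined on the basis of
  distinguished open sets \<open>D(f)\<close> by the localizations \<open>R\<^sub>f\<close> and the localization maps, so
  an isomorphism is a homeomorphism \<open>h\<close> under which the sections over the preimage of each \<open>D(f)\<close>
  are such a localization.\<close>

definition affine_open :: "('x, 'a) ringed_space \<Rightarrow> 'x set \<Rightarrow> bool" where
  "affine_open X U \<longleftrightarrow> is_open X U \<and>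
     (\<exists>h. homeomorphic_map (subtopology (Space X) U) (spec_topology (Sect X U)) h \<and>
        (\<forall>f\<in>carrier (Sect X U).
           localization_away (Sect X U) f (Sect X {x\<in>U. f \<notin> h x}) (Rest X U {x\<in>U. f \<notin> h x})))"

definition scheme :: "('x, 'a) ringed_space \<Rightarrow> bool" where
  "scheme X \<longleftrightarrow> sheaf_of_rings X \<and> (\<forall>x\<in>points X. \<exists>U. affine_open X U \<and> x \<in> U)"

definition noetherian_scheme :: "('x, 'a) ringed_space \<Rightarrow> bool" where
  "noetherian_scheme X \<longleftrightarrow> scheme X \<and> compact_space (Space X) \<and>
     (\<forall>x\<in>points X. \<exists>U. affine_open X U \<and> x \<in> U \<and> noetherian_ring (Sect X U))"

text \<open>The diagonal is a closed immersion.  The product \<open>X \<times> X\<close> over the integers is covered by the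
  affine schemes \<open>U \<times> V = Spec (O(U) \<otimes> O(V))\<close> with \<open>U\<close>, \<open>V\<close> affine open, and the preimage of
  \<open>U \<times> V\<close> under the diagonal is \<open>U \<inter> V\<close>; so the condition is that \<open>U \<inter> V\<close> is affine and
  \<open>O(U) \<otimes> O(V) \<rightarrow> O(U \<inter> V)\<close> is surjective.\<close>

definition separated_scheme :: "('x, 'a) ringed_space \<Rightarrow> bool" where
  "separated_scheme X \<longleftrightarrow> scheme X \<and>
     (\<forall>U V. affine_open X U \<and> affine_open X V \<longrightarrow>
        affine_open X (U \<inter> V) \<and>
        generate_ring (Sect X (U \<inter> V))
          (Rest X U (U \<inter> V) ` carrier (Sect X U) \<union> Rest X V (U \<inter> V) ` carrier (Sect X V))
        = carrier (Sect X (U \<inter> V)))"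

definition integral_scheme :: "('x, 'a) ringed_space \<Rightarrow> bool" where
  "integral_scheme X \<longleftrightarrow> scheme X \<and> points X \<noteq> {} \<and>
     (\<forall>U. is_open X U \<and> U \<noteq> {} \<longrightarrow> domain (Sect X U))"

definition has_prime_char :: "('x, 'a) ringed_space \<Rightarrow> nat \<Rightarrow> bool" where
  "has_prime_char X p \<longleftrightarrow> Factorial_Ring.prime p \<and>
     [p] \<cdot>\<^bsub>Sect X (points X)\<^esub> \<one>\<^bsub>Sect X (points X)\<^esub> = \<zero>\<^bsub>Sect X (points X)\<^esub>"

text \<open>The Frobenius morphism is the identity on points and the \<open>p\<close>-th power map on sections, so it
  is finite iff for all affine open \<open>U\<close> the ring \<open>O(U)\<close> is a finite module over itself via the
  \<open>p\<close>-th power map.\<close>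

definition F_finite :: "('x, 'a) ringed_space \<Rightarrow> nat \<Rightarrow> bool" where
  "F_finite X p \<longleftrightarrow>
     (\<forall>U. affine_open X U \<longrightarrow>
        (\<exists>B\<subseteq>carrier (Sect X U). finite B \<and>
           (\<forall>s\<in>carrier (Sect X U). \<exists>c\<in>B \<rightarrow> carrier (Sect X U).
              s = (\<Oplus>\<^bsub>Sect X U\<^esub>b\<in>B. c b [^]\<^bsub>Sect X U\<^esub> p \<otimes>\<^bsub>Sect X U\<^esub> b))))"


section \<open>Function field and local rings\<close>

definition germ :: "('x, 'a) ringed_space \<Rightarrow> 'x \<Rightarrow> 'x set \<Rightarrow> 'a \<Rightarrow> ('x set \<times> 'a) set" where
  "germ X x U s = {(V, t). is_open X V \<and> x \<in> V \<and> t \<in> carrier (Sect X V) \<and>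
     (\<exists>W. is_open X W \<and> x \<in> W \<and> W \<subseteq> U \<inter> V \<and> Rest X U W s = Rest X V W t)}"

definition stalk :: "('x, 'a) ringed_space \<Rightarrow> 'x \<Rightarrow> ('x set \<times> 'a) set ring" where
  "stalk X x =
     \<lparr>carrier = {germ X x U s | U s. is_open X U \<and> x \<in> U \<and> s \<in> carrier (Sect X U)},
      monoid.mult = (\<lambda>a b. THE c. \<exists>U s t. is_open X U \<and> x \<in> U \<and>
         s \<in> carrier (Sect X U) \<and> t \<in> carrier (Sect X U) \<and>
         a = germ X x U s \<and> b = germ X x U t \<and> c = germ X x U (s \<otimes>\<^bsub>Sect X U\<^esub> t)),
      one = germ X x (points X) \<one>\<^bsub>Sect X (points X)\<^esub>,
      zero = germ X x (points X) \<zero>\<^bsub>Sect X (points X)\<^esub>,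
      add = (\<lambda>a b. THE c. \<exists>U s t. is_open X U \<and> x \<in> U \<and>
         s \<in> carrier (Sect X U) \<and> t \<in> carrier (Sect X U) \<and>
         a = germ X x U s \<and> b = germ X x U t \<and> c = germ X x U (s \<oplus>\<^bsub>Sect X U\<^esub> t))\<rparr>"

definition generic_point :: "('x, 'a) ringed_space \<Rightarrow> 'x" where
  "generic_point X = (THE x. x \<in> points X \<and> Space X closure_of {x} = points X)"

definition function_field :: "('x, 'a) ringed_space \<Rightarrow> ('x set \<times> 'a) set ring" where
  "function_field X = stalk X (generic_point X)"

text \<open>On an integral scheme the generic point lies in every nonempty open set, and taking germs there
  identifies sections and stalks with subrings of the function field.\<close>

definition sections :: "('x, 'a) ringed_space \<Rightarrow> 'x set \<Rightarrow> ('x set \<times> 'a) set set" where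
  "sections X U = germ X (generic_point X) U ` carrier (Sect X U)"

definition local_ring :: "('x, 'a) ringed_space \<Rightarrow> 'x \<Rightarrow> ('x set \<times> 'a) set set" where
  "local_ring X x = \<Union> {sections X U | U. is_open X U \<and> x \<in> U}"

text \<open>The non-units of a subring \<open>R\<close> of a field \<open>K\<close>, i.e. the maximal ideal if \<open>R\<close> is local.\<close>

definition nonunits :: "('k, 'm) ring_scheme \<Rightarrow> 'k set \<Rightarrow> 'k set" where
  "nonunits K R = {a\<in>R. \<not> (\<exists>b\<in>R. a \<otimes>\<^bsub>K\<^esub> b = \<one>\<^bsub>K\<^esub>)}"

abbreviation max_ideal :: "('x, 'a) ringed_space \<Rightarrow> 'x \<Rightarrow> ('x set \<times> 'a) set set" where
  "max_ideal X x \<equiv> nonunits (function_field X) (local_ring X x)"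

definition residue_field :: "('x, 'a) ringed_space \<Rightarrow> 'x \<Rightarrow> ('x set \<times> 'a) set set ring" where
  "residue_field X x = (function_field X)\<lparr>carrier := local_ring X x\<rparr> Quot max_ideal X x"

definition residue ::
  "('x, 'a) ringed_space \<Rightarrow> 'x \<Rightarrow> ('x set \<times> 'a) set \<Rightarrow> ('x set \<times> 'a) set set" where
  "residue X x f = max_ideal X x +>\<^bsub>function_field X\<^esub> f"

abbreviation closure_pt :: "('x, 'a) ringed_space \<Rightarrow> 'x \<Rightarrow> 'x set" where
  "closure_pt X x \<equiv> Space X closure_of {x}"

text \<open>For \<open>Z\<close> the closure of \<open>x\<close> with its reduced structure and \<open>z \<in> Z\<close>: the local ring of \<open>Z\<close> at \<open>z\<close>,
  as a subring of the function field of \<open>Z\<close>, which is the residue field of \<open>x\<close>.\<close>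

definition local_ring_closure ::
  "('x, 'a) ringed_space \<Rightarrow> 'x \<Rightarrow> 'x \<Rightarrow> ('x set \<times> 'a) set set set" where
  "local_ring_closure X x z = residue X x ` local_ring X z"

text \<open>The stalk at \<open>z\<close> of the ideal sheaf of the closure of \<open>x\<close>.\<close>

definition ideal_closure ::
  "('x, 'a) ringed_space \<Rightarrow> 'x \<Rightarrow> 'x \<Rightarrow> ('x set \<times> 'a) set set" where
  "ideal_closure X x z =
     (if z \<in> closure_pt X x then local_ring X z \<inter> max_ideal X x else local_ring X z)"


section \<open>Semivaluations\<close>

text \<open>Membership in \<^const>\<open>extensional\<close> makes equality of valuations mean equality on \<open>K\<close>.\<close>

definition real_valuation :: "('k, 'm) ring_scheme \<Rightarrow> ('k \<Rightarrow> ereal) \<Rightarrow> bool" where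
  "real_valuation K w \<longleftrightarrow> w \<in> extensional (carrier K) \<and>
     w \<zero>\<^bsub>K\<^esub> = \<infinity> \<and> (\<forall>a\<in>carrier K - {\<zero>\<^bsub>K\<^esub>}. \<bar>w a\<bar> \<noteq> \<infinity>) \<and>
     (\<forall>a\<in>carrier K. \<forall>b\<in>carrier K. w (a \<otimes>\<^bsub>K\<^esub> b) = w a + w b) \<and>
     (\<forall>a\<in>carrier K. \<forall>b\<in>carrier K. min (w a) (w b) \<le> w (a \<oplus>\<^bsub>K\<^esub> b))"

definition trivial_valuation :: "('k, 'm) ring_scheme \<Rightarrow> 'k \<Rightarrow> ereal" where
  "trivial_valuation K = (\<lambda>a\<in>carrier K. if a = \<zero>\<^bsub>K\<^esub> then \<infinity> else 0)"

definition dominates :: "('k, 'm) ring_scheme \<Rightarrow> ('k \<Rightarrow> ereal) \<Rightarrow> 'k set \<Rightarrow> bool" where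
  "dominates K w R \<longleftrightarrow> (\<forall>a\<in>R. 0 \<le> w a) \<and> (\<forall>a\<in>R. 0 < w a \<longleftrightarrow> a \<in> nonunits K R)"

type_synonym ('x, 'a) semivaluation = "(('x set \<times> 'a) set set \<Rightarrow> ereal) \<times> 'x"

definition semivaluations :: "('x, 'a) ringed_space \<Rightarrow> ('x, 'a) semivaluation set" where
  "semivaluations X = {(w, x). x \<in> points X \<and> real_valuation (residue_field X x) w \<and>
     (\<exists>z\<in>closure_pt X x. \<forall>a\<in>local_ring_closure X x z. 0 \<le> w a)}"

definition center :: "('x, 'a) ringed_space \<Rightarrow> ('x, 'a) semivaluation \<Rightarrow> 'x" where
  "center X \<zeta> = (case \<zeta> of (w, x) \<Rightarrow>
     THE z. z \<in> closure_pt X x \<and> dominates (residue_field X x) w (local_ring_closure X x z))"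

definition triv :: "('x, 'a) ringed_space \<Rightarrow> 'x \<Rightarrow> ('x, 'a) semivaluation" where
  "triv X x = (trivial_valuation (residue_field X x), x)"


section \<open>Cartier algebras\<close>

text \<open>\<open>p\<^sup>-\<^sup>e\<close>-linear maps on a field \<open>K\<close>; they are extensional, so that equality of maps is equality
  on \<open>K\<close>.\<close>

definition p_linear :: "('k, 'm) ring_scheme \<Rightarrow> nat \<Rightarrow> nat \<Rightarrow> ('k \<Rightarrow> 'k) set" where
  "p_linear K p e = {\<psi> \<in> carrier K \<rightarrow>\<^sub>E carrier K.
     (\<forall>f\<in>carrier K. \<forall>g\<in>carrier K. \<psi> (f \<oplus>\<^bsub>K\<^esub> g) = \<psi> f \<oplus>\<^bsub>K\<^esub> \<psi> g) \<and>
     (\<forall>f\<in>carrier K. \<forall>g\<in>carrier K. \<psi> (f [^]\<^bsub>K\<^esub> (p ^ e) \<otimes>\<^bsub>K\<^esub> g) = f \<otimes>\<^bsub>K\<^esub> \<psi> g)}"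

definition nonzero_map :: "('k, 'm) ring_scheme \<Rightarrow> ('k \<Rightarrow> 'k) \<Rightarrow> bool" where
  "nonzero_map K \<psi> \<longleftrightarrow> (\<exists>g\<in>carrier K. \<psi> g \<noteq> \<zero>\<^bsub>K\<^esub>)"

text \<open>Sections over a nonempty open set \<open>U\<close> of the degree \<open>e\<close> part of the full Cartier algebra.\<close>

definition full_cartier ::
  "('x, 'a) ringed_space \<Rightarrow> nat \<Rightarrow> nat \<Rightarrow> 'x set \<Rightarrow> (('x set \<times> 'a) set \<Rightarrow> ('x set \<times> 'a) set) set" where
  "full_cartier X p e U = {\<psi> \<in> p_linear (function_field X) p e.
     \<forall>V. is_open X V \<and> V \<noteq> {} \<and> V \<subseteq> U \<longrightarrow> \<psi> ` sections X V \<subseteq> sections X V}"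

definition scale :: "('k, 'm) ring_scheme \<Rightarrow> 'k \<Rightarrow> ('k \<Rightarrow> 'k) \<Rightarrow> 'k \<Rightarrow> 'k" where
  "scale K a \<psi> = (\<lambda>g\<in>carrier K. a \<otimes>\<^bsub>K\<^esub> \<psi> g)"

definition distinguished ::
  "('x, 'a) ringed_space \<Rightarrow> 'x set \<Rightarrow> ('x set \<times> 'a) set \<Rightarrow> 'x set" where
  "distinguished X U f = {x\<in>U. \<exists>g\<in>local_ring X x. f \<otimes>\<^bsub>function_field X\<^esub> g = \<one>\<^bsub>function_field X\<^esub>}"

type_synonym ('x, 'a) graded_maps =
  "nat \<Rightarrow> 'x set \<Rightarrow> (('x set \<times> 'a) set \<Rightarrow> ('x set \<times> 'a) set) set"

text \<open>\<open>D e U\<close> are the sections of \<open>D\<^sub>e\<close> over a nonempty open set \<open>U\<close>; the value at the empty set is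
  irrelevant.  Being subsheaves of a constant sheaf, the \<open>D\<^sub>e\<close> have inclusions as restrictions.  The
  conditions are, in order: subsheaf of the full Cartier algebra, \<open>D\<^sub>0 = O\<^sub>X\<close> (acting by
  multiplication), closure under sums and compositions, quasi-coherence.  Closure under negation
  follows.  In the last condition only the surjectivity of \<open>D\<^sub>e(U)\<^sub>f \<rightarrow> D\<^sub>e(D(f))\<close> is
  stated, since injectivity is automatic.  Quasi-coherence is formulated for the left module
  structure; the right one gives the same condition because \<open>a \<cdot> \<psi> = \<psi> \<cdot> a\<^sup>q\<close> for \<open>q = p\<^sup>e\<close>.\<close>

definition cartier_subalgebra ::
  "('x, 'a) ringed_space \<Rightarrow> nat \<Rightarrow> ('x, 'a) graded_maps \<Rightarrow> bool" where
  "cartier_subalgebra X p D \<longleftrightarrow>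
     (\<forall>e U. is_open X U \<and> U \<noteq> {} \<longrightarrow> D e U \<subseteq> full_cartier X p e U) \<and>
     (\<forall>e U V. is_open X U \<and> is_open X V \<and> V \<noteq> {} \<and> V \<subseteq> U \<longrightarrow> D e U \<subseteq> D e V) \<and>
     (\<forall>e \<U>. \<U> \<noteq> {} \<and> (\<forall>U\<in>\<U>. is_open X U \<and> U \<noteq> {}) \<longrightarrow> (\<Inter>U\<in>\<U>. D e U) \<subseteq> D e (\<Union>\<U>)) \<and>
     (\<forall>U. is_open X U \<and> U \<noteq> {} \<longrightarrow>
        D 0 U = (\<lambda>a. \<lambda>g\<in>carrier (function_field X). a \<otimes>\<^bsub>function_field X\<^esub> g) ` sections X U) \<and>
     (\<forall>e U. is_open X U \<and> U \<noteq> {} \<longrightarrow>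
        (\<forall>\<phi>\<in>D e U. \<forall>\<psi>\<in>D e U.
           (\<lambda>g\<in>carrier (function_field X). \<phi> g \<oplus>\<^bsub>function_field X\<^esub> \<psi> g) \<in> D e U)) \<and>
     (\<forall>d e U. is_open X U \<and> U \<noteq> {} \<longrightarrow>
        (\<forall>\<phi>\<in>D d U. \<forall>\<psi>\<in>D e U. compose (carrier (function_field X)) \<phi> \<psi> \<in> D (d + e) U)) \<and>
     (\<forall>e U. affine_open X U \<and> U \<noteq> {} \<longrightarrow>
        (\<forall>f\<in>sections X U. distinguished X U f \<noteq> {} \<longrightarrow>
           (\<forall>\<psi>\<in>D e (distinguished X U f).
              \<exists>n::nat. scale (function_field X) (f [^]\<^bsub>function_field X\<^esub> n) \<psi> \<in> D e U)))"

definition nonzero_degree ::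
  "('x, 'a) ringed_space \<Rightarrow> ('x, 'a) graded_maps \<Rightarrow> nat \<Rightarrow> bool" where
  "nonzero_degree X D e \<longleftrightarrow>
     (\<exists>U. is_open X U \<and> U \<noteq> {} \<and> (\<exists>\<psi>\<in>D e U. nonzero_map (function_field X) \<psi>))"

definition cartier_stalk ::
  "('x, 'a) ringed_space \<Rightarrow> ('x, 'a) graded_maps \<Rightarrow> 'x \<Rightarrow> nat
    \<Rightarrow> (('x set \<times> 'a) set \<Rightarrow> ('x set \<times> 'a) set) set" where
  "cartier_stalk X D x e = \<Union> {D e U | U. is_open X U \<and> x \<in> U}"

definition sharply_F_pure :: "('x, 'a) ringed_space \<Rightarrow> ('x, 'a) graded_maps \<Rightarrow> bool" where
  "sharply_F_pure X D \<longleftrightarrow>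
     (\<forall>x\<in>points X. \<exists>e\<ge>1. \<exists>\<psi>\<in>cartier_stalk X D x e. \<psi> ` local_ring X x = local_ring X x)"

definition strongly_F_regular :: "('x, 'a) ringed_space \<Rightarrow> ('x, 'a) graded_maps \<Rightarrow> bool" where
  "strongly_F_regular X D \<longleftrightarrow>
     (\<forall>x\<in>points X. \<forall>f\<in>local_ring X x - {\<zero>\<^bsub>function_field X\<^esub>}.
        \<exists>e\<ge>1. \<exists>\<psi>\<in>cartier_stalk X D x e. \<psi> f = \<one>\<^bsub>function_field X\<^esub>)"


section \<open>Log discrepancies\<close>

text \<open>\<open>E_term p e f \<psi> v\<close> is \<open>E(f,\<psi>,v)\<close> for a \<open>p\<^sup>-\<^sup>e\<close>-linear map \<open>\<psi>\<close>.  It is \<open>-\<infinity>\<close> if \<open>\<psi> f = 0\<close>.\<close>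

definition E_term :: "nat \<Rightarrow> nat \<Rightarrow> 'k \<Rightarrow> ('k \<Rightarrow> 'k) \<Rightarrow> ('k \<Rightarrow> ereal) \<Rightarrow> ereal" where
  "E_term p e f \<psi> v = (v f - ereal (real p ^ e) * v (\<psi> f)) / ereal (real p ^ e - 1)"

text \<open>The \<open>n\<close>-th power of a \<open>p\<^sup>-\<^sup>e\<close>-linear map is \<open>p\<^sup>-\<^sup>n\<^sup>e\<close>-linear.\<close>

definition log_discrepancy_map ::
  "('k, 'm) ring_scheme \<Rightarrow> nat \<Rightarrow> nat \<Rightarrow> ('k \<Rightarrow> 'k) \<Rightarrow> ('k \<Rightarrow> ereal) \<Rightarrow> ereal" where
  "log_discrepancy_map K p e \<psi> v =
     Sup {E_term p (n * e) f (\<psi> ^^ n) v | f n. f \<in> carrier K - {\<zero>\<^bsub>K\<^esub>} \<and> n \<ge> 1}"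

text \<open>The log discrepancy \<open>A(v;D)\<close> on an integral scheme with function field \<open>K\<close>, where \<open>S e\<close> is the
  stalk of \<open>D\<^sub>e\<close> at the center of \<open>v\<close>.\<close>

definition log_discrepancy_stalk ::
  "('k, 'm) ring_scheme \<Rightarrow> nat \<Rightarrow> (nat \<Rightarrow> ('k \<Rightarrow> 'k) set) \<Rightarrow> ('k \<Rightarrow> ereal) \<Rightarrow> ereal" where
  "log_discrepancy_stalk K p S v =
     Sup {log_discrepancy_map K p e \<psi> v | e \<psi>. e \<ge> 1 \<and> \<psi> \<in> S e \<and> nonzero_map K \<psi>}"

text \<open>A closed integral subscheme is represented by its generic point \<open>x\<close>.\<close>

definition uniformly_compatible ::
  "('x, 'a) ringed_space \<Rightarrow> ('x, 'a) graded_maps \<Rightarrow> 'x \<Rightarrow> bool" where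
  "uniformly_compatible X D x \<longleftrightarrow>
     (\<forall>z\<in>points X. \<forall>e\<ge>1. \<forall>\<psi>\<in>cartier_stalk X D z e.
        \<psi> ` ideal_closure X x z \<subseteq> ideal_closure X x z)"

text \<open>For \<open>Z\<close> the closure of \<open>x\<close>, uniformly \<open>D\<close>-compatible, and \<open>z \<in> Z\<close>: the stalk at \<open>z\<close> of the degree
  \<open>e\<close> part of the algebra induced by \<open>D\<close> on \<open>Z\<close>.  A map \<open>\<psi>\<close> in the stalk of \<open>D\<^sub>e\<close> at \<open>z\<close> also lies in
  the stalk at \<open>x\<close> and so preserves the maximal ideal at \<open>x\<close>; the map it induces on the residue
  field of \<open>x\<close> is the extension to that field of the map it induces on the local ring of \<open>Z\<close> at
  \<open>z\<close>.\<close>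

definition induced_stalk ::
  "('x, 'a) ringed_space \<Rightarrow> ('x, 'a) graded_maps \<Rightarrow> 'x \<Rightarrow> 'x \<Rightarrow> nat
    \<Rightarrow> (('x set \<times> 'a) set set \<Rightarrow> ('x set \<times> 'a) set set) set" where
  "induced_stalk X D x z e =
     {\<phi> \<in> carrier (residue_field X x) \<rightarrow>\<^sub>E carrier (residue_field X x).
        \<exists>\<psi>\<in>cartier_stalk X D z e. \<forall>f\<in>local_ring X x. \<phi> (residue X x f) = residue X x (\<psi> f)}"

definition log_discrepancy ::
  "('x, 'a) ringed_space \<Rightarrow> nat \<Rightarrow> ('x, 'a) graded_maps \<Rightarrow> ('x, 'a) semivaluation \<Rightarrow> ereal" where
  "log_discrepancy X p D \<zeta> = (case \<zeta> of (w, x) \<Rightarrow>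
     if uniformly_compatible X D x
     then log_discrepancy_stalk (residue_field X x) p (induced_stalk X D x (center X \<zeta>)) w
     else \<infinity>)"

end

theory Submission
  imports Defs
begin

text \<open>
  Let \<open>q = p\<^sup>e\<close>.  If \<open>\<psi>\<close> in \<open>D\<^sub>e\<close> is defined at the center of \<open>\<zeta> = (w, x)\<close> and \<open>\<psi> f = 1\<close> for some
  \<open>f\<close> in the local ring there, then \<open>E(f,\<psi>,w) = w(f)/(q - 1)\<close>, which is nonnegative, and positive if
  \<open>w(f) > 0\<close>; this bounds log discrepancies from below.  Conversely, trivial semivaluations suffice:
  when the closure of \<open>x\<close> is uniformly compatible, the log discrepancy of the trivial valuation at \<open>x\<close>
  is at most \<open>0\<close>, and it is \<open>-\<infinity>\<close> if all maps of positive degree send the local ring at \<open>x\<close> into its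
  maximal ideal.  Hence nonnegativity forces a surjective map at every point, and positivity says that
  no closure of a nongeneric point is uniformly compatible.

  To get strong F-regularity from the latter, let \<open>N\<close> be the set of all \<open>f\<close> in the local ring at \<open>x\<close>
  that no map of positive degree sends to a unit.  It is a compatible ideal, and if it is proper, it
  is prime because \<open>\<psi>(a\<^sup>q\<^sup>-\<^sup>1 \<cdot> a b) = a \<cdot> \<psi> b\<close>.  By quasi-coherence its point is uniformly
  compatible, so \<open>N = 0\<close>.  If \<open>N\<close> is the whole local ring, then \<open>x\<close> itself is uniformly compatible,
  so \<open>x\<close> is generic and \<open>D\<close> vanishes in positive degrees.
\<close>

section \<open>Stalks of a presheaf of rings\<close>

text \<open>Local rings are subrings of the function field \<open>K\<close>, and their maximal
  ideals are the sets of nonunits. So passing to a generization is an inclusion of rings, and a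
  stalk element of \<open>D\<close> is a map on all of \<open>K\<close>. The price is that locality
  of these rings and the match between primes and points are not formal: both are read off affine
  charts and carried over by clearing denominators. The same device transports maps, with a twist:
  \<psi> is linear only over q-th powers, so a denominator \<open>b\<close> enters its argument as
  \<open>b^q\<close>. The center is defined as a unique point, and separatedness supplies the
  uniqueness; the log discrepancy depends on it through the stalk of maps at the center. The trivial
  valuation at \<open>x\<close> has center \<open>x\<close>, so it sees exactly the maps defined at
  \<open>x\<close>. The conventions for extreme values carry the argument: the supremum of the empty
  set is minus infinity, and points with incompatible closure get plus infinity, the only way a
  trivial semivaluation can have positive log discrepancy. The generic point is always compatible,
  its maximal ideal being zero, and therefore has to be exempted.\<close>

locale ring_presheaf =
  fixes X :: "('x, 'a) ringed_space"
  assumes presheaf: "presheaf_of_rings X"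
begin

lemma sect_cring: "is_open X U \<Longrightarrow> cring (Sect X U)"
  using presheaf unfolding presheaf_of_rings_def by simp

lemma rest_hom:
  "is_open X U \<Longrightarrow> is_open X V \<Longrightarrow> V \<subseteq> U \<Longrightarrow> Rest X U V \<in> ring_hom (Sect X U) (Sect X V)"
  using presheaf unfolding presheaf_of_rings_def by simp

lemma rest_closed [simp]:
  "is_open X U \<Longrightarrow> is_open X V \<Longrightarrow> V \<subseteq> U \<Longrightarrow> s \<in> carrier (Sect X U) \<Longrightarrow>
    Rest X U V s \<in> carrier (Sect X V)"
  using rest_hom ring_hom_closed by fast

lemma rest_id [simp]: "is_open X U \<Longrightarrow> s \<in> carrier (Sect X U) \<Longrightarrow> Rest X U U s = s"
  using presheaf unfolding presheaf_of_rings_def by simp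

lemma rest_rest:
  "is_open X U \<Longrightarrow> is_open X V \<Longrightarrow> is_open X W \<Longrightarrow> W \<subseteq> V \<Longrightarrow> V \<subseteq> U \<Longrightarrow> s \<in> carrier (Sect X U) \<Longrightarrow>
    Rest X V W (Rest X U V s) = Rest X U W s"
  using presheaf unfolding presheaf_of_rings_def by simp

lemma rest_eq_mono:
  assumes "is_open X U" "is_open X V" "is_open X W" "is_open X W'" "W \<subseteq> U" "W \<subseteq> V" "W' \<subseteq> W"
    and "s \<in> carrier (Sect X U)" "t \<in> carrier (Sect X V)" "Rest X U W s = Rest X V W t"
  shows "Rest X U W' s = Rest X V W' t"
  using assms rest_rest[of U W W' s] rest_rest[of V W W' t] by auto

text \<open>\<open>germ\<close> is the whole equivalence class of a section near \<open>x\<close>,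
  so it contains its own representative; conversely two agreements compose after shrinking to the
  intersection of the neighbourhoods.\<close>

lemma germ_eq_iff:
  assumes U: "is_open X U" "x \<in> U" "s \<in> carrier (Sect X U)"
    and V: "is_open X V" "x \<in> V" "t \<in> carrier (Sect X V)"
  shows "germ X x U s = germ X x V t \<longleftrightarrow>
    (\<exists>W. is_open X W \<and> x \<in> W \<and> W \<subseteq> U \<inter> V \<and> Rest X U W s = Rest X V W t)"
proof
  assume eq: "germ X x U s = germ X x V t"
  have "(V, t) \<in> germ X x V t"
    unfolding germ_def using V by auto
  then have "(V, t) \<in> germ X x U s" using eq by simp
  then show "\<exists>W. is_open X W \<and> x \<in> W \<and> W \<subseteq> U \<inter> V \<and> Rest X U W s = Rest X V W t"
    unfolding germ_def by simp
next
  have sub: "germ X x V t \<subseteq> germ X x U s"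
    if U: "is_open X U" "x \<in> U" "s \<in> carrier (Sect X U)"
      and V: "is_open X V" "x \<in> V" "t \<in> carrier (Sect X V)"
      and W: "is_open X W" "x \<in> W" "W \<subseteq> U \<inter> V" "Rest X U W s = Rest X V W t"
    for U V W s t
  proof safe
    fix V' t' assume "(V', t') \<in> germ X x V t"
    then obtain W' where V': "is_open X V'" "x \<in> V'" "t' \<in> carrier (Sect X V')"
      and W': "is_open X W'" "x \<in> W'" "W' \<subseteq> V \<inter> V'" "Rest X V W' t = Rest X V' W' t'"
      unfolding germ_def by auto
    have o: "is_open X (W \<inter> W')" using W W' by auto
    have "Rest X U (W \<inter> W') s = Rest X V (W \<inter> W') t"
      by (rule rest_eq_mono[of _ _ W]) (use U V W o in auto)
    also have "\<dots> = Rest X V' (W \<inter> W') t'"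
      by (rule rest_eq_mono[of _ _ W']) (use V V' W' o in auto)
    finally show "(V', t') \<in> germ X x U s"
      unfolding germ_def using V' W W' o by auto
  qed
  assume "\<exists>W. is_open X W \<and> x \<in> W \<and> W \<subseteq> U \<inter> V \<and> Rest X U W s = Rest X V W t"
  then obtain W where "is_open X W" "x \<in> W" "W \<subseteq> U \<inter> V" "Rest X U W s = Rest X V W t" by blast
  then show "germ X x U s = germ X x V t"
    using sub[OF U V, of W] sub[OF V U, of W] by auto
qed

lemma germ_rest:
  assumes "is_open X U" "is_open X V" "x \<in> V" "V \<subseteq> U" "s \<in> carrier (Sect X U)"
  shows "germ X x V (Rest X U V s) = germ X x U s"
proof -
  have "x \<in> U" using assms by blast
  moreover have "Rest X V V (Rest X U V s) = Rest X U V s" using assms by simp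
  ultimately show ?thesis
    using assms germ_eq_iff[of V x "Rest X U V s" U s] rest_closed[of U V s] by blast
qed

lemma stalk_carrierI:
  "is_open X U \<Longrightarrow> x \<in> U \<Longrightarrow> s \<in> carrier (Sect X U) \<Longrightarrow> germ X x U s \<in> carrier (stalk X x)"
  unfolding stalk_def by auto

lemma stalk_carrierE:
  assumes "a \<in> carrier (stalk X x)"
  obtains U s where "is_open X U" "x \<in> U" "s \<in> carrier (Sect X U)" "a = germ X x U s"
  using assms unfolding stalk_def by auto

text \<open>The stalk operations are given by \<open>THE\<close>, so they compute only once
  independence of representatives is known. This follows from naturality under restriction; the
  general \<open>f\<close> serves addition and multiplication alike.\<close>

lemma germ_binop:
  assumes op: "\<And>U s t. is_open X U \<Longrightarrow> s \<in> carrier (Sect X U) \<Longrightarrow> t \<in> carrier (Sect X U) \<Longrightarrow>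
      f U s t \<in> carrier (Sect X U)"
    and nat: "\<And>U V s t. is_open X U \<Longrightarrow> is_open X V \<Longrightarrow> V \<subseteq> U \<Longrightarrow> s \<in> carrier (Sect X U) \<Longrightarrow>
      t \<in> carrier (Sect X U) \<Longrightarrow> Rest X U V (f U s t) = f V (Rest X U V s) (Rest X U V t)"
    and U: "is_open X U" "x \<in> U" "s \<in> carrier (Sect X U)" "t \<in> carrier (Sect X U)"
  shows "(THE c. \<exists>U' s' t'. is_open X U' \<and> x \<in> U' \<and> s' \<in> carrier (Sect X U') \<and>
      t' \<in> carrier (Sect X U') \<and> germ X x U s = germ X x U' s' \<and> germ X x U t = germ X x U' t' \<and>
      c = germ X x U' (f U' s' t')) = germ X x U (f U s t)"
proof (rule the_equality)
  show "\<exists>U' s' t'. is_open X U' \<and> x \<in> U' \<and> s' \<in> carrier (Sect X U') \<and>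
      t' \<in> carrier (Sect X U') \<and> germ X x U s = germ X x U' s' \<and> germ X x U t = germ X x U' t' \<and>
      germ X x U (f U s t) = germ X x U' (f U' s' t')"
    using U by blast
next
  fix c assume "\<exists>U' s' t'. is_open X U' \<and> x \<in> U' \<and> s' \<in> carrier (Sect X U') \<and>
      t' \<in> carrier (Sect X U') \<and> germ X x U s = germ X x U' s' \<and> germ X x U t = germ X x U' t' \<and>
      c = germ X x U' (f U' s' t')"
  then obtain V s' t' where V: "is_open X V" "x \<in> V" "s' \<in> carrier (Sect X V)"
      "t' \<in> carrier (Sect X V)"
    and eq: "germ X x U s = germ X x V s'" "germ X x U t = germ X x V t'"
    and c: "c = germ X x V (f V s' t')" by blast
  obtain W where W: "is_open X W" "x \<in> W" "W \<subseteq> U \<inter> V" "Rest X U W s = Rest X V W s'"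
    using eq(1) U V by (subst (asm) germ_eq_iff) auto
  obtain W' where W': "is_open X W'" "x \<in> W'" "W' \<subseteq> U \<inter> V" "Rest X U W' t = Rest X V W' t'"
    using eq(2) U V by (subst (asm) germ_eq_iff) auto
  let ?W = "W \<inter> W'"
  have o: "is_open X ?W" using W W' by auto
  have 1: "Rest X U ?W s = Rest X V ?W s'"
    by (rule rest_eq_mono[of _ _ W]) (use U V W o in auto)
  have 2: "Rest X U ?W t = Rest X V ?W t'"
    by (rule rest_eq_mono[of _ _ W']) (use U V W' o in auto)
  have "?W \<subseteq> U" "?W \<subseteq> V" using W W' by auto
  then have "Rest X V ?W (f V s' t') = Rest X U ?W (f U s t)"
    using 1 2 nat[of V ?W s' t'] nat[of U ?W s t] U V W W' o by auto
  then show "c = germ X x U (f U s t)"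
    unfolding c using U V W W' o op by (subst germ_eq_iff) (auto intro!: exI[of _ ?W])
qed

lemma germ_mult:
  assumes "is_open X U" "x \<in> U" "s \<in> carrier (Sect X U)" "t \<in> carrier (Sect X U)"
  shows "germ X x U s \<otimes>\<^bsub>stalk X x\<^esub> germ X x U t = germ X x U (s \<otimes>\<^bsub>Sect X U\<^esub> t)"
proof -
  have "s \<otimes>\<^bsub>Sect X U\<^esub> t \<in> carrier (Sect X U)"
    if "is_open X U" "s \<in> carrier (Sect X U)" "t \<in> carrier (Sect X U)" for U s t
    using sect_cring[OF that(1)] that by (simp add: cring.axioms(1) ring.ring_simprules(5))
  from germ_binop[where f = "\<lambda>U. monoid.mult (Sect X U)", OF this _ assms] rest_hom
  show ?thesis unfolding stalk_def by (simp add: ring_hom_mult)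
qed

lemma germ_add:
  assumes "is_open X U" "x \<in> U" "s \<in> carrier (Sect X U)" "t \<in> carrier (Sect X U)"
  shows "germ X x U s \<oplus>\<^bsub>stalk X x\<^esub> germ X x U t = germ X x U (s \<oplus>\<^bsub>Sect X U\<^esub> t)"
proof -
  have "s \<oplus>\<^bsub>Sect X U\<^esub> t \<in> carrier (Sect X U)"
    if "is_open X U" "s \<in> carrier (Sect X U)" "t \<in> carrier (Sect X U)" for U s t
    using sect_cring[OF that(1)] that by (simp add: cring.axioms(1) ring.ring_simprules(1))
  from germ_binop[where f = "\<lambda>U. ring.add (Sect X U)", OF this _ assms] rest_hom
  show ?thesis unfolding stalk_def by (simp add: ring_hom_add)
qed

lemma germ_one:
  assumes "is_open X U" "x \<in> U"
  shows "germ X x U \<one>\<^bsub>Sect X U\<^esub> = \<one>\<^bsub>stalk X x\<^esub>"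
proof -
  interpret S: cring "Sect X (points X)" by (rule sect_cring) simp
  have "U \<subseteq> points X" using assms openin_subset by blast
  then have "germ X x U (Rest X (points X) U \<one>\<^bsub>Sect X (points X)\<^esub>) = \<one>\<^bsub>stalk X x\<^esub>"
    using assms by (subst germ_rest) (auto simp: stalk_def)
  then show ?thesis
    using ring_hom_one[OF rest_hom[of "points X" U]] assms \<open>U \<subseteq> points X\<close> by simp
qed

lemma germ_zero:
  assumes "is_open X U" "x \<in> U"
  shows "germ X x U \<zero>\<^bsub>Sect X U\<^esub> = \<zero>\<^bsub>stalk X x\<^esub>"
proof -
  interpret S: cring "Sect X (points X)" by (rule sect_cring) simp
  interpret T: cring "Sect X U" by (rule sect_cring) fact
  have "U \<subseteq> points X" using assms openin_subset by blast
  then have "germ X x U (Rest X (points X) U \<zero>\<^bsub>Sect X (points X)\<^esub>) = \<zero>\<^bsub>stalk X x\<^esub>"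
    using assms by (subst germ_rest) (auto simp: stalk_def)
  then show ?thesis
    using ring_hom_zero[OF rest_hom[of "points X" U] S.ring_axioms T.ring_axioms] assms
      \<open>U \<subseteq> points X\<close> by simp
qed

lemma stalk_common2:
  assumes "a \<in> carrier (stalk X x)" "b \<in> carrier (stalk X x)"
  obtains U s t where "is_open X U" "x \<in> U" "s \<in> carrier (Sect X U)" "t \<in> carrier (Sect X U)"
    "a = germ X x U s" "b = germ X x U t"
proof -
  obtain U s where U: "is_open X U" "x \<in> U" "s \<in> carrier (Sect X U)" "a = germ X x U s"
    using assms(1) by (rule stalk_carrierE)
  obtain V t where V: "is_open X V" "x \<in> V" "t \<in> carrier (Sect X V)" "b = germ X x V t"
    using assms(2) by (rule stalk_carrierE)
  have o: "is_open X (U \<inter> V)" using U V by auto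
  show thesis
    by (rule that[of "U \<inter> V" "Rest X U (U \<inter> V) s" "Rest X V (U \<inter> V) t"])
      (use U V o in \<open>auto simp: germ_rest\<close>)
qed

lemma stalk_common3:
  assumes "a \<in> carrier (stalk X x)" "b \<in> carrier (stalk X x)" "c \<in> carrier (stalk X x)"
  obtains U s t u where "is_open X U" "x \<in> U" "s \<in> carrier (Sect X U)" "t \<in> carrier (Sect X U)"
    "u \<in> carrier (Sect X U)" "a = germ X x U s" "b = germ X x U t" "c = germ X x U u"
proof -
  obtain U s t where U: "is_open X U" "x \<in> U" "s \<in> carrier (Sect X U)" "t \<in> carrier (Sect X U)"
    "a = germ X x U s" "b = germ X x U t"
    using assms(1,2) by (rule stalk_common2)
  obtain V u where V: "is_open X V" "x \<in> V" "u \<in> carrier (Sect X V)" "c = germ X x V u"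
    using assms(3) by (rule stalk_carrierE)
  have o: "is_open X (U \<inter> V)" using U V by auto
  show thesis
    by (rule that[of "U \<inter> V" "Rest X U (U \<inter> V) s" "Rest X U (U \<inter> V) t" "Rest X V (U \<inter> V) u"])
      (use U V o in \<open>auto simp: germ_rest\<close>)
qed

text \<open>Two or three germs always live over one common neighbourhood, where the axioms are those
  of its ring of sections.\<close>

lemma stalk_cring:
  assumes x: "x \<in> points X"
  shows "cring (stalk X x)"
proof (rule cringI)
  interpret T: cring "Sect X (points X)" by (rule sect_cring) simp
  show "abelian_group (stalk X x)"
  proof (rule abelian_groupI)
    fix a b assume "a \<in> carrier (stalk X x)" "b \<in> carrier (stalk X x)"
    then obtain U s t where U: "is_open X U" "x \<in> U" "s \<in> carrier (Sect X U)"
      "t \<in> carrier (Sect X U)" "a = germ X x U s" "b = germ X x U t" by (rule stalk_common2)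
    interpret S: cring "Sect X U" by (rule sect_cring) fact
    show "a \<oplus>\<^bsub>stalk X x\<^esub> b \<in> carrier (stalk X x)" "a \<oplus>\<^bsub>stalk X x\<^esub> b = b \<oplus>\<^bsub>stalk X x\<^esub> a"
      using U by (auto simp: germ_add stalk_carrierI S.a_comm)
  next
    show "\<zero>\<^bsub>stalk X x\<^esub> \<in> carrier (stalk X x)"
      using stalk_carrierI[of "points X" x "\<zero>\<^bsub>Sect X (points X)\<^esub>"] x
        germ_zero[of "points X" x] by simp
  next
    fix a b c assume "a \<in> carrier (stalk X x)" "b \<in> carrier (stalk X x)" "c \<in> carrier (stalk X x)"
    then obtain U s t u where U: "is_open X U" "x \<in> U" "s \<in> carrier (Sect X U)"
      "t \<in> carrier (Sect X U)" "u \<in> carrier (Sect X U)"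
      "a = germ X x U s" "b = germ X x U t" "c = germ X x U u" by (rule stalk_common3)
    interpret S: cring "Sect X U" by (rule sect_cring) fact
    show "a \<oplus>\<^bsub>stalk X x\<^esub> b \<oplus>\<^bsub>stalk X x\<^esub> c = a \<oplus>\<^bsub>stalk X x\<^esub> (b \<oplus>\<^bsub>stalk X x\<^esub> c)"
      using U by (auto simp: germ_add S.a_assoc)
  next
    fix a assume "a \<in> carrier (stalk X x)"
    then obtain U s where U: "is_open X U" "x \<in> U" "s \<in> carrier (Sect X U)" "a = germ X x U s"
      by (rule stalk_carrierE)
    interpret S: cring "Sect X U" by (rule sect_cring) fact
    show "\<zero>\<^bsub>stalk X x\<^esub> \<oplus>\<^bsub>stalk X x\<^esub> a = a"
      using U germ_add[of U x "\<zero>\<^bsub>Sect X U\<^esub>" s] by (simp add: germ_zero)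
    show "\<exists>y\<in>carrier (stalk X x). y \<oplus>\<^bsub>stalk X x\<^esub> a = \<zero>\<^bsub>stalk X x\<^esub>"
      using U germ_add[of U x "\<ominus>\<^bsub>Sect X U\<^esub> s" s]
      by (intro bexI[of _ "germ X x U (\<ominus>\<^bsub>Sect X U\<^esub> s)"]) (auto simp: germ_zero S.l_neg stalk_carrierI)
  qed
  show "comm_monoid (stalk X x)"
  proof (rule comm_monoidI)
    fix a b assume "a \<in> carrier (stalk X x)" "b \<in> carrier (stalk X x)"
    then obtain U s t where U: "is_open X U" "x \<in> U" "s \<in> carrier (Sect X U)"
      "t \<in> carrier (Sect X U)" "a = germ X x U s" "b = germ X x U t" by (rule stalk_common2)
    interpret S: cring "Sect X U" by (rule sect_cring) fact
    show "a \<otimes>\<^bsub>stalk X x\<^esub> b \<in> carrier (stalk X x)" "a \<otimes>\<^bsub>stalk X x\<^esub> b = b \<otimes>\<^bsub>stalk X x\<^esub> a"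
      using U by (auto simp: germ_mult stalk_carrierI S.m_comm)
  next
    show "\<one>\<^bsub>stalk X x\<^esub> \<in> carrier (stalk X x)"
      using stalk_carrierI[of "points X" x "\<one>\<^bsub>Sect X (points X)\<^esub>"] x
        germ_one[of "points X" x] by simp
  next
    fix a b c assume "a \<in> carrier (stalk X x)" "b \<in> carrier (stalk X x)" "c \<in> carrier (stalk X x)"
    then obtain U s t u where U: "is_open X U" "x \<in> U" "s \<in> carrier (Sect X U)"
      "t \<in> carrier (Sect X U)" "u \<in> carrier (Sect X U)"
      "a = germ X x U s" "b = germ X x U t" "c = germ X x U u" by (rule stalk_common3)
    interpret S: cring "Sect X U" by (rule sect_cring) fact
    show "a \<otimes>\<^bsub>stalk X x\<^esub> b \<otimes>\<^bsub>stalk X x\<^esub> c = a \<otimes>\<^bsub>stalk X x\<^esub> (b \<otimes>\<^bsub>stalk X x\<^esub> c)"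
      using U by (auto simp: germ_mult S.m_assoc)
  next
    fix a assume "a \<in> carrier (stalk X x)"
    then obtain U s where U: "is_open X U" "x \<in> U" "s \<in> carrier (Sect X U)" "a = germ X x U s"
      by (rule stalk_carrierE)
    interpret S: cring "Sect X U" by (rule sect_cring) fact
    show "\<one>\<^bsub>stalk X x\<^esub> \<otimes>\<^bsub>stalk X x\<^esub> a = a"
      using U germ_mult[of U x "\<one>\<^bsub>Sect X U\<^esub>" s] by (simp add: germ_one)
  qed
  fix a b c assume "a \<in> carrier (stalk X x)" "b \<in> carrier (stalk X x)" "c \<in> carrier (stalk X x)"
  then obtain U s t u where U: "is_open X U" "x \<in> U" "s \<in> carrier (Sect X U)"
    "t \<in> carrier (Sect X U)" "u \<in> carrier (Sect X U)"
    "a = germ X x U s" "b = germ X x U t" "c = germ X x U u" by (rule stalk_common3)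
  interpret S: cring "Sect X U" by (rule sect_cring) fact
  show "(a \<oplus>\<^bsub>stalk X x\<^esub> b) \<otimes>\<^bsub>stalk X x\<^esub> c =
      a \<otimes>\<^bsub>stalk X x\<^esub> c \<oplus>\<^bsub>stalk X x\<^esub> b \<otimes>\<^bsub>stalk X x\<^esub> c"
    using U by (auto simp: germ_mult germ_add S.l_distr)
qed

lemma germ_hom:
  assumes "is_open X U" "x \<in> U"
  shows "germ X x U \<in> ring_hom (Sect X U) (stalk X x)"
  using assms by (intro ring_hom_memI) (auto simp: stalk_carrierI germ_mult germ_add germ_one)

end

section \<open>Affine charts and the function field\<close>

text \<open>Serves the primes below (nonunits, contractions, positivity loci of valuations,
  splitting ideals), each of which sits in a subring of the function field. Closure under negation
  comes from -q = (-1) q.\<close>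

lemma (in cring) primeideal_subringI:
  assumes A: "subring A R" and Q: "Q \<subseteq> A" "\<zero> \<in> Q" "\<one> \<notin> Q"
    and add: "\<And>a b. a \<in> Q \<Longrightarrow> b \<in> Q \<Longrightarrow> a \<oplus> b \<in> Q"
    and mult: "\<And>a b. a \<in> A \<Longrightarrow> b \<in> Q \<Longrightarrow> a \<otimes> b \<in> Q"
    and prime: "\<And>a b. a \<in> A \<Longrightarrow> b \<in> A \<Longrightarrow> a \<otimes> b \<in> Q \<Longrightarrow> a \<in> Q \<or> b \<in> Q"
  shows "primeideal Q (R\<lparr>carrier := A\<rparr>)"
proof -
  let ?S = "R\<lparr>carrier := A\<rparr>"
  interpret S: cring ?S
    using A subcring_iff subcringI' subringE(1) by blast
  have "\<ominus>\<^bsub>?S\<^esub> q \<in> Q" if "q \<in> Q" for q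
  proof -
    have "(\<ominus>\<^bsub>?S\<^esub> \<one>\<^bsub>?S\<^esub>) \<otimes>\<^bsub>?S\<^esub> q = \<ominus>\<^bsub>?S\<^esub> q"
      using that Q S.l_minus[of "\<one>\<^bsub>?S\<^esub>" q] S.one_closed S.l_one[of q] by auto
    moreover have "\<ominus>\<^bsub>?S\<^esub> \<one>\<^bsub>?S\<^esub> \<in> A" using S.one_closed S.a_inv_closed by simp
    ultimately show ?thesis using mult[of "\<ominus>\<^bsub>?S\<^esub> \<one>\<^bsub>?S\<^esub>" q] that by simp
  qed
  then have "subgroup Q (add_monoid ?S)"
    using Q add by (intro S.add.subgroupI) (auto simp: a_inv_def)
  then have "additive_subgroup Q ?S" by (rule additive_subgroupI)
  moreover have "a \<otimes> x \<in> Q" if "a \<in> Q" "x \<in> A" for a x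
    using mult[of x a] that Q S.m_comm[of a x] by auto
  moreover have "A \<noteq> Q" using Q S.one_closed by auto
  ultimately show ?thesis
    using mult prime by (intro primeidealI2) (auto intro: S.is_cring)
qed

section \<open>The topology of the prime spectrum\<close>

lemma topspace_spec_topology: "topspace (spec_topology R) = {P. primeideal P R}"
proof -
  have "\<exists>f\<in>carrier R. f \<notin> P" if "primeideal P R" for P
  proof -
    interpret primeideal P R by fact
    show ?thesis using I_notcarr a_subset by auto
  qed
  then show ?thesis unfolding spec_topology_def by auto
qed

lemma openin_spec_topology_basis:
  "f \<in> carrier R \<Longrightarrow> openin (spec_topology R) {P. primeideal P R \<and> f \<notin> P}"
  unfolding spec_topology_def by (rule topology_generated_by_Basis) auto

text \<open>The generating sets D(f) and D(h) meet in D(f h), which still contains \<open>P\<close>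
  because \<open>P\<close> is prime.\<close>

lemma spec_topology_basis:
  assumes "openin (spec_topology R) W" "P \<in> W"
  shows "\<exists>f\<in>carrier R. f \<notin> P \<and> {Q. primeideal Q R \<and> f \<notin> Q} \<subseteq> W"
proof -
  have P: "primeideal P R"
    using assms openin_subset[OF assms(1)] by (auto simp: topspace_spec_topology)
  interpret primeideal P R by fact
  have "generate_topology_on ((\<lambda>f. {P. primeideal P R \<and> f \<notin> P}) ` carrier R) W"
    using assms(1) unfolding spec_topology_def by (rule openin_topology_generated_by)
  then show ?thesis using assms(2)
  proof (induction)
    case (Int a b)
    then obtain f h where fh: "f \<in> carrier R" "f \<notin> P" "{Q. primeideal Q R \<and> f \<notin> Q} \<subseteq> a"
      "h \<in> carrier R" "h \<notin> P" "{Q. primeideal Q R \<and> h \<notin> Q} \<subseteq> b" by blast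
    have "f \<notin> Q \<and> h \<notin> Q" if "primeideal Q R" "f \<otimes>\<^bsub>R\<^esub> h \<notin> Q" for Q
    proof -
      interpret Q: primeideal Q R by fact
      show ?thesis using that fh Q.I_l_closed Q.I_r_closed by blast
    qed
    then have "{Q. primeideal Q R \<and> f \<otimes>\<^bsub>R\<^esub> h \<notin> Q} \<subseteq> a \<inter> b" using fh by auto
    moreover have "f \<otimes>\<^bsub>R\<^esub> h \<notin> P" using I_prime fh by blast
    ultimately show ?case using fh m_closed by blast
  next
    case (UN F)
    then obtain W where "W \<in> F" "P \<in> W" by blast
    with UN(2)[of W] show ?case by blast
  qed auto
qed

text \<open>The homeomorphism witnessing that \<open>U\<close> is affine, with its continuity reduced to the
  distinguished open sets.\<close>

definition affine_chart :: "('x, 'a) ringed_space \<Rightarrow> 'x set \<Rightarrow> ('x \<Rightarrow> 'a set) \<Rightarrow> bool" where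
  "affine_chart X U h \<longleftrightarrow> is_open X U \<and> bij_betw h U {P. primeideal P (Sect X U)} \<and>
    (\<forall>f\<in>carrier (Sect X U). is_open X {x\<in>U. f \<notin> h x} \<and>
      localization_away (Sect X U) f (Sect X {x\<in>U. f \<notin> h x}) (Rest X U {x\<in>U. f \<notin> h x})) \<and>
    (\<forall>x W. is_open X W \<and> x \<in> W \<and> x \<in> U \<longrightarrow>
      (\<exists>f\<in>carrier (Sect X U). f \<notin> h x \<and> {y\<in>U. f \<notin> h y} \<subseteq> W))"

lemma affine_chartD:
  assumes "affine_chart X U h"
  shows "is_open X U" "bij_betw h U {P. primeideal P (Sect X U)}"
    "\<And>f. f \<in> carrier (Sect X U) \<Longrightarrow> is_open X {x\<in>U. f \<notin> h x}"
    "\<And>f. f \<in> carrier (Sect X U) \<Longrightarrow>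
      localization_away (Sect X U) f (Sect X {x\<in>U. f \<notin> h x}) (Rest X U {x\<in>U. f \<notin> h x})"
    "\<And>x W. is_open X W \<Longrightarrow> x \<in> W \<Longrightarrow> x \<in> U \<Longrightarrow>
      \<exists>f\<in>carrier (Sect X U). f \<notin> h x \<and> {y\<in>U. f \<notin> h y} \<subseteq> W"
  using assms unfolding affine_chart_def by simp_all

lemma affine_chart_prime: "affine_chart X U h \<Longrightarrow> x \<in> U \<Longrightarrow> primeideal (h x) (Sect X U)"
  using affine_chartD(2) unfolding bij_betw_def by blast

lemma affine_chart_exists:
  assumes "affine_open X U"
  shows "\<exists>h. affine_chart X U h"
proof -
  from assms obtain h where U: "is_open X U"
    and h: "homeomorphic_map (subtopology (Space X) U) (spec_topology (Sect X U)) h"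
    and loc: "\<forall>f\<in>carrier (Sect X U).
           localization_away (Sect X U) f (Sect X {x\<in>U. f \<notin> h x}) (Rest X U {x\<in>U. f \<notin> h x})"
    unfolding affine_open_def by auto
  have topU: "topspace (subtopology (Space X) U) = U"
    using openin_subset[OF U] by auto
  have bij: "bij_betw h U {P. primeideal P (Sect X U)}"
    using homeomorphic_imp_surjective_map[OF h] homeomorphic_imp_injective_map[OF h]
    unfolding topU topspace_spec_topology bij_betw_def by simp
  have prime: "primeideal (h x) (Sect X U)" if "x \<in> U" for x
    using bij that unfolding bij_betw_def by blast
  have op: "is_open X V \<longleftrightarrow> openin (spec_topology (Sect X U)) (h ` V)" if "V \<subseteq> U" for V
    using homeomorphic_map_openness[OF h, of V] that U topU
    by (auto simp: openin_open_subtopology)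
  have img: "h ` {x\<in>U. f \<notin> h x} = {P. primeideal P (Sect X U) \<and> f \<notin> P}" for f
  proof -
    have "h ` {x\<in>U. f \<notin> h x} = {P \<in> h ` U. f \<notin> P}" by blast
    then show ?thesis using bij unfolding bij_betw_def by simp
  qed
  have "is_open X {x\<in>U. f \<notin> h x}" if "f \<in> carrier (Sect X U)" for f
      using op[of "{x\<in>U. f \<notin> h x}"] openin_spec_topology_basis[OF that] img by auto
  moreover have "\<exists>f\<in>carrier (Sect X U). f \<notin> h x \<and> {y\<in>U. f \<notin> h y} \<subseteq> W"
      if "is_open X W" "x \<in> W" "x \<in> U" for x W
    proof -
      have "openin (spec_topology (Sect X U)) (h ` (W \<inter> U))"
        using that U op[of "W \<inter> U"] by auto
      from spec_topology_basis[OF this, of "h x"] that obtain f where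
        f: "f \<in> carrier (Sect X U)" "f \<notin> h x" "{Q. primeideal Q (Sect X U) \<and> f \<notin> Q} \<subseteq> h ` (W \<inter> U)"
        by auto
      have "y \<in> W" if "y \<in> U" "f \<notin> h y" for y
      proof -
        have "h y \<in> h ` (W \<inter> U)" using that f(3) prime[of y] by blast
        then obtain z where "z \<in> W" "z \<in> U" "h y = h z" by blast
        then show ?thesis using inj_onD[OF bij_betw_imp_inj_on[OF bij], of y z] that by simp
      qed
      with f show ?thesis by auto
    qed
  ultimately have "affine_chart X U h" unfolding affine_chart_def using U bij loc by simp
  then show ?thesis by blast
qed

lemma in_closure_pt_iff:
  "x \<in> closure_pt X y \<longleftrightarrow> x \<in> points X \<and> (\<forall>W. is_open X W \<and> x \<in> W \<longrightarrow> y \<in> W)"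
  by (auto simp: in_closure_of)

locale integral_space =
  fixes X :: "('x, 'a) ringed_space"
  assumes integral: "integral_scheme X"
begin

abbreviation "g \<equiv> generic_point X"
abbreviation "K \<equiv> function_field X"
abbreviation "\<R> \<equiv> local_ring X"
abbreviation "\<M> \<equiv> max_ideal X"

lemma sheaf: "sheaf_of_rings X"
  using integral unfolding integral_scheme_def scheme_def by simp

sublocale ring_presheaf X
  using sheaf unfolding sheaf_of_rings_def by unfold_locales simp

lemma affine_nbhd: "x \<in> points X \<Longrightarrow> \<exists>U. affine_open X U \<and> x \<in> U"
  using integral unfolding integral_scheme_def scheme_def by simp

lemma sect_domain: "is_open X U \<Longrightarrow> U \<noteq> {} \<Longrightarrow> domain (Sect X U)"
  using integral unfolding integral_scheme_def by simp

section \<open>Gluing, irreducibility and the generic point\<close>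

lemma sect_eqI:
  assumes "\<And>U. U \<in> \<U> \<Longrightarrow> is_open X U" "s \<in> carrier (Sect X (\<Union>\<U>))" "t \<in> carrier (Sect X (\<Union>\<U>))"
    "\<And>U. U \<in> \<U> \<Longrightarrow> Rest X (\<Union>\<U>) U s = Rest X (\<Union>\<U>) U t"
  shows "s = t"
  using conjunct2[OF sheaf[unfolded sheaf_of_rings_def], rule_format, of \<U>] assms by auto

lemma sect_glue:
  assumes "\<And>U. U \<in> \<U> \<Longrightarrow> is_open X U" "\<And>U. U \<in> \<U> \<Longrightarrow> s U \<in> carrier (Sect X U)"
    "\<And>U V. U \<in> \<U> \<Longrightarrow> V \<in> \<U> \<Longrightarrow> Rest X U (U \<inter> V) (s U) = Rest X V (U \<inter> V) (s V)"
  shows "\<exists>t\<in>carrier (Sect X (\<Union>\<U>)). \<forall>U\<in>\<U>. Rest X (\<Union>\<U>) U t = s U"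
proof -
  have "\<forall>U\<in>\<U>. is_open X U" using assms(1) by blast
  from conjunct2[OF conjunct2[OF sheaf[unfolded sheaf_of_rings_def], rule_format, of \<U>]] this
  have "(\<forall>s. (\<forall>U\<in>\<U>. s U \<in> carrier (Sect X U)) \<and>
             (\<forall>U\<in>\<U>. \<forall>V\<in>\<U>. Rest X U (U \<inter> V) (s U) = Rest X V (U \<inter> V) (s V)) \<longrightarrow>
             (\<exists>t\<in>carrier (Sect X (\<Union>\<U>)). \<forall>U\<in>\<U>. Rest X (\<Union>\<U>) U t = s U))"
    by simp
  from this[THEN spec, THEN mp, of s] show ?thesis using assms(2,3) by blast
qed

text \<open>The empty cover makes all sections over the empty set equal, so sections over disjoint
  open sets agree on the overlap automatically.\<close>

lemma sect_glue_disjoint: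
  assumes "is_open X U" "is_open X V" "U \<inter> V = {}" "U \<noteq> V"
    "s \<in> carrier (Sect X U)" "t \<in> carrier (Sect X V)"
  shows "\<exists>r\<in>carrier (Sect X (U \<union> V)). Rest X (U \<union> V) U r = s \<and> Rest X (U \<union> V) V r = t"
proof -
  have empty: "a = b" if "a \<in> carrier (Sect X {})" "b \<in> carrier (Sect X {})" for a b
    using sect_eqI[of "{}" a b] that by simp
  \<comment> \<open>Families of sections are indexed by open sets; \<open>U \<noteq> V\<close>
    excludes the case of both being empty, where \<open>s\<close> and \<open>t\<close> would compete
    for one index.\<close>
  define \<sigma> where "\<sigma> = (\<lambda>W. if W = U then s else t)"
  have \<sigma>: "\<sigma> U = s" "\<sigma> V = t" using assms(4) by (auto simp: \<sigma>_def)
  have "Rest X A (A \<inter> B) (\<sigma> A) = Rest X B (A \<inter> B) (\<sigma> B)"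
    if "A \<in> {U, V}" "B \<in> {U, V}" for A B
  proof (cases "A = B")
    case False
    then have "A \<inter> B = {}" using that assms by auto
    moreover have "is_open X {}" by simp
    ultimately show ?thesis using that assms \<sigma> by (intro empty) auto
  qed simp
  then have "\<exists>r\<in>carrier (Sect X (\<Union>{U, V})). \<forall>W\<in>{U, V}. Rest X (\<Union>{U, V}) W r = \<sigma> W"
    using assms \<sigma> by (intro sect_glue) blast+
  then show ?thesis using \<sigma> by simp
qed

text \<open>Over a disjoint union of two open sets, \<open>(1, 0)\<close> and \<open>(0, 1)\<close> glue to zero divisors.\<close>

lemma irreducible:
  assumes U: "is_open X U" "U \<noteq> {}" and V: "is_open X V" "V \<noteq> {}"
  shows "U \<inter> V \<noteq> {}"
proof
  assume disj: "U \<inter> V = {}"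
  let ?W = "U \<union> V"
  have W: "is_open X ?W" "?W \<noteq> {}" using assms by auto
  interpret W: domain "Sect X ?W" by (rule sect_domain) (use W in auto)
  interpret U: domain "Sect X U" by (rule sect_domain) (use U in auto)
  interpret V: domain "Sect X V" by (rule sect_domain) (use V in auto)
  have ne: "U \<noteq> V" using U V disj by auto
  obtain a where a: "a \<in> carrier (Sect X ?W)" "Rest X ?W U a = \<one>\<^bsub>Sect X U\<^esub>"
    "Rest X ?W V a = \<zero>\<^bsub>Sect X V\<^esub>"
    using sect_glue_disjoint[OF U(1) V(1) disj ne U.one_closed V.zero_closed] by auto
  obtain b where b: "b \<in> carrier (Sect X ?W)" "Rest X ?W U b = \<zero>\<^bsub>Sect X U\<^esub>"
    "Rest X ?W V b = \<one>\<^bsub>Sect X V\<^esub>"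
    using sect_glue_disjoint[OF U(1) V(1) disj ne U.zero_closed V.one_closed] by auto
  have hU: "Rest X ?W U \<in> ring_hom (Sect X ?W) (Sect X U)"
    and hV: "Rest X ?W V \<in> ring_hom (Sect X ?W) (Sect X V)"
    using rest_hom W U V by auto
  have zU: "Rest X ?W U \<zero>\<^bsub>Sect X ?W\<^esub> = \<zero>\<^bsub>Sect X U\<^esub>"
    by (rule ring_hom_zero[OF hU]) unfold_locales
  have zV: "Rest X ?W V \<zero>\<^bsub>Sect X ?W\<^esub> = \<zero>\<^bsub>Sect X V\<^esub>"
    by (rule ring_hom_zero[OF hV]) unfold_locales
  have "a \<otimes>\<^bsub>Sect X ?W\<^esub> b = \<zero>\<^bsub>Sect X ?W\<^esub>"
    by (rule sect_eqI[of "{U, V}"])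
      (use a b U V zU zV in \<open>auto simp: ring_hom_mult[OF hU] ring_hom_mult[OF hV]\<close>)
  then have "a = \<zero>\<^bsub>Sect X ?W\<^esub> \<or> b = \<zero>\<^bsub>Sect X ?W\<^esub>"
    using W.integral a b by blast
  then show False using a b zU zV U.one_not_zero V.one_not_zero by auto
qed

lemma closure_pt_eq_points_iff:
  "y \<in> points X \<and> closure_pt X y = points X \<longleftrightarrow> (\<forall>W. is_open X W \<and> W \<noteq> {} \<longrightarrow> y \<in> W)"
proof
  assume "y \<in> points X \<and> closure_pt X y = points X"
  then show "\<forall>W. is_open X W \<and> W \<noteq> {} \<longrightarrow> y \<in> W"
    using openin_subset[of "Space X"] in_closure_pt_iff[of _ X y] by blast
next
  assume *: "\<forall>W. is_open X W \<and> W \<noteq> {} \<longrightarrow> y \<in> W"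
  moreover have "points X \<noteq> {}" using integral unfolding integral_scheme_def by simp
  ultimately have "y \<in> points X" by blast
  moreover have "closure_pt X y = points X"
    using * in_closure_pt_iff[of _ X y] by blast
  ultimately show "y \<in> points X \<and> closure_pt X y = points X" by simp
qed

text \<open>For nonzero \<open>f\<close> the locus where \<open>f\<close> avoids the prime is open
  and contains the point of the zero prime. Being nonempty it contains \<open>y\<close>, so
  \<open>f\<close> is not in \<open>h y\<close>.\<close>

lemma generic_prime:
  assumes y: "\<forall>W. is_open X W \<and> W \<noteq> {} \<longrightarrow> y \<in> W"
    and h: "affine_chart X U h" and ne: "U \<noteq> {}"
  shows "h y = {\<zero>\<^bsub>Sect X U\<^esub>}"
proof -
  note U = affine_chartD(1)[OF h] ne
  interpret domain "Sect X U" using U by (rule sect_domain)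
  have "y \<in> U" using y U by blast
  then interpret P: primeideal "h y" "Sect X U" by (rule affine_chart_prime[OF h])
  obtain z where z: "z \<in> U" "h z = {\<zero>\<^bsub>Sect X U\<^esub>}"
    using affine_chartD(2)[OF h] zeroprimeideal unfolding bij_betw_def by (metis (no_types, lifting) imageE mem_Collect_eq)
  have "f = \<zero>\<^bsub>Sect X U\<^esub>" if "f \<in> h y" for f
  proof (rule ccontr)
    assume "f \<noteq> \<zero>\<^bsub>Sect X U\<^esub>"
    then have "z \<in> {x\<in>U. f \<notin> h x}" using z by simp
    then have "y \<in> {x\<in>U. f \<notin> h x}"
      using y affine_chartD(3)[OF h, of f] that P.a_subset by blast
    then show False using that by simp
  qed
  then show ?thesis using P.zero_closed by blast
qed

text \<open>The candidate is the point of the zero ideal in one chart \<open>U\<close>. By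
  irreducibility every nonempty open set meets \<open>U\<close>, hence contains a D(f) with
  \<open>f\<close> nonzero, hence this point; \<open>generic_prime\<close> gives uniqueness.\<close>

lemma generic_point_in_opens: "\<forall>W. is_open X W \<and> W \<noteq> {} \<longrightarrow> g \<in> W"
proof -
  obtain x where x: "x \<in> points X"
    using integral unfolding integral_scheme_def by blast
  obtain U where "affine_open X U" "x \<in> U" using affine_nbhd[OF x] by auto
  then obtain h where h: "affine_chart X U h" using affine_chart_exists by blast
  note U = affine_chartD(1)[OF h]
  have Une: "U \<noteq> {}" using \<open>x \<in> U\<close> by blast
  interpret domain "Sect X U" using U Une by (rule sect_domain)
  obtain z where z: "z \<in> U" "h z = {\<zero>\<^bsub>Sect X U\<^esub>}"
    using affine_chartD(2)[OF h] zeroprimeideal unfolding bij_betw_def by (metis (no_types, lifting) imageE mem_Collect_eq)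
  have zW: "\<forall>W. is_open X W \<and> W \<noteq> {} \<longrightarrow> z \<in> W"
  proof (intro allI impI)
    fix W assume W: "is_open X W \<and> W \<noteq> {}"
    then obtain y' where y': "y' \<in> U" "y' \<in> W" using irreducible[OF U Une] by blast
    then obtain f where f: "f \<in> carrier (Sect X U)" "f \<notin> h y'" "{y\<in>U. f \<notin> h y} \<subseteq> W"
      using affine_chartD(5)[OF h] W by blast
    interpret P: primeideal "h y'" "Sect X U" using y'(1) by (rule affine_chart_prime[OF h])
    have "f \<noteq> \<zero>\<^bsub>Sect X U\<^esub>" using f P.zero_closed by blast
    then show "z \<in> W" using f z by blast
  qed
  have "generic_point X = z"
    unfolding generic_point_def closure_pt_eq_points_iff
  proof (rule the_equality)
    fix y assume y: "\<forall>W. is_open X W \<and> W \<noteq> {} \<longrightarrow> y \<in> W"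
    then have "h y = h z" using generic_prime[OF y h Une] z by simp
    moreover have "y \<in> U" using y U Une by blast
    ultimately show "y = z" using affine_chartD(2)[OF h] z(1) unfolding bij_betw_def inj_on_def by blast
  qed (fact zW)
  then show ?thesis using zW by simp
qed

lemma generic_in: "is_open X U \<Longrightarrow> x \<in> U \<Longrightarrow> g \<in> U"
  using generic_point_in_opens by blast

lemma generic_point: "g \<in> points X"
  using generic_point_in_opens closure_pt_eq_points_iff by blast

text \<open>Sections agreeing near the generic point agree on some D(f) with \<open>f\<close>
  nonzero. Localization then yields a power of \<open>f\<close> killing their difference, and the
  ring is a domain.\<close>

lemma chart_germ_inj:
  assumes h: "affine_chart X U h" and ne: "U \<noteq> {}"
  shows "inj_on (germ X g U) (carrier (Sect X U))"
proof (rule inj_onI)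
  note U = affine_chartD(1)[OF h]
  have gU: "g \<in> U" using generic_point_in_opens U ne by blast
  interpret domain "Sect X U" using U ne by (rule sect_domain)
  fix s t assume st: "s \<in> carrier (Sect X U)" "t \<in> carrier (Sect X U)"
    and eq: "germ X g U s = germ X g U t"
  then obtain W where W: "is_open X W" "g \<in> W" "W \<subseteq> U" "Rest X U W s = Rest X U W t"
    using germ_eq_iff[OF U gU st(1) U gU st(2)] by auto
  obtain f where f: "f \<in> carrier (Sect X U)" "f \<notin> h g" "{y\<in>U. f \<notin> h y} \<subseteq> W"
    using affine_chartD(5)[OF h W(1,2) gU] by blast
  let ?D = "{y\<in>U. f \<notin> h y}"
  have D: "is_open X ?D" "g \<in> ?D" using affine_chartD(3)[OF h f(1)] f gU by auto
  interpret D: domain "Sect X ?D" by (rule sect_domain) (use D in auto)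
  have hom: "Rest X U ?D \<in> ring_hom (Sect X U) (Sect X ?D)"
    using rest_hom[OF U D(1)] by auto
  interpret hom: ring_hom_ring "Sect X U" "Sect X ?D" "Rest X U ?D"
    by (rule ring_hom_ringI2) (use hom in \<open>auto intro: ring_axioms D.ring_axioms\<close>)
  have "Rest X U ?D s = Rest X U ?D t"
    by (rule rest_eq_mono[of _ _ W]) (use W U D f st in auto)
  then have "Rest X U ?D (s \<ominus>\<^bsub>Sect X U\<^esub> t) = \<zero>\<^bsub>Sect X ?D\<^esub>"
    using st by (simp add: a_minus_def hom.hom_add hom.hom_a_inv D.r_neg)
  then obtain n :: nat where
    "f [^]\<^bsub>Sect X U\<^esub> n \<otimes>\<^bsub>Sect X U\<^esub> (s \<ominus>\<^bsub>Sect X U\<^esub> t) = \<zero>\<^bsub>Sect X U\<^esub>"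
    using affine_chartD(4)[OF h f(1)] st unfolding localization_away_def by (meson minus_closed)
  moreover have "f \<noteq> \<zero>\<^bsub>Sect X U\<^esub>"
    using f(2) generic_prime[OF generic_point_in_opens h ne] by auto
  then have "f [^]\<^bsub>Sect X U\<^esub> n \<noteq> \<zero>\<^bsub>Sect X U\<^esub>"
    using f(1) by (induction n) (auto simp: integral_iff)
  ultimately have "s \<ominus>\<^bsub>Sect X U\<^esub> t = \<zero>\<^bsub>Sect X U\<^esub>"
    using integral_iff f st by (meson minus_closed nat_pow_closed)
  then show "s = t" using st by simp
qed

lemma chart_unit:
  assumes h: "affine_chart X U h" and x: "x \<in> U" and f: "f \<in> carrier (Sect X U)" "f \<notin> h x"
  shows "\<exists>W b. is_open X W \<and> x \<in> W \<and> b \<in> carrier (Sect X W) \<and>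
    germ X g U f \<otimes>\<^bsub>stalk X g\<^esub> germ X g W b = \<one>\<^bsub>stalk X g\<^esub>"
proof -
  note U = affine_chartD(1)[OF h]
  let ?D = "{x\<in>U. f \<notin> h x}"
  have D: "is_open X ?D" "x \<in> ?D" "?D \<subseteq> U" using affine_chartD(3)[OF h f(1)] x f by auto
  have gD: "g \<in> ?D" by (rule generic_in[OF D(1,2)])
  interpret D: domain "Sect X ?D" by (rule sect_domain) (use D in auto)
  have "Rest X U ?D f \<in> Units (Sect X ?D)"
    using affine_chartD(4)[OF h f(1)] unfolding localization_away_def by blast
  then obtain b where b: "b \<in> carrier (Sect X ?D)"
    "Rest X U ?D f \<otimes>\<^bsub>Sect X ?D\<^esub> b = \<one>\<^bsub>Sect X ?D\<^esub>" unfolding Units_def by auto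
  have "germ X g U f = germ X g ?D (Rest X U ?D f)"
    using germ_rest[OF U D(1) gD D(3) f(1)] by simp
  then have "germ X g U f \<otimes>\<^bsub>stalk X g\<^esub> germ X g ?D b = \<one>\<^bsub>stalk X g\<^esub>"
    using germ_mult[OF D(1) gD _ b(1)] b(2) rest_closed[OF U D(1,3) f(1)] germ_one[OF D(1) gD]
    by simp
  then show ?thesis using D b by blast
qed

text \<open>A neighbourhood of \<open>x\<close> contains some D(f), where sections are fractions
  \<open>s / f^n\<close>, and \<open>f^n\<close> avoids the prime of \<open>x\<close>. Stating the
  equation in the stalk at the generic point absorbs all restrictions.\<close>

lemma chart_fraction:
  assumes h: "affine_chart X U h" and x: "x \<in> U"
    and V: "is_open X V" "x \<in> V" "t \<in> carrier (Sect X V)"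
  shows "\<exists>s\<in>carrier (Sect X U). \<exists>f\<in>carrier (Sect X U). f \<notin> h x \<and>
    germ X g V t \<otimes>\<^bsub>stalk X g\<^esub> germ X g U f = germ X g U s"
proof -
  note U = affine_chartD(1)[OF h]
  interpret U: domain "Sect X U" by (rule sect_domain) (use U x in auto)
  obtain f where f: "f \<in> carrier (Sect X U)" "f \<notin> h x" "{y\<in>U. f \<notin> h y} \<subseteq> V"
    using affine_chartD(5)[OF h V(1,2) x] by blast
  let ?D = "{x\<in>U. f \<notin> h x}"
  have D: "is_open X ?D" "x \<in> ?D" "?D \<subseteq> U" using affine_chartD(3)[OF h f(1)] x f by auto
  have gD: "g \<in> ?D" by (rule generic_in[OF D(1,2)])
  interpret D: domain "Sect X ?D" by (rule sect_domain) (use D in auto)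
  have hom: "Rest X U ?D \<in> ring_hom (Sect X U) (Sect X ?D)" using rest_hom[OF U D(1,3)] .
  interpret hom: ring_hom_ring "Sect X U" "Sect X ?D" "Rest X U ?D"
    by (rule ring_hom_ringI2) (use hom in \<open>auto intro: U.ring_axioms D.ring_axioms\<close>)
  have t: "Rest X V ?D t \<in> carrier (Sect X ?D)" using V D f by auto
  then obtain s n where s: "s \<in> carrier (Sect X U)"
    "Rest X V ?D t \<otimes>\<^bsub>Sect X ?D\<^esub> Rest X U ?D f [^]\<^bsub>Sect X ?D\<^esub> (n::nat) = Rest X U ?D s"
    using affine_chartD(4)[OF h f(1)] unfolding localization_away_def by blast
  interpret P: primeideal "h x" "Sect X U" using x by (rule affine_chart_prime[OF h])
  have fn: "f [^]\<^bsub>Sect X U\<^esub> n \<notin> h x"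
  proof (induction n)
    case 0
    then show ?case using P.I_notcarr P.one_imp_carrier by auto
  next
    case (Suc n)
    then show ?case using P.I_prime[of "f [^]\<^bsub>Sect X U\<^esub> n" f] f by auto
  qed
  have "germ X g V t \<otimes>\<^bsub>stalk X g\<^esub> germ X g U (f [^]\<^bsub>Sect X U\<^esub> n) =
      germ X g ?D (Rest X V ?D t) \<otimes>\<^bsub>stalk X g\<^esub> germ X g ?D (Rest X U ?D (f [^]\<^bsub>Sect X U\<^esub> n))"
    using V D f U gD by (simp add: germ_rest)
  also have "\<dots> = germ X g ?D (Rest X U ?D s)"
    using s(2) f(1) t D germ_mult[OF D(1) gD t] hom.hom_closed
    by (simp add: hom.hom_nat_pow)
  also have "\<dots> = germ X g U s" using germ_rest[OF U D(1) gD D(3) s(1)] .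
  finally show ?thesis using s(1) fn f(1) by blast
qed

text \<open>At the generic point the prime of a chart is zero, so every nonzero section of the chart
  becomes a unit, and every germ is a quotient of two sections.\<close>

sublocale K: field K
proof -
  interpret cring "stalk X g" by (rule stalk_cring) (rule generic_point)
  have "field (stalk X g)"
  proof (rule cring_fieldI2)
    obtain U where aff: "affine_open X U" "g \<in> U" using affine_nbhd[OF generic_point] by auto
    then have U: "is_open X U" unfolding affine_open_def by simp
    interpret U: domain "Sect X U" by (rule sect_domain) (use U aff in auto)
    from aff obtain h where h: "affine_chart X U h" using affine_chart_exists by blast
    show "\<zero>\<^bsub>stalk X g\<^esub> \<noteq> \<one>\<^bsub>stalk X g\<^esub>"
      using chart_germ_inj[OF h] aff(2) germ_zero[OF U aff(2)] germ_one[OF U aff(2)]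
        U.one_not_zero unfolding inj_on_def
      by (metis U.one_closed U.zero_closed emptyE)
    have hg: "h g = {\<zero>\<^bsub>Sect X U\<^esub>}"
      by (rule generic_prime[OF generic_point_in_opens h]) (use aff in auto)
    have unit: "\<exists>b\<in>carrier (stalk X g). germ X g U s \<otimes>\<^bsub>stalk X g\<^esub> b = \<one>\<^bsub>stalk X g\<^esub>"
      if s: "s \<in> carrier (Sect X U)" "s \<noteq> \<zero>\<^bsub>Sect X U\<^esub>" for s
      using chart_unit[OF h aff(2) s(1)] s(2) hg stalk_carrierI generic_in by blast
    fix a assume a: "a \<in> carrier (stalk X g)" "a \<noteq> \<zero>\<^bsub>stalk X g\<^esub>"
    obtain s t where st: "s \<in> carrier (Sect X U)" "t \<in> carrier (Sect X U)" "t \<noteq> \<zero>\<^bsub>Sect X U\<^esub>"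
      "a \<otimes>\<^bsub>stalk X g\<^esub> germ X g U t = germ X g U s"
      using a(1) chart_fraction[OF h aff(2)] hg by (metis singleton_iff stalk_carrierE)
    obtain t' where t': "t' \<in> carrier (stalk X g)" "germ X g U t \<otimes>\<^bsub>stalk X g\<^esub> t' = \<one>\<^bsub>stalk X g\<^esub>"
      using unit st by blast
    have gt: "germ X g U t \<in> carrier (stalk X g)" using U aff st stalk_carrierI by blast
    have "s \<noteq> \<zero>\<^bsub>Sect X U\<^esub>"
    proof
      assume "s = \<zero>\<^bsub>Sect X U\<^esub>"
      then have "a \<otimes>\<^bsub>stalk X g\<^esub> germ X g U t \<otimes>\<^bsub>stalk X g\<^esub> t' = \<zero>\<^bsub>stalk X g\<^esub>"
        using st(4) germ_zero[OF U aff(2)] t' by simp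
      then show False using a t' gt by (simp add: m_assoc)
    qed
    then obtain s' where s': "s' \<in> carrier (stalk X g)"
      "germ X g U s \<otimes>\<^bsub>stalk X g\<^esub> s' = \<one>\<^bsub>stalk X g\<^esub>" using unit st by blast
    have "a \<otimes>\<^bsub>stalk X g\<^esub> (germ X g U t \<otimes>\<^bsub>stalk X g\<^esub> s') = \<one>\<^bsub>stalk X g\<^esub>"
      using a gt s' st(4) by (simp add: m_assoc[symmetric])
    then show "\<exists>b\<in>carrier (stalk X g). a \<otimes>\<^bsub>stalk X g\<^esub> b = \<one>\<^bsub>stalk X g\<^esub>"
      using gt s' by (meson m_closed)
  qed
  then show "field K" unfolding function_field_def .
qed

section \<open>Local rings\<close>

lemmas function_fieldE = stalk_carrierE[of _ g, folded function_field_def]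

lemma germ_ring_hom:
  assumes "is_open X U" "U \<noteq> {}"
  shows "ring_hom_ring (Sect X U) K (germ X g U)"
proof -
  interpret U: domain "Sect X U" using assms by (rule sect_domain)
  show ?thesis
    by (rule ring_hom_ringI2) (use assms generic_in germ_hom[of U g, folded function_field_def]
        in \<open>auto intro: U.ring_axioms K.ring_axioms\<close>)
qed

lemma sections_subring:
  assumes "is_open X U" "U \<noteq> {}"
  shows "subring (sections X U) K"
proof -
  interpret ring_hom_ring "Sect X U" K "germ X g U" using assms by (rule germ_ring_hom)
  show ?thesis unfolding sections_def by (rule img_is_subring) (rule R.carrier_is_subring)
qed

lemma sections_mono:
  assumes "is_open X U" "is_open X V" "V \<noteq> {}" "V \<subseteq> U"
  shows "sections X U \<subseteq> sections X V"
proof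
  fix a assume "a \<in> sections X U"
  then obtain s where s: "s \<in> carrier (Sect X U)" "a = germ X g U s" unfolding sections_def by auto
  have "g \<in> V" using assms generic_point_in_opens by blast
  then have "a = germ X g V (Rest X U V s)" using germ_rest assms s by simp
  then show "a \<in> sections X V" unfolding sections_def using assms s by auto
qed

lemma local_ringI: "is_open X U \<Longrightarrow> x \<in> U \<Longrightarrow> a \<in> sections X U \<Longrightarrow> a \<in> \<R> x"
  unfolding local_ring_def by blast

lemma local_ringE:
  assumes "a \<in> \<R> x"
  obtains U where "is_open X U" "x \<in> U" "a \<in> sections X U"
  using assms unfolding local_ring_def by blast

lemma local_ring_common:
  assumes "a \<in> \<R> x" "b \<in> \<R> x"
  obtains U where "is_open X U" "x \<in> U" "a \<in> sections X U" "b \<in> sections X U"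
proof -
  obtain U where U: "is_open X U" "x \<in> U" "a \<in> sections X U" using assms(1) by (rule local_ringE)
  obtain V where V: "is_open X V" "x \<in> V" "b \<in> sections X V" using assms(2) by (rule local_ringE)
  have "is_open X (U \<inter> V)" "x \<in> U \<inter> V" using U V by auto
  then show thesis
    using that[of "U \<inter> V"] sections_mono[of U "U \<inter> V"] sections_mono[of V "U \<inter> V"] U V by blast
qed

lemma local_ring_subring:
  assumes x: "x \<in> points X"
  shows "subring (\<R> x) K"
proof (rule K.subringI)
  show "\<R> x \<subseteq> carrier K"
    using sections_subring subringE(1) by (blast elim: local_ringE)
  have "subring (sections X (points X)) K" using x by (intro sections_subring) auto
  then show "\<one>\<^bsub>K\<^esub> \<in> \<R> x" using subringE(3) x by (intro local_ringI[of "points X"]) auto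
next
  fix a assume "a \<in> \<R> x"
  then obtain U where U: "is_open X U" "x \<in> U" "a \<in> sections X U" by (rule local_ringE)
  then have "subring (sections X U) K" by (intro sections_subring) auto
  then show "\<ominus>\<^bsub>K\<^esub> a \<in> \<R> x" using U subringE(5) by (intro local_ringI[of U]) auto
next
  fix a b assume "a \<in> \<R> x" "b \<in> \<R> x"
  then obtain U where U: "is_open X U" "x \<in> U" "a \<in> sections X U" "b \<in> sections X U"
    by (rule local_ring_common)
  then have A: "subring (sections X U) K" by (intro sections_subring) auto
  show "a \<otimes>\<^bsub>K\<^esub> b \<in> \<R> x" "a \<oplus>\<^bsub>K\<^esub> b \<in> \<R> x"
    using subringE(6,7)[OF A] U by (auto intro: local_ringI[of U])
qed

lemma local_ring_point: "a \<in> \<R> x \<Longrightarrow> x \<in> points X"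
  using openin_subset by (blast elim: local_ringE)

lemma local_ring_carrier: "a \<in> \<R> x \<Longrightarrow> a \<in> carrier K"
  using local_ring_point local_ring_subring subringE(1) by blast

lemma local_ring_zero: "x \<in> points X \<Longrightarrow> \<zero>\<^bsub>K\<^esub> \<in> \<R> x"
  by (rule subringE(2)[OF local_ring_subring])

lemma local_ring_one: "x \<in> points X \<Longrightarrow> \<one>\<^bsub>K\<^esub> \<in> \<R> x"
  by (rule subringE(3)[OF local_ring_subring])

lemma local_ring_mult: "a \<in> \<R> x \<Longrightarrow> b \<in> \<R> x \<Longrightarrow> a \<otimes>\<^bsub>K\<^esub> b \<in> \<R> x"
  by (rule subringE(6)[OF local_ring_subring[OF local_ring_point]])

lemma local_ring_add: "a \<in> \<R> x \<Longrightarrow> b \<in> \<R> x \<Longrightarrow> a \<oplus>\<^bsub>K\<^esub> b \<in> \<R> x"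
  by (rule subringE(7)[OF local_ring_subring[OF local_ring_point]])

lemma local_ring_uminus: "a \<in> \<R> x \<Longrightarrow> \<ominus>\<^bsub>K\<^esub> a \<in> \<R> x"
  by (rule subringE(5)[OF local_ring_subring[OF local_ring_point]])

lemma local_ring_pow: "a \<in> \<R> x \<Longrightarrow> a [^]\<^bsub>K\<^esub> (n::nat) \<in> \<R> x"
  by (induction n) (auto intro: local_ring_one local_ring_point local_ring_mult)

lemma local_ring_mono: "x \<in> closure_pt X y \<Longrightarrow> \<R> x \<subseteq> \<R> y"
  unfolding in_closure_pt_iff by (blast elim: local_ringE intro: local_ringI)

lemma local_ring_generic: "\<R> g = carrier K"
proof
  show "carrier K \<subseteq> \<R> g"
  proof
    fix a assume "a \<in> carrier K"
    then obtain U s where "is_open X U" "g \<in> U" "s \<in> carrier (Sect X U)" "a = germ X g U s"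
      by (rule function_fieldE)
    then show "a \<in> \<R> g" by (intro local_ringI[of U]) (auto simp: sections_def)
  qed
qed (use local_ring_carrier in blast)

lemma max_ideal_local: "a \<in> \<M> x \<Longrightarrow> a \<in> \<R> x"
  unfolding nonunits_def by simp

lemma local_ring_unit: "a \<in> \<R> x \<Longrightarrow> a \<notin> \<M> x \<Longrightarrow> \<exists>b\<in>\<R> x. a \<otimes>\<^bsub>K\<^esub> b = \<one>\<^bsub>K\<^esub>"
  unfolding nonunits_def by simp

lemma max_ideal_unit: "a \<in> \<M> x \<Longrightarrow> b \<in> \<R> x \<Longrightarrow> a \<otimes>\<^bsub>K\<^esub> b \<noteq> \<one>\<^bsub>K\<^esub>"
  unfolding nonunits_def by simp

lemma max_ideal_generic: "\<M> g = {\<zero>\<^bsub>K\<^esub>}"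
proof -
  have "\<exists>b\<in>carrier K. a \<otimes>\<^bsub>K\<^esub> b = \<one>\<^bsub>K\<^esub>" if "a \<in> carrier K" "a \<noteq> \<zero>\<^bsub>K\<^esub>" for a
  proof -
    have "a \<in> Units K" using that K.field_Units by simp
    then show ?thesis unfolding Units_def by blast
  qed
  moreover have "\<zero>\<^bsub>K\<^esub> \<otimes>\<^bsub>K\<^esub> b \<noteq> \<one>\<^bsub>K\<^esub>" if "b \<in> carrier K" for b
    using that K.l_null K.one_not_zero by simp
  ultimately show ?thesis unfolding nonunits_def local_ring_generic by blast
qed

lemma max_ideal_mult:
  assumes "a \<in> \<R> x" "b \<in> \<M> x"
  shows "a \<otimes>\<^bsub>K\<^esub> b \<in> \<M> x"
proof -
  have ab: "a \<otimes>\<^bsub>K\<^esub> b \<in> \<R> x" using assms local_ring_mult max_ideal_local by blast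
  have "False" if c: "c \<in> \<R> x" "a \<otimes>\<^bsub>K\<^esub> b \<otimes>\<^bsub>K\<^esub> c = \<one>\<^bsub>K\<^esub>" for c
  proof -
    have "b \<otimes>\<^bsub>K\<^esub> (a \<otimes>\<^bsub>K\<^esub> c) = \<one>\<^bsub>K\<^esub>"
      using c assms local_ring_carrier max_ideal_local
      by (metis K.m_assoc K.m_comm)
    then show False using max_ideal_unit assms c local_ring_mult by blast
  qed
  then show ?thesis using ab local_ring_unit by blast
qed

lemma max_ideal_prime:
  assumes "a \<in> \<R> x" "b \<in> \<R> x" "a \<otimes>\<^bsub>K\<^esub> b \<in> \<M> x"
  shows "a \<in> \<M> x \<or> b \<in> \<M> x"
proof (rule ccontr)
  assume "\<not> ?thesis"
  then obtain c where c: "c \<in> \<R> x" "a \<otimes>\<^bsub>K\<^esub> c = \<one>\<^bsub>K\<^esub>" and "b \<notin> \<M> x"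
    using local_ring_unit assms by blast
  have "c \<otimes>\<^bsub>K\<^esub> (a \<otimes>\<^bsub>K\<^esub> b) \<in> \<M> x" using max_ideal_mult c assms by blast
  moreover have "c \<otimes>\<^bsub>K\<^esub> (a \<otimes>\<^bsub>K\<^esub> b) = b"
    using assms c local_ring_carrier by (metis K.m_assoc K.m_comm K.l_one)
  ultimately show False using \<open>b \<notin> \<M> x\<close> by simp
qed

lemma one_notin_max_ideal: "\<one>\<^bsub>K\<^esub> \<notin> \<M> x"
  using max_ideal_unit[of "\<one>\<^bsub>K\<^esub>" x "\<one>\<^bsub>K\<^esub>"] local_ring_one[OF local_ring_point] max_ideal_local
  by fastforce

section \<open>Nonunits in affine charts\<close>

lemma chart_in_local:
  assumes h: "affine_chart X U h" and x: "x \<in> U" and f: "f \<in> carrier (Sect X U)"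
  shows "germ X g U f \<in> \<R> x"
  using affine_chartD(1)[OF h] x f by (intro local_ringI[of U]) (auto simp: sections_def)

lemma chart_local_fraction:
  assumes h: "affine_chart X U h" and x: "x \<in> U" and a: "a \<in> \<R> x"
  shows "\<exists>s\<in>carrier (Sect X U). \<exists>f\<in>carrier (Sect X U). f \<notin> h x \<and>
    a \<otimes>\<^bsub>K\<^esub> germ X g U f = germ X g U s"
proof -
  from a obtain V t where "is_open X V" "x \<in> V" "t \<in> carrier (Sect X V)" "a = germ X g V t"
    by (auto elim!: local_ringE simp: sections_def)
  with chart_fraction[OF h x, folded function_field_def] show ?thesis by blast
qed

text \<open>Identifies the abstract nonunits with the prime of the chart. If
  \<open>f \<in> h x\<close> had an inverse \<open>s / t\<close> with \<open>t \<notin> h x\<close>,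
  injectivity of germs would give \<open>t = f s\<close>, an element of \<open>h x\<close>.\<close>

lemma chart_max_ideal:
  assumes h: "affine_chart X U h" and x: "x \<in> U" and f: "f \<in> carrier (Sect X U)"
  shows "germ X g U f \<in> \<M> x \<longleftrightarrow> f \<in> h x"
proof
  assume f_max: "germ X g U f \<in> \<M> x"
  show "f \<in> h x"
  proof (rule ccontr)
    assume "f \<notin> h x"
    then obtain W b where "is_open X W" "x \<in> W" "b \<in> carrier (Sect X W)"
      "germ X g U f \<otimes>\<^bsub>K\<^esub> germ X g W b = \<one>\<^bsub>K\<^esub>"
      using chart_unit[OF h x f, folded function_field_def] by blast
    moreover from this have "germ X g W b \<in> \<R> x"
      by (intro local_ringI[of W]) (auto simp: sections_def)
    ultimately show False using f_max max_ideal_unit by blast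
  qed
next
  assume fh: "f \<in> h x"
  have U: "is_open X U" "U \<noteq> {}" using affine_chartD(1)[OF h] x by auto
  interpret hom: ring_hom_ring "Sect X U" K "germ X g U" using U by (rule germ_ring_hom)
  interpret P: primeideal "h x" "Sect X U" using x by (rule affine_chart_prime[OF h])
  have fR: "germ X g U f \<in> \<R> x" by (rule chart_in_local[OF h x f])
  show "germ X g U f \<in> \<M> x"
  proof (rule ccontr)
    assume "germ X g U f \<notin> \<M> x"
    then obtain b where b: "b \<in> \<R> x" "germ X g U f \<otimes>\<^bsub>K\<^esub> b = \<one>\<^bsub>K\<^esub>"
      using local_ring_unit fR by blast
    obtain s t where st: "s \<in> carrier (Sect X U)" "t \<in> carrier (Sect X U)" "t \<notin> h x"
      "b \<otimes>\<^bsub>K\<^esub> germ X g U t = germ X g U s" using chart_local_fraction[OF h x b(1)] by blast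
    have "germ X g U t = germ X g U f \<otimes>\<^bsub>K\<^esub> b \<otimes>\<^bsub>K\<^esub> germ X g U t"
      using b st by simp
    also have "\<dots> = germ X g U f \<otimes>\<^bsub>K\<^esub> germ X g U s"
      using st f K.m_assoc[OF _ local_ring_carrier[OF b(1)], of "germ X g U f" "germ X g U t"] by simp
    finally have "germ X g U t = germ X g U (f \<otimes>\<^bsub>Sect X U\<^esub> s)"
      using f st by simp
    then have "t = f \<otimes>\<^bsub>Sect X U\<^esub> s"
      using chart_germ_inj[OF h U(2)] f st by (simp add: inj_on_def)
    then show False using P.I_r_closed fh st by simp
  qed
qed

text \<open>This is locality of the ring, the one ideal property of nonunits that is not formal.
  Over denominators from a chart, the numerators lie in the prime \<open>h x\<close>, which is
  closed under sums.\<close>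

lemma max_ideal_add:
  assumes a: "a \<in> \<M> x" and b: "b \<in> \<M> x"
  shows "a \<oplus>\<^bsub>K\<^esub> b \<in> \<M> x"
proof -
  have aR: "a \<in> \<R> x" and bR: "b \<in> \<R> x" using assms max_ideal_local by auto
  note ab = local_ring_carrier[OF aR] local_ring_carrier[OF bR]
  obtain U where "affine_open X U" and x: "x \<in> U" using affine_nbhd local_ring_point aR by blast
  then obtain h where h: "affine_chart X U h" using affine_chart_exists by blast
  have U: "is_open X U" "U \<noteq> {}" using affine_chartD(1)[OF h] x by auto
  interpret hom: ring_hom_ring "Sect X U" K "germ X g U" using U by (rule germ_ring_hom)
  interpret P: primeideal "h x" "Sect X U" using x by (rule affine_chart_prime[OF h])
  obtain s c where sc: "s \<in> carrier (Sect X U)" "c \<in> carrier (Sect X U)" "c \<notin> h x"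
    "a \<otimes>\<^bsub>K\<^esub> germ X g U c = germ X g U s" using chart_local_fraction[OF h x aR] by blast
  obtain t d where td: "t \<in> carrier (Sect X U)" "d \<in> carrier (Sect X U)" "d \<notin> h x"
    "b \<otimes>\<^bsub>K\<^esub> germ X g U d = germ X g U t" using chart_local_fraction[OF h x bR] by blast
  have "germ X g U s \<in> \<M> x" "germ X g U t \<in> \<M> x"
    using max_ideal_mult[OF chart_in_local[OF h x] a, of c] max_ideal_mult[OF chart_in_local[OF h x] b, of d]
      sc td ab by (simp_all add: K.m_comm)
  then have st: "s \<in> h x" "t \<in> h x" using chart_max_ideal[OF h x] sc td by auto
  \<comment> \<open>Numerator of the sum over the common denominator \<open>c d\<close>.\<close>
  then have "s \<otimes>\<^bsub>Sect X U\<^esub> d \<oplus>\<^bsub>Sect X U\<^esub> t \<otimes>\<^bsub>Sect X U\<^esub> c \<in> h x"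
    using P.I_r_closed sc td by (intro P.a_closed) auto
  then have "germ X g U (s \<otimes>\<^bsub>Sect X U\<^esub> d \<oplus>\<^bsub>Sect X U\<^esub> t \<otimes>\<^bsub>Sect X U\<^esub> c) \<in> \<M> x"
    using sc td by (intro iffD2[OF chart_max_ideal[OF h x]]) auto
  moreover have "germ X g U (s \<otimes>\<^bsub>Sect X U\<^esub> d \<oplus>\<^bsub>Sect X U\<^esub> t \<otimes>\<^bsub>Sect X U\<^esub> c) =
      (a \<oplus>\<^bsub>K\<^esub> b) \<otimes>\<^bsub>K\<^esub> germ X g U (c \<otimes>\<^bsub>Sect X U\<^esub> d)"
  proof -
    have cd: "germ X g U c \<in> carrier K" "germ X g U d \<in> carrier K" using sc td by auto
    have "a \<otimes>\<^bsub>K\<^esub> (germ X g U c \<otimes>\<^bsub>K\<^esub> germ X g U d) = germ X g U s \<otimes>\<^bsub>K\<^esub> germ X g U d"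
      using K.m_assoc[OF ab(1) cd] sc by simp
    moreover have "b \<otimes>\<^bsub>K\<^esub> (germ X g U c \<otimes>\<^bsub>K\<^esub> germ X g U d) = germ X g U t \<otimes>\<^bsub>K\<^esub> germ X g U c"
      using K.m_assoc[OF ab(2) cd(2,1)] K.m_comm[OF cd] td by simp
    ultimately show ?thesis using sc td ab cd by (simp add: K.l_distr)
  qed
  ultimately have "(a \<oplus>\<^bsub>K\<^esub> b) \<otimes>\<^bsub>K\<^esub> germ X g U (c \<otimes>\<^bsub>Sect X U\<^esub> d) \<in> \<M> x" by simp
  moreover have "c \<otimes>\<^bsub>Sect X U\<^esub> d \<notin> h x" using P.I_prime sc td by blast
  then have "germ X g U (c \<otimes>\<^bsub>Sect X U\<^esub> d) \<notin> \<M> x"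
    using sc td by (subst chart_max_ideal[OF h x]) auto
  moreover have "germ X g U (c \<otimes>\<^bsub>Sect X U\<^esub> d) \<in> \<R> x" using sc td by (intro chart_in_local[OF h x]) auto
  ultimately show ?thesis using max_ideal_prime local_ring_add aR bR by blast
qed

lemma max_ideal_zero: "x \<in> points X \<Longrightarrow> \<zero>\<^bsub>K\<^esub> \<in> \<M> x"
  using local_ring_zero local_ring_carrier local_ring_unit K.l_null K.zero_not_one by metis

lemma max_ideal_primeideal:
  assumes x: "x \<in> points X"
  shows "primeideal (\<M> x) (K\<lparr>carrier := \<R> x\<rparr>)"
  using local_ring_subring[OF x] max_ideal_zero[OF x] one_notin_max_ideal
    max_ideal_add max_ideal_mult max_ideal_prime max_ideal_local
  by (intro K.primeideal_subringI) auto

lemma max_ideal_mono: 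
  assumes "x \<in> closure_pt X y" "a \<in> \<M> y" "a \<in> \<R> x"
  shows "a \<in> \<M> x"
  using assms local_ring_mono local_ring_unit max_ideal_unit by blast

section \<open>Points of affine open sets and primes of local rings\<close>

lemma chart_sections_max_ideal:
  assumes h: "affine_chart X U h" and "x \<in> U"
  shows "\<M> x \<inter> sections X U = germ X g U ` h x"
  using chart_max_ideal[OF assms] primeideal.axioms(1)[OF affine_chart_prime[OF assms]]
    ideal.Icarr unfolding sections_def by fast

text \<open>The trace of the maximal ideal on sections is the image of the prime in the chart, and
  the chart map is injective.\<close>

lemma affine_point_unique:
  assumes "affine_open X U" "x \<in> U" "y \<in> U" "\<M> x \<inter> sections X U = \<M> y \<inter> sections X U"
  shows "x = y"
proof -
  obtain h where h: "affine_chart X U h" using assms affine_chart_exists by blast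
  have "f \<in> h x \<longleftrightarrow> f \<in> h y" if f: "f \<in> carrier (Sect X U)" for f
  proof -
    have "germ X g U f \<in> sections X U" using f unfolding sections_def by simp
    then show ?thesis
      using chart_max_ideal[OF h assms(2) f] chart_max_ideal[OF h assms(3) f] assms(4) by blast
  qed
  then have "h x = h y"
    using ideal.Icarr[OF primeideal.axioms(1)[OF affine_chart_prime[OF h assms(2)]]]
      ideal.Icarr[OF primeideal.axioms(1)[OF affine_chart_prime[OF h assms(3)]]] by blast
  then show ?thesis using affine_chartD(2)[OF h] assms unfolding bij_betw_def inj_on_def by blast
qed

text \<open>\<open>Q\<close> pulls back along the germ map to a prime of the ring of sections, and
  the chart map hits every such prime.\<close>

lemma affine_point_exists:
  assumes aff: "affine_open X U" and ne: "U \<noteq> {}"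
    and Q: "primeideal Q (K\<lparr>carrier := sections X U\<rparr>)"
  shows "\<exists>y\<in>U. \<M> y \<inter> sections X U = Q"
proof -
  obtain h where h: "affine_chart X U h" using aff affine_chart_exists by blast
  note U = affine_chartD(1)[OF h] ne
  interpret U: domain "Sect X U" using U by (rule sect_domain)
  interpret hom: ring_hom_ring "Sect X U" K "germ X g U" using U by (rule germ_ring_hom)
  interpret Q: primeideal Q "K\<lparr>carrier := sections X U\<rparr>" by fact
  interpret hom': ring_hom_ring "Sect X U" "K\<lparr>carrier := sections X U\<rparr>" "germ X g U"
    by (rule ring_hom_ringI2[OF U.ring_axioms Q.ring_axioms])
      (use hom.homh in \<open>auto simp: ring_hom_def sections_def\<close>)
  let ?P = "{r \<in> carrier (Sect X U). germ X g U r \<in> Q}"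
  have "primeideal ?P (Sect X U)" by (rule hom'.primeideal_vimage) (use Q U.is_cring in auto)
  then obtain y where y: "y \<in> U" "h y = ?P"
    using affine_chartD(2)[OF h] unfolding bij_betw_def by (metis (no_types, lifting) imageE mem_Collect_eq)
  have "\<M> y \<inter> sections X U = Q"
    unfolding chart_sections_max_ideal[OF h y(1)] y(2)
    using Q.Icarr by (auto simp: sections_def)
  then show ?thesis using y by blast
qed

lemma distinguished_eq:
  assumes "is_open X U" "f \<in> sections X U"
  shows "distinguished X U f = {x\<in>U. f \<notin> \<M> x}"
  using local_ringI[OF assms(1) _ assms(2)] local_ring_unit max_ideal_unit
  unfolding distinguished_def by blast

lemma affine_basis:
  assumes aff: "affine_open X U" and W: "is_open X W" "x \<in> W" "x \<in> U"
  shows "\<exists>f\<in>sections X U. x \<in> distinguished X U f \<and> distinguished X U f \<subseteq> W \<and>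
    is_open X (distinguished X U f)"
proof -
  obtain h where h: "affine_chart X U h" using aff affine_chart_exists by blast
  note U = affine_chartD(1)[OF h]
  obtain f where f: "f \<in> carrier (Sect X U)" "f \<notin> h x" "{y\<in>U. f \<notin> h y} \<subseteq> W"
    using affine_chartD(5)[OF h W] by blast
  have fs: "germ X g U f \<in> sections X U" using f unfolding sections_def by simp
  have "distinguished X U (germ X g U f) = {y\<in>U. f \<notin> h y}"
    unfolding distinguished_eq[OF U fs] using chart_max_ideal[OF h _ f(1)] by blast
  then show ?thesis using f W fs affine_chartD(3)[OF h f(1)] by (intro bexI[of _ "germ X g U f"]) auto
qed

lemma affine_closure:
  assumes aff: "affine_open X U" and xy: "x \<in> U" "y \<in> U" and sub: "\<M> y \<inter> sections X U \<subseteq> \<M> x"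
  shows "x \<in> closure_pt X y"
  unfolding in_closure_pt_iff
proof safe
  have U: "is_open X U" using aff unfolding affine_open_def by simp
  then show "x \<in> points X" using openin_subset xy by blast
  fix W assume "is_open X W" "x \<in> W"
  then obtain f where f: "f \<in> sections X U" "x \<in> distinguished X U f" "distinguished X U f \<subseteq> W"
    using affine_basis[OF aff] xy by blast
  then have "y \<in> distinguished X U f" using distinguished_eq[OF U f(1)] sub xy by blast
  then show "y \<in> W" using f by blast
qed

lemma affine_fraction:
  assumes aff: "affine_open X U" and x: "x \<in> U" and a: "a \<in> \<R> x"
  shows "\<exists>b\<in>sections X U. \<exists>c\<in>sections X U. c \<notin> \<M> x \<and> a \<otimes>\<^bsub>K\<^esub> c = b"
proof -
  obtain h where h: "affine_chart X U h" using aff affine_chart_exists by blast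
  then obtain s f where "s \<in> carrier (Sect X U)" "f \<in> carrier (Sect X U)" "f \<notin> h x"
    "a \<otimes>\<^bsub>K\<^esub> germ X g U f = germ X g U s" using chart_local_fraction[OF h x a] by blast
  then show ?thesis using chart_max_ideal[OF h x] unfolding sections_def by blast
qed

lemma prime_subset_max_ideal:
  assumes x: "x \<in> points X" and Q: "primeideal Q (K\<lparr>carrier := \<R> x\<rparr>)"
  shows "Q \<subseteq> \<M> x"
proof
  interpret Q: primeideal Q "K\<lparr>carrier := \<R> x\<rparr>" by fact
  fix a assume a: "a \<in> Q"
  then have aR: "a \<in> \<R> x" using Q.Icarr by simp
  show "a \<in> \<M> x"
  proof (rule ccontr)
    assume "a \<notin> \<M> x"
    then obtain b where b: "b \<in> \<R> x" "a \<otimes>\<^bsub>K\<^esub> b = \<one>\<^bsub>K\<^esub>" using local_ring_unit aR by blast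
    then have "\<one>\<^bsub>K\<^esub> \<in> Q" using Q.I_r_closed a by fastforce
    then show False using Q.one_imp_carrier Q.I_notcarr by simp
  qed
qed

text \<open>Contract \<open>Q\<close> to an affine neighbourhood and take its point \<open>y\<close>
  there. Elements of the local ring are quotients with denominator outside \<open>\<M> x\<close>,
  hence outside both \<open>Q\<close> and \<open>\<M> y\<close>, so agreement on sections propagates
  to the local ring.\<close>

lemma local_prime_point:
  assumes x: "x \<in> points X" and Q: "primeideal Q (K\<lparr>carrier := \<R> x\<rparr>)"
  obtains y where "y \<in> points X" "x \<in> closure_pt X y" "\<M> y \<inter> \<R> x = Q"
proof -
  interpret Q: primeideal Q "K\<lparr>carrier := \<R> x\<rparr>" by fact
  obtain U where aff: "affine_open X U" and xU: "x \<in> U" using affine_nbhd[OF x] by auto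
  have U: "is_open X U" "U \<noteq> {}" using aff xU unfolding affine_open_def by auto
  let ?A = "sections X U"
  have AR: "?A \<subseteq> \<R> x" using local_ringI U xU by blast
  have QM: "Q \<subseteq> \<M> x" by (rule prime_subset_max_ideal[OF x Q])
  note A = sections_subring[OF U]
  have "primeideal (Q \<inter> ?A) (K\<lparr>carrier := ?A\<rparr>)"
  proof (rule K.primeideal_subringI[OF A])
    show "\<one>\<^bsub>K\<^esub> \<notin> Q \<inter> ?A" using QM one_notin_max_ideal by blast
    show "\<zero>\<^bsub>K\<^esub> \<in> Q \<inter> ?A" 
      using additive_subgroup.zero_closed[OF Q.is_additive_subgroup] subringE(2)[OF A] by simp
    fix a b
    show "a \<oplus>\<^bsub>K\<^esub> b \<in> Q \<inter> ?A" if "a \<in> Q \<inter> ?A" "b \<in> Q \<inter> ?A"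
      using that additive_subgroup.a_closed[OF Q.is_additive_subgroup, of a b] subringE(7)[OF A] by simp
    show "a \<otimes>\<^bsub>K\<^esub> b \<in> Q \<inter> ?A" if "a \<in> ?A" "b \<in> Q \<inter> ?A"
      using that Q.I_l_closed[of b a] subringE(6)[OF A] AR by auto
    show "a \<in> Q \<inter> ?A \<or> b \<in> Q \<inter> ?A" if "a \<in> ?A" "b \<in> ?A" "a \<otimes>\<^bsub>K\<^esub> b \<in> Q \<inter> ?A"
      using that Q.I_prime[of a b] AR by auto
  qed simp
  from affine_point_exists[OF aff U(2) this] obtain y where
    y: "y \<in> U" "\<M> y \<inter> ?A = Q \<inter> ?A" by blast
  have cl: "x \<in> closure_pt X y" by (rule affine_closure[OF aff xU y(1)]) (use y(2) QM in blast)
  have "a \<in> \<M> y \<longleftrightarrow> a \<in> Q" if a: "a \<in> \<R> x" for a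
  proof -
    obtain b c where bc: "b \<in> ?A" "c \<in> ?A" "c \<notin> \<M> x" "a \<otimes>\<^bsub>K\<^esub> c = b"
      using affine_fraction[OF aff xU a] by blast
    have cQ: "c \<notin> Q" "c \<notin> \<M> y" using bc QM y(2) by blast+
    have R: "a \<in> \<R> x" "c \<in> \<R> x" "a \<in> \<R> y" "c \<in> \<R> y"
      using a bc AR local_ring_mono[OF cl] by auto
    have "a \<in> Q \<longleftrightarrow> b \<in> Q" using Q.I_prime[of a c] Q.I_r_closed[of a c] R cQ bc by auto
    also have "\<dots> \<longleftrightarrow> b \<in> \<M> y" using y(2) bc by blast
    also have "\<dots> \<longleftrightarrow> a \<in> \<M> y"
      using max_ideal_prime[OF R(3,4)] max_ideal_mult[OF R(4), of a] cQ bc R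
        K.m_comm[of c a] local_ring_carrier by metis
    finally show ?thesis by simp
  qed
  then have "\<M> y \<inter> \<R> x = Q" using Q.Icarr by auto
  then show thesis using that cl y(1) openin_subset[OF U(1)] by blast
qed

text \<open>An affine neighbourhood of \<open>x\<close> contains every generization
  \<open>y\<close>, so fractions of its sections serve both points: the local ring at
  \<open>y\<close> is a localization of the one at \<open>x\<close>.\<close>

lemma local_fraction:
  assumes cl: "x \<in> closure_pt X y" and a: "a \<in> \<R> y"
  shows "\<exists>b\<in>\<R> x. \<exists>c\<in>\<R> x. c \<notin> \<M> y \<and> a \<otimes>\<^bsub>K\<^esub> c = b"
proof -
  have x: "x \<in> points X" using cl in_closure_pt_iff[of x X y] by blast
  obtain U where aff: "affine_open X U" and xU: "x \<in> U" using affine_nbhd[OF x] by auto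
  have U: "is_open X U" using aff unfolding affine_open_def by auto
  then have "y \<in> U" using cl xU in_closure_pt_iff by metis
  from affine_fraction[OF aff this a] show ?thesis using local_ringI[OF U xU] by blast
qed

text \<open>A zero maximal ideal would have the same trace in an affine chart as that of the generic
  point.\<close>

lemma max_ideal_nontrivial:
  assumes x: "x \<in> points X" and ng: "x \<noteq> g"
  shows "\<exists>a\<in>\<M> x. a \<noteq> \<zero>\<^bsub>K\<^esub>"
proof (rule ccontr)
  assume *: "\<not> ?thesis"
  obtain U where aff: "affine_open X U" and xU: "x \<in> U" using affine_nbhd[OF x] by auto
  then have U: "is_open X U" unfolding affine_open_def by auto
  have gU: "g \<in> U" by (rule generic_in[OF U xU])
  have "\<M> x \<inter> sections X U = \<M> g \<inter> sections X U"
  proof -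
    have "\<M> x = {\<zero>\<^bsub>K\<^esub>}" using * max_ideal_zero[OF x] by blast
    then show ?thesis by (simp only: max_ideal_generic)
  qed
  from affine_point_unique[OF aff xU gU this] ng show False by simp
qed

end

section \<open>Residue fields and centers\<close>

lemma real_valuation_mult:
  "real_valuation F w \<Longrightarrow> a \<in> carrier F \<Longrightarrow> b \<in> carrier F \<Longrightarrow> w (a \<otimes>\<^bsub>F\<^esub> b) = w a + w b"
  unfolding real_valuation_def by simp

lemma real_valuation_add:
  "real_valuation F w \<Longrightarrow> a \<in> carrier F \<Longrightarrow> b \<in> carrier F \<Longrightarrow> min (w a) (w b) \<le> w (a \<oplus>\<^bsub>F\<^esub> b)"
  unfolding real_valuation_def by simp

lemma real_valuation_finite:
  "real_valuation F w \<Longrightarrow> a \<in> carrier F \<Longrightarrow> a \<noteq> \<zero>\<^bsub>F\<^esub> \<Longrightarrow> \<bar>w a\<bar> \<noteq> \<infinity>"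
  unfolding real_valuation_def by simp

lemma real_valuation_zero: "real_valuation F w \<Longrightarrow> w \<zero>\<^bsub>F\<^esub> = \<infinity>"
  unfolding real_valuation_def by simp

lemma (in field) real_valuation_one:
  assumes "real_valuation R w"
  shows "w \<one> = 0"
proof -
  have "w \<one> = w \<one> + w \<one>" using real_valuation_mult[OF assms, of \<one> \<one>] by simp
  moreover have "\<bar>w \<one>\<bar> \<noteq> \<infinity>" using real_valuation_finite[OF assms] by simp
  ultimately show ?thesis by (cases "w \<one>") auto
qed

lemma (in field) trivial_valuation: "real_valuation R (trivial_valuation R)"
  unfolding real_valuation_def trivial_valuation_def by (auto simp: integral_iff)

context integral_space
begin

lemma residue_eq: "residue X x a = \<M> x +>\<^bsub>K\<lparr>carrier := \<R> x\<rparr>\<^esub> a"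
  unfolding residue_def a_r_coset_def' by simp

lemma residue_ring_hom:
  assumes x: "x \<in> points X"
  shows "residue X x \<in> ring_hom (K\<lparr>carrier := \<R> x\<rparr>) (residue_field X x)"
  unfolding residue_field_def residue_eq[abs_def]
  by (rule ideal.rcos_ring_hom[OF primeideal.axioms(1)[OF max_ideal_primeideal[OF x]]])

lemma residue_add:
  "a \<in> \<R> x \<Longrightarrow> b \<in> \<R> x \<Longrightarrow>
    residue X x (a \<oplus>\<^bsub>K\<^esub> b) = residue X x a \<oplus>\<^bsub>residue_field X x\<^esub> residue X x b"
  using ring_hom_add[OF residue_ring_hom[OF local_ring_point], of a x a b] by simp

lemma residue_mult:
  "a \<in> \<R> x \<Longrightarrow> b \<in> \<R> x \<Longrightarrow>
    residue X x (a \<otimes>\<^bsub>K\<^esub> b) = residue X x a \<otimes>\<^bsub>residue_field X x\<^esub> residue X x b"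
  using ring_hom_mult[OF residue_ring_hom[OF local_ring_point], of a x a b] by simp

lemma residue_one: "x \<in> points X \<Longrightarrow> residue X x \<one>\<^bsub>K\<^esub> = \<one>\<^bsub>residue_field X x\<^esub>"
  using ring_hom_one[OF residue_ring_hom[of x]] by simp

lemma residue_field_carrier: "carrier (residue_field X x) = residue X x ` \<R> x"
  unfolding residue_field_def FactRing_def A_RCOSETS_def' residue_eq[abs_def] by auto

lemma residue_closed: "a \<in> \<R> x \<Longrightarrow> residue X x a \<in> carrier (residue_field X x)"
  unfolding residue_field_carrier by simp

lemma residue_eqD:
  assumes a: "a \<in> \<R> x" and b: "b \<in> \<R> x" and eq: "residue X x a = residue X x b"
  shows "\<exists>m\<in>\<M> x. a = m \<oplus>\<^bsub>K\<^esub> b"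
proof -
  have "\<zero>\<^bsub>K\<^esub> \<in> \<M> x" using max_ideal_zero local_ring_point a by blast
  moreover have "a = \<zero>\<^bsub>K\<^esub> \<oplus>\<^bsub>K\<^esub> a" using a local_ring_carrier by simp
  ultimately have "a \<in> residue X x a" unfolding residue_def a_r_coset_def' by blast
  then have "a \<in> residue X x b" using eq by simp
  then show ?thesis unfolding residue_def a_r_coset_def' by auto
qed

lemma residue_zero_iff:
  assumes a: "a \<in> \<R> x"
  shows "residue X x a = \<zero>\<^bsub>residue_field X x\<^esub> \<longleftrightarrow> a \<in> \<M> x"
proof -
  interpret P: primeideal "\<M> x" "K\<lparr>carrier := \<R> x\<rparr>"
    using local_ring_point a max_ideal_primeideal by blast
  have zero: "\<zero>\<^bsub>residue_field X x\<^esub> = \<M> x" unfolding residue_field_def FactRing_def by simp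
  have "residue X x a = \<M> x" if "a \<in> \<M> x"
    unfolding residue_eq by (rule P.a_rcos_zero[OF P.is_ideal that])
  moreover have "a \<in> residue X x a" unfolding residue_eq using P.a_rcos_self a by simp
  ultimately show ?thesis unfolding zero by blast
qed

lemma residue_field_field:
  assumes x: "x \<in> points X"
  shows "field (residue_field X x)"
proof -
  interpret P: primeideal "\<M> x" "K\<lparr>carrier := \<R> x\<rparr>" by (rule max_ideal_primeideal[OF x])
  interpret F: cring "residue_field X x"
    unfolding residue_field_def by (rule P.quotient_is_cring[OF P.is_cring])
  show ?thesis
  proof (rule F.cring_fieldI2)
    show "\<zero>\<^bsub>residue_field X x\<^esub> \<noteq> \<one>\<^bsub>residue_field X x\<^esub>"
      using residue_zero_iff[OF local_ring_one[OF x]] residue_one[OF x] one_notin_max_ideal by metis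
    fix c assume c: "c \<in> carrier (residue_field X x)" "c \<noteq> \<zero>\<^bsub>residue_field X x\<^esub>"
    then obtain a where a: "a \<in> \<R> x" "c = residue X x a" unfolding residue_field_carrier by auto
    then obtain b where b: "b \<in> \<R> x" "a \<otimes>\<^bsub>K\<^esub> b = \<one>\<^bsub>K\<^esub>"
      using c residue_zero_iff local_ring_unit by blast
    then have "c \<otimes>\<^bsub>residue_field X x\<^esub> residue X x b = \<one>\<^bsub>residue_field X x\<^esub>"
      using a residue_mult residue_one[OF x] by metis
    then show "\<exists>b\<in>carrier (residue_field X x). c \<otimes>\<^bsub>residue_field X x\<^esub> b = \<one>\<^bsub>residue_field X x\<^esub>"
      using b residue_closed by blast
  qed
qed

section \<open>Valuations of the residue field, read on the local ring\<close>

abbreviation pullback :: "(('x set \<times> 'a) set set \<Rightarrow> ereal) \<Rightarrow> 'x \<Rightarrow> ('x set \<times> 'a) set \<Rightarrow> ereal"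
  where "pullback w x a \<equiv> w (residue X x a)"

context
  fixes w x
  assumes x: "x \<in> points X" and w: "real_valuation (residue_field X x) w"
begin

interpretation F: field "residue_field X x" by (rule residue_field_field[OF x])

lemma pullback_mult:
  "a \<in> \<R> x \<Longrightarrow> b \<in> \<R> x \<Longrightarrow> pullback w x (a \<otimes>\<^bsub>K\<^esub> b) = pullback w x a + pullback w x b"
  by (simp add: residue_mult residue_closed real_valuation_mult[OF w])

lemma pullback_add:
  "a \<in> \<R> x \<Longrightarrow> b \<in> \<R> x \<Longrightarrow> min (pullback w x a) (pullback w x b) \<le> pullback w x (a \<oplus>\<^bsub>K\<^esub> b)"
  by (simp add: residue_add residue_closed real_valuation_add[OF w])

lemma pullback_one: "pullback w x \<one>\<^bsub>K\<^esub> = 0"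
  by (simp add: residue_one x F.real_valuation_one w)

lemma pullback_max_ideal: "a \<in> \<M> x \<Longrightarrow> pullback w x a = \<infinity>"
  using residue_zero_iff[OF max_ideal_local] real_valuation_zero[OF w] by metis

lemma pullback_uminus:
  assumes a: "a \<in> \<R> x"
  shows "pullback w x (\<ominus>\<^bsub>K\<^esub> a) = pullback w x a"
proof -
  have m1: "\<ominus>\<^bsub>K\<^esub> \<one>\<^bsub>K\<^esub> \<in> \<R> x" using local_ring_uminus local_ring_one x by blast
  then have "pullback w x (\<ominus>\<^bsub>K\<^esub> \<one>\<^bsub>K\<^esub>) + pullback w x (\<ominus>\<^bsub>K\<^esub> \<one>\<^bsub>K\<^esub>) = 0"
    using pullback_mult[OF m1 m1] pullback_one by (simp add: K.l_minus K.r_minus)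
  then have "pullback w x (\<ominus>\<^bsub>K\<^esub> \<one>\<^bsub>K\<^esub>) = 0" by (cases "pullback w x (\<ominus>\<^bsub>K\<^esub> \<one>\<^bsub>K\<^esub>)") auto
  then show ?thesis using pullback_mult[OF m1 a] a local_ring_carrier by (simp add: K.l_minus)
qed

text \<open>Applied to a local ring to find a center, and to the sections over an affine set to
  prove uniqueness; hence the general subring \<open>A\<close>. Nonnegativity makes the complement
  the elements of value 0, which is closed under products.\<close>

lemma positive_primeideal:
  assumes A: "subring A K" "A \<subseteq> \<R> x" and pos: "\<And>a. a \<in> A \<Longrightarrow> 0 \<le> pullback w x a"
  shows "primeideal {a\<in>A. 0 < pullback w x a} (K\<lparr>carrier := A\<rparr>)"
proof (rule K.primeideal_subringI[OF A(1)])
  show "\<zero>\<^bsub>K\<^esub> \<in> {a\<in>A. 0 < pullback w x a}"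
    using pullback_max_ideal[OF max_ideal_zero[OF x]] subringE(2)[OF A(1)] by simp
  show "\<one>\<^bsub>K\<^esub> \<notin> {a\<in>A. 0 < pullback w x a}" using pullback_one by simp
  fix a b
  show "a \<oplus>\<^bsub>K\<^esub> b \<in> {a\<in>A. 0 < pullback w x a}"
    if "a \<in> {a\<in>A. 0 < pullback w x a}" "b \<in> {a\<in>A. 0 < pullback w x a}"
  proof -
    have "0 < min (pullback w x a) (pullback w x b)" using that by simp
    also have "\<dots> \<le> pullback w x (a \<oplus>\<^bsub>K\<^esub> b)" using that A(2) by (intro pullback_add) auto
    finally show ?thesis using that subringE(7)[OF A(1), of a b] by simp
  qed
  show "a \<otimes>\<^bsub>K\<^esub> b \<in> {a\<in>A. 0 < pullback w x a}"
    if "a \<in> A" "b \<in> {a\<in>A. 0 < pullback w x a}"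
  proof -
    have R: "a \<in> \<R> x" "b \<in> \<R> x" using that A(2) by auto
    have "0 < pullback w x b" using that by simp
    also have "\<dots> \<le> pullback w x a + pullback w x b" using pos[of a] that by (simp add: add_increasing)
    finally show ?thesis using that subringE(6)[OF A(1), of a b] pullback_mult[OF R] by simp
  qed
  show "a \<in> {a\<in>A. 0 < pullback w x a} \<or> b \<in> {a\<in>A. 0 < pullback w x a}"
    if "a \<in> A" "b \<in> A" "a \<otimes>\<^bsub>K\<^esub> b \<in> {a\<in>A. 0 < pullback w x a}"
  proof (rule ccontr)
    assume "\<not> ?thesis"
    then have "pullback w x a = 0" "pullback w x b = 0" using that pos by (force intro: antisym)+
    moreover have "a \<in> \<R> x" "b \<in> \<R> x" using that A(2) by auto
    ultimately show False using that pullback_mult[of a b] by simp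
  qed
qed auto

end

text \<open>Units of a local ring and of its quotient correspond: if \<open>a b\<close> is 1 modulo
  \<open>\<M> x\<close>, the difference lies in \<open>\<R> z\<close> and in \<open>\<M> x\<close>,
  hence in \<open>\<M> z\<close>, so \<open>a\<close> cannot lie in \<open>\<M> z\<close>.
  Domination can thus be tested in \<open>K\<close>.\<close>

lemma residue_nonunits_iff:
  assumes z: "z \<in> closure_pt X x" and a: "a \<in> \<R> z"
  shows "residue X x a \<in> nonunits (residue_field X x) (local_ring_closure X x z) \<longleftrightarrow> a \<in> \<M> z"
proof -
  note sub = local_ring_mono[OF z]
  have x: "x \<in> points X" using local_ring_point sub a by blast
  have *: "a \<notin> \<M> z \<longleftrightarrow> (\<exists>b\<in>\<R> z. residue X x a \<otimes>\<^bsub>residue_field X x\<^esub> residue X x b = \<one>\<^bsub>residue_field X x\<^esub>)"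
  proof
    assume "a \<notin> \<M> z"
    then obtain b where b: "b \<in> \<R> z" "a \<otimes>\<^bsub>K\<^esub> b = \<one>\<^bsub>K\<^esub>" using local_ring_unit a by blast
    then have "residue X x a \<otimes>\<^bsub>residue_field X x\<^esub> residue X x b = \<one>\<^bsub>residue_field X x\<^esub>"
      using residue_mult[of a x b] residue_one[OF x] sub a by auto
    then show "\<exists>b\<in>\<R> z. residue X x a \<otimes>\<^bsub>residue_field X x\<^esub> residue X x b = \<one>\<^bsub>residue_field X x\<^esub>"
      using b by blast
  next
    assume "\<exists>b\<in>\<R> z. residue X x a \<otimes>\<^bsub>residue_field X x\<^esub> residue X x b = \<one>\<^bsub>residue_field X x\<^esub>"
    then obtain b where b: "b \<in> \<R> z"
      "residue X x a \<otimes>\<^bsub>residue_field X x\<^esub> residue X x b = \<one>\<^bsub>residue_field X x\<^esub>" by blast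
    have ab: "a \<otimes>\<^bsub>K\<^esub> b \<in> \<R> z" using a b local_ring_mult by blast
    have one: "\<one>\<^bsub>K\<^esub> \<in> \<R> z" using local_ring_one local_ring_point a by blast
    have "residue X x \<one>\<^bsub>K\<^esub> = residue X x (a \<otimes>\<^bsub>K\<^esub> b)"
      using b a sub residue_mult[of a x b] residue_one[OF x] by auto
    then obtain m where m: "m \<in> \<M> x" "\<one>\<^bsub>K\<^esub> = m \<oplus>\<^bsub>K\<^esub> a \<otimes>\<^bsub>K\<^esub> b"
      using residue_eqD[of "\<one>\<^bsub>K\<^esub>" x "a \<otimes>\<^bsub>K\<^esub> b"] one ab sub by blast
    have carr: "m \<in> carrier K" "a \<otimes>\<^bsub>K\<^esub> b \<in> carrier K"
      using m(1) ab max_ideal_local local_ring_carrier by blast+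
    have "\<one>\<^bsub>K\<^esub> \<oplus>\<^bsub>K\<^esub> \<ominus>\<^bsub>K\<^esub> (a \<otimes>\<^bsub>K\<^esub> b) = m"
      unfolding m(2) using carr by (simp add: K.a_assoc K.r_neg)
    then have "m \<in> \<R> z" using local_ring_add[OF one local_ring_uminus[OF ab]] by simp
    then have mz: "m \<in> \<M> z" using max_ideal_mono[OF z m(1)] by blast
    show "a \<notin> \<M> z"
    proof
      assume "a \<in> \<M> z"
      then have "b \<otimes>\<^bsub>K\<^esub> a \<in> \<M> z" using max_ideal_mult b by blast
      then have "\<one>\<^bsub>K\<^esub> \<in> \<M> z"
        unfolding m(2) using max_ideal_add[OF mz] K.m_comm a b local_ring_carrier by metis
      then show False using one_notin_max_ideal by blast
    qed
  qed
  show ?thesis using * a unfolding nonunits_def[of "residue_field X x"] local_ring_closure_def by blast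
qed

lemma dominates_iff:
  assumes z: "z \<in> closure_pt X x"
  shows "dominates (residue_field X x) w (local_ring_closure X x z) \<longleftrightarrow>
    (\<forall>a\<in>\<R> z. 0 \<le> pullback w x a \<and> (0 < pullback w x a \<longleftrightarrow> a \<in> \<M> z))"
  unfolding dominates_def using residue_nonunits_iff[OF z] by (auto simp: local_ring_closure_def)

lemma dominates_residue: 
  assumes "x \<in> points X"
  shows "dominates (residue_field X x) (trivial_valuation (residue_field X x)) (local_ring_closure X x x)"
proof -
  have "x \<in> closure_pt X x" using assms in_closure_pt_iff by metis
  then show ?thesis
    by (auto simp: dominates_iff trivial_valuation_def residue_closed residue_zero_iff)
qed

lemma triv_semivaluation:
  assumes x: "x \<in> points X"
  shows "triv X x \<in> semivaluations X"
proof -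
  interpret F: field "residue_field X x" by (rule residue_field_field[OF x])
  have "x \<in> closure_pt X x" using assms in_closure_pt_iff by metis
  then show ?thesis
    using dominates_residue[OF x] F.trivial_valuation x
    unfolding semivaluations_def triv_def dominates_def by auto
qed

text \<open>Nonnegativity on the local ring of a point \<open>z0\<close> does not make
  \<open>z0\<close> the center: the center is the generization of \<open>z0\<close> cut out by the
  elements of positive value.\<close>

lemma center_exists:
  assumes "(w, x) \<in> semivaluations X"
  shows "\<exists>z\<in>closure_pt X x. dominates (residue_field X x) w (local_ring_closure X x z)"
proof -
  from assms have x: "x \<in> points X" and w: "real_valuation (residue_field X x) w"
    unfolding semivaluations_def by auto
  from assms obtain z0 where z0: "z0 \<in> closure_pt X x"
    and pos: "\<And>a. a \<in> \<R> z0 \<Longrightarrow> 0 \<le> pullback w x a"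
    unfolding semivaluations_def local_ring_closure_def by auto
  note sub0 = local_ring_mono[OF z0]
  have z0p: "z0 \<in> points X" using z0 in_closure_pt_iff by metis
  obtain z where z: "z \<in> points X" "z0 \<in> closure_pt X z"
    and Mz: "\<M> z \<inter> \<R> z0 = {a\<in>\<R> z0. 0 < pullback w x a}"
    using local_prime_point[OF z0p positive_primeideal[OF x w local_ring_subring[OF z0p] sub0 pos]]
    by blast
  obtain U where aff: "affine_open X U" and z0U: "z0 \<in> U" using affine_nbhd[OF z0p] by blast
  have U: "is_open X U" using aff unfolding affine_open_def by simp
  have xU: "x \<in> U" "z \<in> U" using z0U z0 z(2) U in_closure_pt_iff by metis+
  \<comment> \<open>Elements vanishing at \<open>x\<close> have infinite value, so the prime of
    \<open>x\<close> lies in that of \<open>z\<close>, which keeps \<open>z\<close> in the closure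
    of \<open>x\<close>.\<close>
  have "a \<in> \<M> z" if "a \<in> \<M> x" "a \<in> sections X U" for a
  proof -
    have "a \<in> {a\<in>\<R> z0. 0 < pullback w x a}"
      using pullback_max_ideal[OF x w that(1)] local_ringI[OF U z0U that(2)] by simp
    then show ?thesis using Mz by blast
  qed
  then have zx: "z \<in> closure_pt X x" using affine_closure[OF aff xU(2,1)] by blast
  have Mz_iff: "b \<in> \<M> z \<longleftrightarrow> 0 < pullback w x b" if "b \<in> \<R> z0" for b
    using Mz that by blast
  note sub = local_ring_mono[OF zx] and sub' = local_ring_mono[OF z(2)]
  have "0 \<le> pullback w x a \<and> (0 < pullback w x a \<longleftrightarrow> a \<in> \<M> z)" if a: "a \<in> \<R> z" for a
  proof -
    obtain b c where bc: "b \<in> \<R> z0" "c \<in> \<R> z0" "c \<notin> \<M> z" "a \<otimes>\<^bsub>K\<^esub> c = b"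
      using local_fraction[OF z(2) a] by blast
    \<comment> \<open>Denominators outside \<open>\<M> z\<close> have value 0, so passing from
      \<open>a\<close> to its numerator \<open>b\<close> changes neither the value nor membership in
      \<open>\<M> z\<close>.\<close>
    have "pullback w x c = 0" 
      using bc(2,3) Mz_iff[of c] pos[of c] by (simp add: order.order_iff_strict)
    then have eq: "pullback w x b = pullback w x a"
      using pullback_mult[OF x w, of a c] bc a sub sub0 by auto
    have "b \<in> \<M> z \<longleftrightarrow> a \<in> \<M> z"
    proof -
      have c: "c \<in> \<R> z" using bc(2) sub' by blast
      have "c \<otimes>\<^bsub>K\<^esub> a = b" using bc(4) K.m_comm[of c a] c a local_ring_carrier by simp
      then show ?thesis
        using bc(3,4) max_ideal_prime[OF a c] max_ideal_mult[OF c, of a] by metis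
    qed
    then show ?thesis using eq Mz_iff[OF bc(1)] pos[OF bc(1)] by simp
  qed
  then show ?thesis using zx dominates_iff[OF zx] by blast
qed

end

locale integral_separated_space = integral_space +
  assumes separated: "separated_scheme X"
begin

text \<open>Take affine neighbourhoods \<open>U\<close>, \<open>V\<close> of two centers.  As the sections over \<open>U \<inter> V\<close> are generated
  by those over \<open>U\<close> and \<open>V\<close>, the valuation is nonnegative on them, and the point of \<open>U \<inter> V\<close> where it
  is positive has the same prime as the first center in \<open>U\<close> and as the second in \<open>V\<close>.\<close>

lemma center_unique:
  assumes x: "x \<in> points X" and w: "real_valuation (residue_field X x) w"
    and y: "y \<in> closure_pt X x" "dominates (residue_field X x) w (local_ring_closure X x y)"
    and z: "z \<in> closure_pt X x" "dominates (residue_field X x) w (local_ring_closure X x z)"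
  shows "y = z"
proof -
  have yz: "y \<in> points X" "z \<in> points X" using y z in_closure_pt_iff by metis+
  obtain U where affU: "affine_open X U" and yU: "y \<in> U" using affine_nbhd[OF yz(1)] by blast
  obtain V where affV: "affine_open X V" and zV: "z \<in> V" using affine_nbhd[OF yz(2)] by blast
  let ?W = "U \<inter> V"
  let ?A = "sections X ?W"
  have opn: "is_open X U" "is_open X V" "is_open X ?W" using affU affV unfolding affine_open_def by auto
  have "x \<in> U" "x \<in> V" using y(1) z(1) yU zV opn in_closure_pt_iff by metis+
  then have xW: "x \<in> ?W" by simp
  have affW: "affine_open X ?W"
    and gen: "generate_ring (Sect X ?W) (Rest X U ?W ` carrier (Sect X U) \<union> Rest X V ?W ` carrier (Sect X V))
      = carrier (Sect X ?W)"
    using separated affU affV unfolding separated_scheme_def by blast+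
  have Wne: "?W \<noteq> {}" using xW by blast
  note A = sections_subring[OF opn(3) Wne]
  have AR: "?A \<subseteq> \<R> x" using local_ringI[OF opn(3) xW] by blast
  have gW: "g \<in> ?W" by (rule generic_in[OF opn(3) xW])
  interpret hom: ring_hom_ring "Sect X ?W" K "germ X g ?W" using opn(3) Wne by (rule germ_ring_hom)
  have posy: "0 \<le> pullback w x a" "0 < pullback w x a \<longleftrightarrow> a \<in> \<M> y" if "a \<in> \<R> y" for a
    using y(2) that unfolding dominates_iff[OF y(1)] by blast+
  have posz: "0 \<le> pullback w x a" "0 < pullback w x a \<longleftrightarrow> a \<in> \<M> z" if "a \<in> \<R> z" for a
    using z(2) that unfolding dominates_iff[OF z(1)] by blast+
  have pos: "0 \<le> pullback w x (germ X g ?W s)"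
    if "s \<in> generate_ring (Sect X ?W) (Rest X U ?W ` carrier (Sect X U) \<union> Rest X V ?W ` carrier (Sect X V))" for s
    using that
  proof induction
    case one
    then show ?case using pullback_one[OF x w] by simp
  next
    case (incl s)
    then consider t where "t \<in> carrier (Sect X U)" "s = Rest X U ?W t"
      | t where "t \<in> carrier (Sect X V)" "s = Rest X V ?W t" by blast
    then show ?case
    proof cases
      case 1
      then have "germ X g ?W s = germ X g U t" using germ_rest opn gW by simp
      then show ?thesis
        using posy(1) 1 local_ringI[OF opn(1) yU] unfolding sections_def by simp
    next
      case 2
      then have "germ X g ?W s = germ X g V t" using germ_rest opn gW by simp
      then show ?thesis
        using posz(1) 2 local_ringI[OF opn(2) zV] unfolding sections_def by simp
    qed
  next
    case (a_inv s)
    then have s: "s \<in> carrier (Sect X ?W)" unfolding gen by simp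
    then have "germ X g ?W s \<in> \<R> x" using AR unfolding sections_def by blast
    then show ?case using a_inv s pullback_uminus[OF x w] by simp
  next
    case (eng_add s t)
    then have s: "s \<in> carrier (Sect X ?W)" "t \<in> carrier (Sect X ?W)" unfolding gen by simp_all
    then have "germ X g ?W s \<in> \<R> x" "germ X g ?W t \<in> \<R> x" using AR unfolding sections_def by blast+
    from pullback_add[OF x w this] show ?case
      using eng_add s by (auto intro: order_trans[rotated])
  next
    case (eng_mult s t)
    then have s: "s \<in> carrier (Sect X ?W)" "t \<in> carrier (Sect X ?W)" unfolding gen by simp_all
    then have "germ X g ?W s \<in> \<R> x" "germ X g ?W t \<in> \<R> x" using AR unfolding sections_def by blast+
    from pullback_mult[OF x w this] show ?case using eng_mult s by simp
  qed
  then have posA: "0 \<le> pullback w x a" if "a \<in> ?A" for a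
    using that unfolding gen sections_def by blast
  obtain c where c: "c \<in> ?W" "\<M> c \<inter> ?A = {a\<in>?A. 0 < pullback w x a}"
    using affine_point_exists[OF affW Wne positive_primeideal[OF x w A AR posA]] by blast
  have UA: "sections X U \<subseteq> ?A" "sections X V \<subseteq> ?A" using sections_mono opn Wne by simp_all
  have "c = y"
  proof (rule affine_point_unique[OF affU _ yU])
    show "\<M> c \<inter> sections X U = \<M> y \<inter> sections X U"
      using c(2) UA(1) posy(2) local_ringI[OF opn(1) yU] by blast
  qed (use c in simp)
  moreover have "c = z"
  proof (rule affine_point_unique[OF affV _ zV])
    show "\<M> c \<inter> sections X V = \<M> z \<inter> sections X V"
      using c(2) UA(2) posz(2) local_ringI[OF opn(2) zV] by blast
  qed (use c in simp)
  ultimately show ?thesis by simp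
qed

lemma center_eqI:
  assumes "x \<in> points X" "real_valuation (residue_field X x) w"
    and "z \<in> closure_pt X x" "dominates (residue_field X x) w (local_ring_closure X x z)"
  shows "center X (w, x) = z"
  unfolding center_def using assms center_unique[OF assms(1,2)] by (auto intro!: the_equality)

lemma center:
  assumes "(w, x) \<in> semivaluations X"
  shows "center X (w, x) \<in> closure_pt X x"
    "dominates (residue_field X x) w (local_ring_closure X x (center X (w, x)))"
proof -
  obtain z where "z \<in> closure_pt X x" "dominates (residue_field X x) w (local_ring_closure X x z)"
    using center_exists[OF assms] by blast
  moreover from this have "center X (w, x) = z"
    using assms by (intro center_eqI) (auto simp: semivaluations_def)
  ultimately show "center X (w, x) \<in> closure_pt X x"
    "dominates (residue_field X x) w (local_ring_closure X x (center X (w, x)))" by simp_all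
qed

text \<open>The local ring of the closure at its own generic point is the whole residue field, which
  the trivial valuation dominates.\<close>

lemma center_triv:
  assumes x: "x \<in> points X"
  shows "center X (triv X x) = x"
proof -
  interpret F: field "residue_field X x" by (rule residue_field_field[OF x])
  have "x \<in> closure_pt X x" using assms in_closure_pt_iff by metis
  then show ?thesis unfolding triv_def
    by (intro center_eqI dominates_residue x F.trivial_valuation)
qed

end

section \<open>Cartier subalgebras and log discrepancies\<close>

text \<open>With \<open>v f = 0\<close> only the nonpositive term in \<open>v (\<psi> f)\<close>
  remains. That value may be infinite, as a map may kill \<open>f\<close>, so the case split runs
  over extended reals; the bounds on \<open>p\<close> and \<open>n\<close> keep the denominator
  positive.\<close>

lemma E_term_triv_le:
  assumes "p \<ge> 2" "n \<ge> 1" "v f = 0" "v (\<psi> f) \<ge> 0"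
  shows "E_term p n f \<psi> v \<le> 0"
proof -
  have "real p ^ n > 1" using assms by (intro one_less_power) auto
  moreover have "0 \<le> ereal (real p ^ n) * v (\<psi> f)" using assms by (intro ereal_0_le_mult) auto
  ultimately show ?thesis using assms(3) unfolding E_term_def
    by (cases "ereal (real p ^ n) * v (\<psi> f)") (auto simp: divide_le_0_iff)
qed

locale cartier_space = integral_separated_space X for X :: "('x, 'a) ringed_space" +
  fixes p :: nat and D :: "('x, 'a) graded_maps"
  assumes p: "2 \<le> p" and cartier: "cartier_subalgebra X p D"
begin

abbreviation "\<D> \<equiv> cartier_stalk X D"

lemma cartier_full: "is_open X U \<Longrightarrow> U \<noteq> {} \<Longrightarrow> D e U \<subseteq> full_cartier X p e U"
  using cartier unfolding cartier_subalgebra_def by (elim conjE) simp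

lemma cartier_mono: "is_open X U \<Longrightarrow> is_open X V \<Longrightarrow> V \<noteq> {} \<Longrightarrow> V \<subseteq> U \<Longrightarrow> D e U \<subseteq> D e V"
  using cartier unfolding cartier_subalgebra_def by (elim conjE) simp

lemma cartier_zero: "is_open X U \<Longrightarrow> U \<noteq> {} \<Longrightarrow>
    D 0 U = (\<lambda>a. \<lambda>g\<in>carrier K. a \<otimes>\<^bsub>K\<^esub> g) ` sections X U"
  using cartier unfolding cartier_subalgebra_def by (elim conjE) simp

lemma cartier_compose: "is_open X U \<Longrightarrow> U \<noteq> {} \<Longrightarrow> \<phi> \<in> D d U \<Longrightarrow> \<psi> \<in> D e U \<Longrightarrow>
    compose (carrier K) \<phi> \<psi> \<in> D (d + e) U"
  using cartier unfolding cartier_subalgebra_def by (elim conjE) simp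

lemma cartier_quasicoherent: "affine_open X U \<Longrightarrow> U \<noteq> {} \<Longrightarrow> f \<in> sections X U \<Longrightarrow>
    distinguished X U f \<noteq> {} \<Longrightarrow> \<psi> \<in> D e (distinguished X U f) \<Longrightarrow>
    \<exists>n::nat. scale K (f [^]\<^bsub>K\<^esub> n) \<psi> \<in> D e U"
  using cartier unfolding cartier_subalgebra_def by (elim conjE) simp

section \<open>Stalks of the Cartier subalgebra and their module structure\<close>

lemma stalkI: "is_open X U \<Longrightarrow> x \<in> U \<Longrightarrow> \<psi> \<in> D e U \<Longrightarrow> \<psi> \<in> \<D> x e"
  unfolding cartier_stalk_def by blast

lemma stalkE:
  assumes "\<psi> \<in> \<D> x e"
  obtains U where "is_open X U" "x \<in> U" "\<psi> \<in> D e U"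
  using assms unfolding cartier_stalk_def by blast

lemma stalk_mono: "x \<in> closure_pt X y \<Longrightarrow> \<D> x e \<subseteq> \<D> y e"
  unfolding in_closure_pt_iff by (blast elim: stalkE intro: stalkI)

lemma stalk_p_linear:
  assumes "\<psi> \<in> \<D> x e"
  shows "\<psi> \<in> p_linear K p e"
  using assms cartier_full unfolding full_cartier_def by (blast elim: stalkE)

lemma stalk_closed: "\<psi> \<in> \<D> x e \<Longrightarrow> a \<in> carrier K \<Longrightarrow> \<psi> a \<in> carrier K"
  using stalk_p_linear unfolding p_linear_def by blast

lemma stalk_additive: "\<psi> \<in> \<D> x e \<Longrightarrow> a \<in> carrier K \<Longrightarrow> b \<in> carrier K \<Longrightarrow>
    \<psi> (a \<oplus>\<^bsub>K\<^esub> b) = \<psi> a \<oplus>\<^bsub>K\<^esub> \<psi> b"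
  using stalk_p_linear unfolding p_linear_def by blast

lemma stalk_linear: "\<psi> \<in> \<D> x e \<Longrightarrow> a \<in> carrier K \<Longrightarrow> b \<in> carrier K \<Longrightarrow>
    \<psi> (a [^]\<^bsub>K\<^esub> (p ^ e) \<otimes>\<^bsub>K\<^esub> b) = a \<otimes>\<^bsub>K\<^esub> \<psi> b"
  using stalk_p_linear unfolding p_linear_def by blast

lemma stalk_local:
  assumes \<psi>: "\<psi> \<in> \<D> x e" and a: "a \<in> \<R> x"
  shows "\<psi> a \<in> \<R> x"
proof -
  obtain U where U: "is_open X U" "x \<in> U" "\<psi> \<in> D e U" using \<psi> by (rule stalkE)
  obtain V where V: "is_open X V" "x \<in> V" "a \<in> sections X V" using a by (rule local_ringE)
  have W: "is_open X (U \<inter> V)" "x \<in> U \<inter> V" using U V by auto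
  then have "U \<inter> V \<noteq> {}" by blast
  then have "\<psi> ` sections X (U \<inter> V) \<subseteq> sections X (U \<inter> V)" "a \<in> sections X (U \<inter> V)"
    using cartier_full[OF U(1)] U W V sections_mono[of V "U \<inter> V"] unfolding full_cartier_def by blast+
  then show ?thesis using local_ringI[OF W] by blast
qed

lemma stalk_compose:
  assumes "\<phi> \<in> \<D> x d" "\<psi> \<in> \<D> x e"
  shows "compose (carrier K) \<phi> \<psi> \<in> \<D> x (d + e)"
proof -
  obtain U where U: "is_open X U" "x \<in> U" "\<phi> \<in> D d U" using assms(1) by (rule stalkE)
  obtain V where V: "is_open X V" "x \<in> V" "\<psi> \<in> D e V" using assms(2) by (rule stalkE)
  have W: "is_open X (U \<inter> V)" "x \<in> U \<inter> V" using U V by auto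
  then have "U \<inter> V \<noteq> {}" by blast
  then have "\<phi> \<in> D d (U \<inter> V)" "\<psi> \<in> D e (U \<inter> V)"
    using cartier_mono[of U "U \<inter> V"] cartier_mono[of V "U \<inter> V"] U V W by blast+
  then show ?thesis using cartier_compose[OF W(1) \<open>U \<inter> V \<noteq> {}\<close>] stalkI[OF W] by blast
qed

lemma stalk_multiplication:
  assumes "a \<in> \<R> x"
  shows "(\<lambda>b\<in>carrier K. a \<otimes>\<^bsub>K\<^esub> b) \<in> \<D> x 0"
proof -
  obtain U where U: "is_open X U" "x \<in> U" "a \<in> sections X U" using assms by (rule local_ringE)
  then have "(\<lambda>b\<in>carrier K. a \<otimes>\<^bsub>K\<^esub> b) \<in> D 0 U" using cartier_zero by blast
  then show ?thesis using stalkI U by blast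
qed

text \<open>Degree zero consists of the multiplications by sections, so composing with them on one
  side or, in the next lemma, on the other gives the left and right module structures.\<close>

lemma stalk_mult_left:
  assumes a: "a \<in> \<R> x" and \<psi>: "\<psi> \<in> \<D> x e"
  shows "\<exists>\<phi>\<in>\<D> x e. \<forall>b\<in>carrier K. \<phi> b = a \<otimes>\<^bsub>K\<^esub> \<psi> b"
  using stalk_compose[OF stalk_multiplication[OF a] \<psi>] stalk_closed[OF \<psi>]
  by (intro bexI[of _ "compose (carrier K) (\<lambda>b\<in>carrier K. a \<otimes>\<^bsub>K\<^esub> b) \<psi>"])
    (auto simp: compose_def)

lemma stalk_mult_right:
  assumes a: "a \<in> \<R> x" and \<psi>: "\<psi> \<in> \<D> x e"
  shows "\<exists>\<phi>\<in>\<D> x e. \<forall>b\<in>carrier K. \<phi> b = \<psi> (a \<otimes>\<^bsub>K\<^esub> b)"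
  using stalk_compose[OF \<psi> stalk_multiplication[OF a]]
  by (intro bexI[of _ "compose (carrier K) \<psi> (\<lambda>b\<in>carrier K. a \<otimes>\<^bsub>K\<^esub> b)"])
    (auto simp: compose_def)

lemma stalk_comp:
  assumes "\<phi> \<in> \<D> x d" "\<psi> \<in> \<D> x e"
  shows "\<exists>\<theta>\<in>\<D> x (d + e). \<forall>b\<in>carrier K. \<theta> b = \<phi> (\<psi> b)"
  using stalk_compose[OF assms]
  by (intro bexI[of _ "compose (carrier K) \<phi> \<psi>"]) (auto simp: compose_def)

text \<open>Quasi-coherence at work: in an affine neighbourhood of \<open>x\<close>, the map \<psi>
  is defined on some D(f) around \<open>y\<close>. Multiplying by a power of \<open>f\<close>
  extends it to the whole neighbourhood, and \<open>f\<close> is a unit at \<open>y\<close>.\<close>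

lemma stalk_generalize:
  assumes cl: "x \<in> closure_pt X y" and \<psi>: "\<psi> \<in> \<D> y e"
  shows "\<exists>c\<in>\<R> x. c \<notin> \<M> y \<and> (\<exists>\<phi>\<in>\<D> x e. \<forall>b\<in>carrier K. \<phi> b = c \<otimes>\<^bsub>K\<^esub> \<psi> b)"
proof -
  have x: "x \<in> points X" using cl in_closure_pt_iff by metis
  obtain U where aff: "affine_open X U" and xU: "x \<in> U" using affine_nbhd[OF x] by blast
  then have U: "is_open X U" "U \<noteq> {}" unfolding affine_open_def by auto
  have yU: "y \<in> U" using cl xU U in_closure_pt_iff by metis
  obtain V where V: "is_open X V" "y \<in> V" "\<psi> \<in> D e V" using \<psi> by (rule stalkE)
  obtain f where f: "f \<in> sections X U" "y \<in> distinguished X U f" "distinguished X U f \<subseteq> V"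
    "is_open X (distinguished X U f)" using affine_basis[OF aff V(1,2) yU] by blast
  then have ne: "distinguished X U f \<noteq> {}" by blast
  have "\<psi> \<in> D e (distinguished X U f)" using cartier_mono[OF V(1) f(4) ne f(3)] V(3) by blast
  then obtain n :: nat where n: "scale K (f [^]\<^bsub>K\<^esub> n) \<psi> \<in> D e U"
    using cartier_quasicoherent[OF aff U(2) f(1) ne] by blast
  have fx: "f \<in> \<R> x" by (rule local_ringI[OF U(1) xU f(1)])
  have fy: "f \<in> \<R> y" "f \<notin> \<M> y"
    using f(2) local_ringI[OF U(1) yU f(1)] unfolding distinguished_eq[OF U(1) f(1)] by auto
  have "f [^]\<^bsub>K\<^esub> n \<notin> \<M> y"
  proof (induction n)
    case 0
    then show ?case using one_notin_max_ideal by simp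
  next
    case (Suc n)
    then show ?case using max_ideal_prime[OF local_ring_pow[OF fy(1)] fy(1), of n] fy by auto
  qed
  moreover have "\<forall>b\<in>carrier K. scale K (f [^]\<^bsub>K\<^esub> n) \<psi> b = f [^]\<^bsub>K\<^esub> n \<otimes>\<^bsub>K\<^esub> \<psi> b"
    unfolding scale_def by simp
  ultimately show ?thesis using local_ring_pow[OF fx] stalkI[OF U(1) xU n] by blast
qed

section \<open>Uniform compatibility and induced maps\<close>

text \<open>Testing at the generic point of the closed subscheme is enough. At a specialization the
  maps also lie in the stalk at \<open>x\<close> and the ideal is an intersection with
  \<open>\<M> x\<close>; off the closure the ideal is the whole local ring.\<close>

lemma compatible_iff:
  assumes x: "x \<in> points X"
  shows "uniformly_compatible X D x \<longleftrightarrow> (\<forall>e\<ge>1. \<forall>\<psi>\<in>\<D> x e. \<psi> ` \<M> x \<subseteq> \<M> x)"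
proof
  have "x \<in> closure_pt X x" using x in_closure_pt_iff by metis
  then have "ideal_closure X x x = \<M> x" using max_ideal_local unfolding ideal_closure_def by auto
  then show "\<forall>e\<ge>1. \<forall>\<psi>\<in>\<D> x e. \<psi> ` \<M> x \<subseteq> \<M> x" if "uniformly_compatible X D x"
    using that x unfolding uniformly_compatible_def by metis
next
  assume *: "\<forall>e\<ge>1. \<forall>\<psi>\<in>\<D> x e. \<psi> ` \<M> x \<subseteq> \<M> x"
  have "\<psi> a \<in> ideal_closure X x z"
    if "e \<ge> 1" and \<psi>: "\<psi> \<in> \<D> z e" and a: "a \<in> ideal_closure X x z" for z e \<psi> a
  proof (cases "z \<in> closure_pt X x")
    case True
    then have "\<psi> \<in> \<D> x e" using stalk_mono \<psi> by blast
    then show ?thesis using * \<open>e \<ge> 1\<close> a stalk_local[OF \<psi>] True unfolding ideal_closure_def by auto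
  next
    case False
    then show ?thesis using a stalk_local[OF \<psi>] unfolding ideal_closure_def by auto
  qed
  then show "uniformly_compatible X D x" unfolding uniformly_compatible_def by blast
qed

lemma compatible_max_ideal:
  assumes "uniformly_compatible X D x" "e \<ge> 1" "\<psi> \<in> \<D> x e" "a \<in> \<M> x"
  shows "\<psi> a \<in> \<M> x"
  using assms compatible_iff[OF local_ring_point[OF max_ideal_local[OF assms(4)]]]
  by (simp add: image_subset_iff)

text \<open>Two representatives of a residue differ by an element of \<open>\<M> x\<close>, which
  \<psi> keeps in \<open>\<M> x\<close> by compatibility; additivity then makes the map on residues
  well defined.\<close>

lemma induced_map:
  assumes x: "x \<in> points X" and compat: "uniformly_compatible X D x" and z: "z \<in> closure_pt X x"
    and e: "e \<ge> 1" and \<psi>: "\<psi> \<in> \<D> z e"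
  obtains \<phi> where "\<phi> \<in> induced_stalk X D x z e"
    "\<And>a. a \<in> \<R> x \<Longrightarrow> \<phi> (residue X x a) = residue X x (\<psi> a)"
proof -
  let ?k = "residue_field X x"
  interpret F: field ?k by (rule residue_field_field[OF x])
  have \<psi>x: "\<psi> \<in> \<D> x e" using stalk_mono[OF z] \<psi> by blast
  have wd: "residue X x (\<psi> a) = residue X x (\<psi> b)"
    if ab: "a \<in> \<R> x" "b \<in> \<R> x" "residue X x a = residue X x b" for a b
  proof -
    obtain m where m: "m \<in> \<M> x" "a = m \<oplus>\<^bsub>K\<^esub> b" using residue_eqD[OF ab] by blast
    have \<psi>m: "\<psi> m \<in> \<M> x" by (rule compatible_max_ideal[OF compat e \<psi>x m(1)])
    have "\<psi> a = \<psi> m \<oplus>\<^bsub>K\<^esub> \<psi> b"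
      unfolding m(2) using m(1) ab(2) max_ideal_local local_ring_carrier
      by (intro stalk_additive[OF \<psi>x]) blast+
    then have "residue X x (\<psi> a) = residue X x (\<psi> m) \<oplus>\<^bsub>?k\<^esub> residue X x (\<psi> b)"
      using residue_add[OF max_ideal_local[OF \<psi>m] stalk_local[OF \<psi>x ab(2)]] by simp
    also have "residue X x (\<psi> m) = \<zero>\<^bsub>?k\<^esub>" using residue_zero_iff[OF max_ideal_local[OF \<psi>m]] \<psi>m by simp
    finally show ?thesis using residue_closed[OF stalk_local[OF \<psi>x ab(2)]] by simp
  qed
  define \<phi> where "\<phi> = (\<lambda>c\<in>carrier ?k. residue X x (\<psi> (SOME a. a \<in> \<R> x \<and> residue X x a = c)))"
  have \<phi>: "\<phi> (residue X x a) = residue X x (\<psi> a)" if a: "a \<in> \<R> x" for a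
  proof -
    let ?b = "SOME b. b \<in> \<R> x \<and> residue X x b = residue X x a"
    have "?b \<in> \<R> x \<and> residue X x ?b = residue X x a" by (rule someI[of _ a]) (use a in simp)
    then have "residue X x (\<psi> ?b) = residue X x (\<psi> a)" using wd a by blast
    then show ?thesis unfolding \<phi>_def using residue_closed[OF a] by simp
  qed
  have "\<phi> \<in> carrier ?k \<rightarrow>\<^sub>E carrier ?k"
  proof (rule PiE_I)
    fix c assume "c \<in> carrier ?k"
    then obtain a where "a \<in> \<R> x" "c = residue X x a" unfolding residue_field_carrier by blast
    then show "\<phi> c \<in> carrier ?k" using \<phi> residue_closed stalk_local[OF \<psi>x] by simp
  qed (simp add: \<phi>_def)
  then have "\<phi> \<in> induced_stalk X D x z e" unfolding induced_stalk_def using \<psi> \<phi> by blast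
  then show thesis using that \<phi> by blast
qed

section \<open>Bounds on log discrepancies\<close>

text \<open>The left side is one term of the suprema: \<open>n = 1\<close>, the map induced by
  \<psi>, and the residue of \<open>a\<close>. Its image is 1, which has value 0.\<close>

lemma log_discrepancy_ge:
  assumes \<zeta>: "(w, x) \<in> semivaluations X" and compat: "uniformly_compatible X D x"
    and e: "e \<ge> 1" and \<psi>: "\<psi> \<in> \<D> (center X (w, x)) e"
    and a: "a \<in> \<R> x" "\<psi> a = \<one>\<^bsub>K\<^esub>"
  shows "pullback w x a / ereal (real p ^ e - 1) \<le> log_discrepancy X p D (w, x)"
proof -
  let ?k = "residue_field X x" and ?z = "center X (w, x)"
  from \<zeta> have x: "x \<in> points X" and w: "real_valuation ?k w" unfolding semivaluations_def by auto
  interpret F: field ?k by (rule residue_field_field[OF x])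
  note z = center(1)[OF \<zeta>]
  have \<psi>x: "\<psi> \<in> \<D> x e" using stalk_mono[OF z] \<psi> by blast
  obtain \<phi> where \<phi>: "\<phi> \<in> induced_stalk X D x ?z e"
    "\<And>a. a \<in> \<R> x \<Longrightarrow> \<phi> (residue X x a) = residue X x (\<psi> a)"
    using induced_map[OF x compat z e \<psi>] by blast
  let ?c = "residue X x a"
  have \<phi>c: "\<phi> ?c = \<one>\<^bsub>?k\<^esub>" using \<phi>(2)[OF a(1)] a(2) residue_one[OF x] by simp
  \<comment> \<open>The residue must be nonzero to be admissible in the supremum; if it were zero,
    compatibility would put 1 into \<open>\<M> x\<close>.\<close>
  have "a \<notin> \<M> x"
  proof
    assume "a \<in> \<M> x"
    then show False using compatible_max_ideal[OF compat e \<psi>x] a(2) one_notin_max_ideal by metis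
  qed
  then have c: "?c \<in> carrier ?k - {\<zero>\<^bsub>?k\<^esub>}" using residue_closed residue_zero_iff a by simp
  have "pullback w x a / ereal (real p ^ e - 1) = E_term p (1 * e) ?c (\<phi> ^^ 1) w"
    unfolding E_term_def using \<phi>c F.real_valuation_one[OF w] by simp
  also have "\<dots> \<le> log_discrepancy_map ?k p e \<phi> w"
    unfolding log_discrepancy_map_def by (rule Sup_upper) (use c in blast)
  also have "\<dots> \<le> log_discrepancy_stalk ?k p (induced_stalk X D x ?z) w"
    unfolding log_discrepancy_stalk_def
  proof (rule Sup_upper)
    have "nonzero_map ?k \<phi>" unfolding nonzero_map_def using c \<phi>c by (intro bexI[of _ ?c]) auto
    then show "log_discrepancy_map ?k p e \<phi> w \<in> {log_discrepancy_map ?k p e \<psi> w |e \<psi>.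
        1 \<le> e \<and> \<psi> \<in> induced_stalk X D x ?z e \<and> nonzero_map ?k \<psi>}" using e \<phi>(1) by blast
  qed
  also have "\<dots> = log_discrepancy X p D (w, x)" unfolding log_discrepancy_def using compat by simp
  finally show ?thesis .
qed

text \<open>The trivial valuation is 0 on nonzero elements and never negative, so no term of the
  suprema is positive. The bound holds with any stalk \<open>z\<close> in place of the one at the
  center.\<close>

lemma log_discrepancy_triv_le:
  assumes x: "x \<in> points X" and compat: "uniformly_compatible X D x"
  shows "log_discrepancy X p D (triv X x) \<le> 0"
proof -
  let ?k = "residue_field X x"
  have "E_term p (n * e) f (\<phi> ^^ n) (trivial_valuation ?k) \<le> 0"
    if "e \<ge> 1" "n \<ge> 1" "f \<in> carrier ?k - {\<zero>\<^bsub>?k\<^esub>}" "\<phi> \<in> carrier ?k \<rightarrow> carrier ?k" for e n f \<phi>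
  proof (rule E_term_triv_le[OF p])
    have "(\<phi> ^^ m) f \<in> carrier ?k" for m using that(3,4) by (induction m) auto
    then show "0 \<le> trivial_valuation ?k ((\<phi> ^^ n) f)" unfolding trivial_valuation_def by simp
  qed (use that in \<open>auto simp: trivial_valuation_def\<close>)
  then have "log_discrepancy_map ?k p e \<phi> (trivial_valuation ?k) \<le> 0"
    if "e \<ge> 1" "\<phi> \<in> carrier ?k \<rightarrow> carrier ?k" for e \<phi>
    using that unfolding log_discrepancy_map_def by (intro Sup_least) blast
  then have "log_discrepancy_stalk ?k p (induced_stalk X D x z) (trivial_valuation ?k) \<le> 0" for z
    unfolding log_discrepancy_stalk_def
    by (intro Sup_least) (auto simp: induced_stalk_def PiE_def)
  then show ?thesis using compat unfolding log_discrepancy_def triv_def by simp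
qed

text \<open>The assumption already makes \<open>x\<close> compatible, and every induced map is zero.
  The log discrepancy is then a supremum over the empty set, that is, minus infinity.\<close>

lemma log_discrepancy_triv_neg:
  assumes x: "x \<in> points X" and zero: "\<And>e \<psi>. e \<ge> 1 \<Longrightarrow> \<psi> \<in> \<D> x e \<Longrightarrow> \<psi> ` \<R> x \<subseteq> \<M> x"
  shows "log_discrepancy X p D (triv X x) < 0"
proof -
  let ?k = "residue_field X x"
  have compat: "uniformly_compatible X D x"
    unfolding compatible_iff[OF x] using zero max_ideal_local by blast
  have "\<not> nonzero_map ?k \<phi>" if "e \<ge> 1" "\<phi> \<in> induced_stalk X D x x e" for e \<phi>
  proof -
    from that obtain \<psi> where \<psi>: "\<psi> \<in> \<D> x e" "\<forall>f\<in>\<R> x. \<phi> (residue X x f) = residue X x (\<psi> f)"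
      unfolding induced_stalk_def by blast
    have "\<phi> (residue X x f) = \<zero>\<^bsub>?k\<^esub>" if "f \<in> \<R> x" for f
    proof -
      have "\<psi> f \<in> \<M> x" using zero[OF \<open>e \<ge> 1\<close> \<psi>(1)] that by blast
      then show ?thesis using \<psi>(2) that residue_zero_iff[OF max_ideal_local] by simp
    qed
    then show ?thesis unfolding nonzero_map_def residue_field_carrier by blast
  qed
  then have none: "{log_discrepancy_map ?k p e \<psi> v |e \<psi>. 1 \<le> e \<and> \<psi> \<in> induced_stalk X D x x e \<and>
      nonzero_map ?k \<psi>} = {}" for v by blast
  have "log_discrepancy_stalk ?k p (induced_stalk X D x x) v = Sup {}" for v
    unfolding log_discrepancy_stalk_def none ..
  then have "log_discrepancy X p D (triv X x) = Sup {}"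
    using compat center_triv[OF x] unfolding log_discrepancy_def triv_def by simp
  then show ?thesis by (simp add: bot_ereal_def)
qed

lemma unit_value:
  assumes \<psi>: "\<psi> \<in> \<D> x e" and a: "a \<in> \<R> x" "\<psi> a \<notin> \<M> x"
  shows "\<exists>b\<in>\<R> x. \<psi> a \<otimes>\<^bsub>K\<^esub> b = \<one>\<^bsub>K\<^esub>"
  using local_ring_unit[OF stalk_local[OF \<psi> a(1)] a(2)] .

text \<open>If \<open>\<psi> a\<close> is a unit with inverse \<open>b\<close>, then
  \<open>r\<close> is the image of \<open>(r b)^q a\<close> for \<open>q = p^e\<close>; a single
  unit value makes \<psi> onto.\<close>

lemma surjective_iff:
  assumes x: "x \<in> points X" and \<psi>: "\<psi> \<in> \<D> x e"
  shows "\<psi> ` \<R> x = \<R> x \<longleftrightarrow> \<not> \<psi> ` \<R> x \<subseteq> \<M> x"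
proof
  assume "\<psi> ` \<R> x = \<R> x"
  then show "\<not> \<psi> ` \<R> x \<subseteq> \<M> x" using local_ring_one[OF x] one_notin_max_ideal by blast
next
  assume "\<not> \<psi> ` \<R> x \<subseteq> \<M> x"
  then obtain a where a: "a \<in> \<R> x" "\<psi> a \<notin> \<M> x" by blast
  then obtain b where b: "b \<in> \<R> x" "\<psi> a \<otimes>\<^bsub>K\<^esub> b = \<one>\<^bsub>K\<^esub>" using unit_value[OF \<psi>] by blast
  have "r \<in> \<psi> ` \<R> x" if r: "r \<in> \<R> x" for r
  proof -
    have c: "r \<in> carrier K" "b \<in> carrier K" "a \<in> carrier K" "\<psi> a \<in> carrier K"
      using r b a local_ring_carrier stalk_closed[OF \<psi>] by blast+
    have "\<psi> ((r \<otimes>\<^bsub>K\<^esub> b) [^]\<^bsub>K\<^esub> (p ^ e) \<otimes>\<^bsub>K\<^esub> a) = r \<otimes>\<^bsub>K\<^esub> b \<otimes>\<^bsub>K\<^esub> \<psi> a"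
      using stalk_linear[OF \<psi>] c by simp
    also have "\<dots> = r" using c b(2) by (simp add: K.m_assoc K.m_comm[of b])
    finally have "r = \<psi> ((r \<otimes>\<^bsub>K\<^esub> b) [^]\<^bsub>K\<^esub> (p ^ e) \<otimes>\<^bsub>K\<^esub> a)" by simp
    moreover have "(r \<otimes>\<^bsub>K\<^esub> b) [^]\<^bsub>K\<^esub> (p ^ e) \<otimes>\<^bsub>K\<^esub> a \<in> \<R> x"
      using local_ring_mult local_ring_pow r b a by blast
    ultimately show ?thesis by blast
  qed
  then show "\<psi> ` \<R> x = \<R> x" using stalk_local[OF \<psi>] by blast
qed

section \<open>Purity and regularity against signs of log discrepancies\<close>

text \<open>Purity is used at the center, not at the home: a preimage of 1 in the local ring of the
  center has nonnegative value because that ring is dominated.\<close>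

lemma pure_imp_log_discrepancy_nonneg:
  assumes pure: "sharply_F_pure X D" and \<zeta>: "\<zeta> \<in> semivaluations X"
  shows "log_discrepancy X p D \<zeta> \<ge> 0"
proof -
  obtain w x where \<zeta>_eq: "\<zeta> = (w, x)" by fastforce
  note \<zeta>' = \<zeta>[unfolded \<zeta>_eq]
  let ?z = "center X (w, x)"
  show ?thesis
  proof (cases "uniformly_compatible X D x")
    case True
    note z = center[OF \<zeta>']
    have zp: "?z \<in> points X" using z(1) in_closure_pt_iff by metis
    then obtain e \<psi> where \<psi>: "e \<ge> 1" "\<psi> \<in> \<D> ?z e" "\<psi> ` \<R> ?z = \<R> ?z"
      using pure unfolding sharply_F_pure_def by blast
    have "\<one>\<^bsub>K\<^esub> \<in> \<psi> ` \<R> ?z" using \<psi>(3) local_ring_one[OF zp] by simp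
    then obtain a where a: "a \<in> \<R> ?z" "\<psi> a = \<one>\<^bsub>K\<^esub>" by auto
    have "0 \<le> pullback w x a" using z(2) a(1) unfolding dominates_iff[OF z(1)] by blast
    moreover have "real p ^ e > 1" using p \<psi>(1) by (intro one_less_power) auto
    ultimately have "0 \<le> pullback w x a / ereal (real p ^ e - 1)" by simp
    also have "\<dots> \<le> log_discrepancy X p D (w, x)"
      using log_discrepancy_ge[OF \<zeta>' True \<psi>(1,2)] a local_ring_mono[OF z(1)] by blast
    finally show ?thesis unfolding \<zeta>_eq .
  next
    case False
    then show ?thesis unfolding \<zeta>_eq log_discrepancy_def by simp
  qed
qed

lemma triv_nonneg_imp_pure:
  assumes "\<And>x. x \<in> points X \<Longrightarrow> log_discrepancy X p D (triv X x) \<ge> 0"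
  shows "sharply_F_pure X D"
  unfolding sharply_F_pure_def
proof
  fix x assume x: "x \<in> points X"
  then have "\<not> log_discrepancy X p D (triv X x) < 0" using assms by (simp add: leD)
  then obtain e \<psi> where "e \<ge> 1" "\<psi> \<in> \<D> x e" "\<not> \<psi> ` \<R> x \<subseteq> \<M> x"
    using log_discrepancy_triv_neg[OF x] by blast
  then show "\<exists>e\<ge>1. \<exists>\<psi>\<in>\<D> x e. \<psi> ` \<R> x = \<R> x" using surjective_iff[OF x] by blast
qed

text \<open>At a nongeneric home compatibility fails, since regularity sends a nonzero element of
  the maximal ideal to 1. At the generic home the valuation is nontrivial, which yields an element
  of positive value to feed into regularity at the center.\<close>

lemma regular_imp_log_discrepancy_pos:
  assumes reg: "strongly_F_regular X D" and \<zeta>: "\<zeta> \<in> semivaluations X" "\<zeta> \<noteq> triv X g"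
  shows "log_discrepancy X p D \<zeta> > 0"
proof -
  obtain w x where \<zeta>_eq: "\<zeta> = (w, x)" by fastforce
  note \<zeta>' = \<zeta>(1)[unfolded \<zeta>_eq]
  let ?z = "center X (w, x)"
  from \<zeta>' have x: "x \<in> points X" and w: "real_valuation (residue_field X x) w"
    unfolding semivaluations_def by auto
  show ?thesis
  proof (cases "uniformly_compatible X D x")
    case True
    have "x = g"
    proof (rule ccontr)
      assume "x \<noteq> g"
      then obtain f where f: "f \<in> \<M> x" "f \<noteq> \<zero>\<^bsub>K\<^esub>" using max_ideal_nontrivial x by blast
      then have "f \<in> \<R> x - {\<zero>\<^bsub>K\<^esub>}" using max_ideal_local by blast
      then obtain e \<psi> where \<psi>: "e \<ge> 1" "\<psi> \<in> \<D> x e" "\<psi> f = \<one>\<^bsub>K\<^esub>"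
        using reg x unfolding strongly_F_regular_def by blast
      then show False using compatible_max_ideal[OF True \<psi>(1,2) f(1)] \<psi>(3) one_notin_max_ideal by metis
    qed
    then have nontriv: "w \<noteq> trivial_valuation (residue_field X x)" using \<zeta>(2) unfolding \<zeta>_eq triv_def by blast
    note z = center[OF \<zeta>']
    have zp: "?z \<in> points X" using z(1) in_closure_pt_iff by metis
    have dom: "0 \<le> pullback w x a" if "a \<in> \<R> ?z" for a
      using z(2) that unfolding dominates_iff[OF z(1)] by blast
    have "\<exists>c\<in>carrier (residue_field X x). w c \<noteq> trivial_valuation (residue_field X x) c"
    proof (rule ccontr)
      assume "\<not> ?thesis"
      moreover have "w \<in> extensional (carrier (residue_field X x))"
        using w unfolding real_valuation_def by blast
      ultimately have "w = trivial_valuation (residue_field X x)"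
        by (intro extensionalityI) (auto simp: trivial_valuation_def)
      then show False using nontriv by blast
    qed
    then obtain k where k: "k \<in> \<R> x" "pullback w x k \<noteq> trivial_valuation (residue_field X x) (residue X x k)"
      unfolding residue_field_carrier by blast
    have kM: "k \<notin> \<M> x"
    proof
      assume k': "k \<in> \<M> x"
      then have "residue X x k = \<zero>\<^bsub>residue_field X x\<^esub>" using residue_zero_iff[OF k(1)] by blast
      then show False
        using k pullback_max_ideal[OF x w k'] residue_closed[OF k(1)] by (simp add: trivial_valuation_def)
    qed
    then have "residue X x k \<noteq> \<zero>\<^bsub>residue_field X x\<^esub>" using residue_zero_iff[OF k(1)] by blast
    then have k0: "pullback w x k \<noteq> 0" using k residue_closed[OF k(1)] by (simp add: trivial_valuation_def)
    \<comment> \<open>\<open>k\<close> need not be defined at the center, so it is written as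
      \<open>b / c\<close>. Since its value is not 0, one of \<open>b\<close> and \<open>c\<close>
      has nonzero value, which is positive because both lie in the dominated ring.\<close>
    obtain b c where bc: "b \<in> \<R> ?z" "c \<in> \<R> ?z" "c \<notin> \<M> x" "k \<otimes>\<^bsub>K\<^esub> c = b"
      using local_fraction[OF z(1) k(1)] by blast
    have R: "b \<in> \<R> x" "c \<in> \<R> x" using bc local_ring_mono[OF z(1)] by blast+
    have "pullback w x b = pullback w x k + pullback w x c"
      using pullback_mult[OF x w k(1) R(2)] bc(4) by simp
    then have "pullback w x b \<noteq> 0 \<or> pullback w x c \<noteq> 0" using k0 by auto
    moreover have "b \<notin> \<M> x" using max_ideal_prime[OF k(1) R(2)] bc kM by blast
    ultimately obtain f where f: "f \<in> \<R> ?z" "f \<notin> \<M> x" "pullback w x f \<noteq> 0" using bc by blast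
    have "0 < pullback w x f" using dom[OF f(1)] f(3) by (simp add: order.order_iff_strict)
    moreover have "f \<noteq> \<zero>\<^bsub>K\<^esub>" using f(2) max_ideal_zero[OF x] by blast
    then obtain e \<psi> where \<psi>: "e \<ge> 1" "\<psi> \<in> \<D> ?z e" "\<psi> f = \<one>\<^bsub>K\<^esub>"
      using reg zp f(1) unfolding strongly_F_regular_def by blast
    have "real p ^ e > 1" using p \<psi>(1) by (intro one_less_power) auto
    ultimately have "0 < pullback w x f / ereal (real p ^ e - 1)"
      by (cases "pullback w x f") auto
    also have "\<dots> \<le> log_discrepancy X p D (w, x)"
      using log_discrepancy_ge[OF \<zeta>' True \<psi>(1,2)] \<psi>(3) f(1) local_ring_mono[OF z(1)] by blast
    finally show ?thesis unfolding \<zeta>_eq .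
  next
    case False
    then show ?thesis unfolding \<zeta>_eq log_discrepancy_def by simp
  qed
qed

text \<open>When it is proper, this is the splitting prime of \<open>D\<close> at \<open>x\<close>.\<close>

definition splitting_ideal :: "'x \<Rightarrow> ('x set \<times> 'a) set set" where
  "splitting_ideal x = {a\<in>\<R> x. \<forall>e\<ge>1. \<forall>\<psi>\<in>\<D> x e. \<psi> a \<in> \<M> x}"

lemma splitting_idealD: "a \<in> splitting_ideal x \<Longrightarrow> e \<ge> 1 \<Longrightarrow> \<psi> \<in> \<D> x e \<Longrightarrow> \<psi> a \<in> \<M> x"
  unfolding splitting_ideal_def by blast

text \<open>Degrees add under composition: a map applied to \<open>\<psi> a\<close> is a composite
  of positive degree applied to \<open>a\<close>.\<close>

lemma splitting_ideal_compatible: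
  assumes \<psi>: "e \<ge> 1" "\<psi> \<in> \<D> x e" and a: "a \<in> splitting_ideal x"
  shows "\<psi> a \<in> splitting_ideal x"
proof -
  have aR: "a \<in> \<R> x" and aK: "a \<in> carrier K"
    using a local_ring_carrier unfolding splitting_ideal_def by auto
  have "\<phi> (\<psi> a) \<in> \<M> x" if \<phi>: "d \<ge> 1" "\<phi> \<in> \<D> x d" for d \<phi>
  proof -
    obtain \<theta> where \<theta>: "\<theta> \<in> \<D> x (d + e)" "\<forall>b\<in>carrier K. \<theta> b = \<phi> (\<psi> b)"
      using stalk_comp[OF \<phi>(2) \<psi>(2)] by blast
    have "\<theta> a \<in> \<M> x" by (rule splitting_idealD[OF a _ \<theta>(1)]) (use \<phi>(1) in simp)
    then show ?thesis using \<theta>(2) aK by simp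
  qed
  then show ?thesis unfolding splitting_ideal_def using stalk_local[OF \<psi>(2) aR] by blast
qed

lemma splitting_ideal_mult:
  assumes a: "a \<in> \<R> x" and b: "b \<in> splitting_ideal x"
  shows "a \<otimes>\<^bsub>K\<^esub> b \<in> splitting_ideal x"
proof -
  have bR: "b \<in> \<R> x" and bK: "b \<in> carrier K"
    using b local_ring_carrier unfolding splitting_ideal_def by auto
  have "\<psi> (a \<otimes>\<^bsub>K\<^esub> b) \<in> \<M> x" if \<psi>: "e \<ge> 1" "\<psi> \<in> \<D> x e" for e \<psi>
  proof -
    obtain \<theta> where "\<theta> \<in> \<D> x e" "\<forall>b\<in>carrier K. \<theta> b = \<psi> (a \<otimes>\<^bsub>K\<^esub> b)"
      using stalk_mult_right[OF a \<psi>(2)] by blast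
    then show ?thesis using b bK \<psi>(1) unfolding splitting_ideal_def by force
  qed
  then show ?thesis unfolding splitting_ideal_def using local_ring_mult[OF a bR] by blast
qed

text \<open>If some \<psi> takes \<open>b\<close> to a unit, compatibility puts
  \<open>a (\<psi> b)\<close> into the ideal, and the inverse of the unit is available in the local
  ring.\<close>

lemma splitting_ideal_prime:
  assumes a: "a \<in> \<R> x" and b: "b \<in> \<R> x" and ab: "a \<otimes>\<^bsub>K\<^esub> b \<in> splitting_ideal x"
  shows "a \<in> splitting_ideal x \<or> b \<in> splitting_ideal x"
proof (rule disjCI)
  assume "b \<notin> splitting_ideal x"
  then obtain e \<psi> where \<psi>: "e \<ge> 1" "\<psi> \<in> \<D> x e" "\<psi> b \<notin> \<M> x"
    using b unfolding splitting_ideal_def by blast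
  then obtain c where c: "c \<in> \<R> x" "\<psi> b \<otimes>\<^bsub>K\<^esub> c = \<one>\<^bsub>K\<^esub>" using unit_value b by blast
  have carr: "a \<in> carrier K" "b \<in> carrier K" "c \<in> carrier K" "\<psi> b \<in> carrier K"
    using a b c local_ring_carrier stalk_closed[OF \<psi>(2)] by blast+
  \<comment> \<open>Splits one factor \<open>a\<close> off the q-th power, so that
    \<open>a b\<close> appears in the argument of \<psi>.\<close>
  have pos: "p ^ e = Suc (p ^ e - 1)" using p by simp
  have "a [^]\<^bsub>K\<^esub> (p ^ e) = a [^]\<^bsub>K\<^esub> (p ^ e - 1) \<otimes>\<^bsub>K\<^esub> a" by (subst pos) simp
  then have "a [^]\<^bsub>K\<^esub> (p ^ e) \<otimes>\<^bsub>K\<^esub> b = a [^]\<^bsub>K\<^esub> (p ^ e - 1) \<otimes>\<^bsub>K\<^esub> (a \<otimes>\<^bsub>K\<^esub> b)"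
    using carr by (simp add: K.m_assoc)
  also have "\<dots> \<in> splitting_ideal x" by (rule splitting_ideal_mult[OF local_ring_pow[OF a] ab])
  finally have "a \<otimes>\<^bsub>K\<^esub> \<psi> b \<in> splitting_ideal x"
    using splitting_ideal_compatible[OF \<psi>(1,2)] stalk_linear[OF \<psi>(2) carr(1,2)] by metis
  then have "c \<otimes>\<^bsub>K\<^esub> (a \<otimes>\<^bsub>K\<^esub> \<psi> b) \<in> splitting_ideal x" by (rule splitting_ideal_mult[OF c(1)])
  moreover have "c \<otimes>\<^bsub>K\<^esub> (a \<otimes>\<^bsub>K\<^esub> \<psi> b) = a"
    using carr c(2) K.m_comm[of c "a \<otimes>\<^bsub>K\<^esub> \<psi> b"] K.m_assoc[of a "\<psi> b" c] by simp
  ultimately show "a \<in> splitting_ideal x" by simp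
qed

lemma splitting_ideal_primeideal:
  assumes x: "x \<in> points X" and proper: "\<one>\<^bsub>K\<^esub> \<notin> splitting_ideal x"
    and ne: "splitting_ideal x \<noteq> {}"
  shows "primeideal (splitting_ideal x) (K\<lparr>carrier := \<R> x\<rparr>)"
proof (rule K.primeideal_subringI[OF local_ring_subring[OF x]])
  show sub: "splitting_ideal x \<subseteq> \<R> x" unfolding splitting_ideal_def by blast
  obtain a where a: "a \<in> splitting_ideal x" using ne by blast
  then have "a \<in> carrier K" using sub local_ring_carrier by blast
  then show "\<zero>\<^bsub>K\<^esub> \<in> splitting_ideal x" using splitting_ideal_mult[OF local_ring_zero[OF x] a] by simp
  fix a b
  show "a \<oplus>\<^bsub>K\<^esub> b \<in> splitting_ideal x" if "a \<in> splitting_ideal x" "b \<in> splitting_ideal x"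
  proof -
    have ab: "a \<in> \<R> x" "b \<in> \<R> x" "a \<in> carrier K" "b \<in> carrier K"
      using that sub local_ring_carrier by blast+
    have "\<psi> (a \<oplus>\<^bsub>K\<^esub> b) \<in> \<M> x" if \<psi>: "e \<ge> 1" "\<psi> \<in> \<D> x e" for e \<psi>
      using max_ideal_add splitting_idealD \<open>a \<in> splitting_ideal x\<close> \<open>b \<in> splitting_ideal x\<close> \<psi>
      unfolding stalk_additive[OF \<psi>(2) ab(3,4)] by blast
    then show ?thesis using local_ring_add[OF ab(1,2)] unfolding splitting_ideal_def by blast
  qed
qed (use proper splitting_ideal_mult splitting_ideal_prime in auto)

text \<open>Information at the specialization \<open>x\<close> reaches \<open>y\<close> by clearing
  two denominators, \<open>b\<close> for the element and \<open>c\<close> for the map. Both lie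
  outside the prime \<open>\<M> y\<close>, so they cancel from
  \<open>c b (\<psi> f)\<close>.\<close>

lemma compatible_of_prime:
  assumes cl: "x \<in> closure_pt X y" and y: "y \<in> points X"
    and pres: "\<And>e \<psi> a. e \<ge> 1 \<Longrightarrow> \<psi> \<in> \<D> x e \<Longrightarrow> a \<in> \<M> y \<Longrightarrow> a \<in> \<R> x \<Longrightarrow> \<psi> a \<in> \<M> y"
  shows "uniformly_compatible X D y"
  unfolding compatible_iff[OF y]
proof safe
  fix e \<psi> f assume e: "e \<ge> 1" and \<psi>: "\<psi> \<in> \<D> y e" and f: "f \<in> \<M> y"
  note sub = local_ring_mono[OF cl]
  have fR: "f \<in> \<R> y" using f max_ideal_local by blast
  obtain c \<phi> where c: "c \<in> \<R> x" "c \<notin> \<M> y" and \<phi>: "\<phi> \<in> \<D> x e" "\<forall>b\<in>carrier K. \<phi> b = c \<otimes>\<^bsub>K\<^esub> \<psi> b"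
    using stalk_generalize[OF cl \<psi>] by blast
  obtain a b where ab: "a \<in> \<R> x" "b \<in> \<R> x" "b \<notin> \<M> y" "f \<otimes>\<^bsub>K\<^esub> b = a"
    using local_fraction[OF cl fR] by blast
  have R: "b \<in> \<R> y" "c \<in> \<R> y" using ab c sub by blast+
  have carr: "f \<in> carrier K" "a \<in> carrier K" "b \<in> carrier K" "c \<in> carrier K" "\<psi> f \<in> carrier K"
    using fR ab c local_ring_carrier stalk_closed[OF \<psi>] by blast+
  have pos: "p ^ e = Suc (p ^ e - 1)" using p by simp
  \<comment> \<open>Inside \<psi> the denominator is used as \<open>b^q\<close>: one copy turns
    \<open>f\<close> into \<open>a\<close>, which is defined at \<open>x\<close>, and outside \<psi>
    a single \<open>b\<close> remains.\<close>
  have "b [^]\<^bsub>K\<^esub> (p ^ e) = b [^]\<^bsub>K\<^esub> (p ^ e - 1) \<otimes>\<^bsub>K\<^esub> b" by (subst pos) simp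
  then have eq: "b [^]\<^bsub>K\<^esub> (p ^ e) \<otimes>\<^bsub>K\<^esub> f = b [^]\<^bsub>K\<^esub> (p ^ e - 1) \<otimes>\<^bsub>K\<^esub> a"
    using carr ab(4) by (simp add: K.m_assoc K.m_comm[of b f])
  have "a \<in> \<M> y" using max_ideal_mult[OF R(1) f] ab(4) K.m_comm[of b f] carr by simp
  then have "b [^]\<^bsub>K\<^esub> (p ^ e - 1) \<otimes>\<^bsub>K\<^esub> a \<in> \<M> y" "b [^]\<^bsub>K\<^esub> (p ^ e - 1) \<otimes>\<^bsub>K\<^esub> a \<in> \<R> x"
    using max_ideal_mult[OF local_ring_pow[OF R(1)]] local_ring_mult[OF local_ring_pow[OF ab(2)] ab(1)]
    by blast+
  then have "\<phi> (b [^]\<^bsub>K\<^esub> (p ^ e) \<otimes>\<^bsub>K\<^esub> f) \<in> \<M> y" using pres[OF e \<phi>(1)] unfolding eq by blast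
  then have "c \<otimes>\<^bsub>K\<^esub> (b \<otimes>\<^bsub>K\<^esub> \<psi> f) \<in> \<M> y"
    using \<phi>(2) stalk_linear[OF \<psi> carr(3,1)] carr by simp
  then have "b \<otimes>\<^bsub>K\<^esub> \<psi> f \<in> \<M> y"
    using max_ideal_prime[OF R(2) local_ring_mult[OF R(1) stalk_local[OF \<psi> fR]]] c(2) by blast
  then show "\<psi> f \<in> \<M> y" using max_ideal_prime[OF R(1) stalk_local[OF \<psi> fR]] ab(3) by blast
qed

lemma triv_pos_imp_regular:
  assumes nz: "\<exists>e>0. nonzero_degree X D e"
    and pos: "\<And>x. x \<in> points X \<Longrightarrow> x \<noteq> g \<Longrightarrow> log_discrepancy X p D (triv X x) > 0"
  shows "strongly_F_regular X D"
  unfolding strongly_F_regular_def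
proof (intro ballI)
  have incompat: "\<not> uniformly_compatible X D y" if "y \<in> points X" "y \<noteq> g" for y
    using pos[OF that] log_discrepancy_triv_le[OF that(1)] by (auto simp: leD)
  fix x f assume x: "x \<in> points X" and f: "f \<in> \<R> x - {\<zero>\<^bsub>K\<^esub>}"
  show "\<exists>e\<ge>1. \<exists>\<psi>\<in>\<D> x e. \<psi> f = \<one>\<^bsub>K\<^esub>"
  proof (rule ccontr)
    assume no: "\<not> ?thesis"
    have fR: "f \<in> \<R> x" and fK: "f \<in> carrier K" using f local_ring_carrier by blast+
    \<comment> \<open>A map with unit value at \<open>f\<close> could be rescaled on the left to
      take the value 1, so failure of regularity at \<open>f\<close> means membership in the
      splitting ideal.\<close>
    have fN: "f \<in> splitting_ideal x"
    proof (rule ccontr)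
      assume "f \<notin> splitting_ideal x"
      then obtain e \<psi> where \<psi>: "e \<ge> 1" "\<psi> \<in> \<D> x e" "\<psi> f \<notin> \<M> x"
        using fR unfolding splitting_ideal_def by blast
      then obtain b where b: "b \<in> \<R> x" "\<psi> f \<otimes>\<^bsub>K\<^esub> b = \<one>\<^bsub>K\<^esub>" using unit_value fR by blast
      obtain \<phi> where \<phi>: "\<phi> \<in> \<D> x e" "\<forall>a\<in>carrier K. \<phi> a = b \<otimes>\<^bsub>K\<^esub> \<psi> a"
        using stalk_mult_left[OF b(1) \<psi>(2)] by blast
      then have "\<phi> f = \<one>\<^bsub>K\<^esub>"
        using b fK K.m_comm[of b "\<psi> f"] local_ring_carrier[OF b(1)] stalk_closed[OF \<psi>(2) fK] by simp
      then show False using no \<psi>(1) \<phi>(1) by blast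
    qed
    show False
    proof (cases "\<one>\<^bsub>K\<^esub> \<in> splitting_ideal x")
      case True
      have all: "\<psi> a \<in> \<M> x" if "e \<ge> 1" "\<psi> \<in> \<D> x e" "a \<in> \<R> x" for e \<psi> a
        using splitting_ideal_mult[OF that(3) True] that local_ring_carrier[OF that(3)]
        unfolding splitting_ideal_def by auto
      then have "uniformly_compatible X D x"
        unfolding compatible_iff[OF x] using max_ideal_local by blast
      then have "x = g" using incompat x by blast
      \<comment> \<open>Every nonempty open set contains the generic point, so this map lies in its
        stalk; there the maximal ideal is zero, and a splitting ideal containing 1 would make the
        map vanish.\<close>
      obtain e U \<psi> where e: "e > 0" and U: "is_open X U" "U \<noteq> {}" and \<psi>: "\<psi> \<in> D e U" "nonzero_map K \<psi>"
        using nz unfolding nonzero_degree_def by blast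
      have "\<psi> \<in> \<D> x e" using stalkI[OF U(1) _ \<psi>(1)] generic_in[OF U(1)] U(2) \<open>x = g\<close> by blast
      then have "\<psi> a = \<zero>\<^bsub>K\<^esub>" if "a \<in> carrier K" for a
        using all[of e \<psi> a] e that max_ideal_generic local_ring_generic \<open>x = g\<close> by auto
      then show False using \<psi>(2) unfolding nonzero_map_def by blast
    next
      case False
      have "primeideal (splitting_ideal x) (K\<lparr>carrier := \<R> x\<rparr>)"
        by (rule splitting_ideal_primeideal[OF x False]) (use fN in blast)
      then obtain y where y: "y \<in> points X" "x \<in> closure_pt X y" "\<M> y \<inter> \<R> x = splitting_ideal x"
        using local_prime_point[OF x] by blast
      \<comment> \<open>The maximal ideal at the generic point is zero, while that of
        \<open>y\<close> contains the nonzero \<open>f\<close>.\<close>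
      have "y \<noteq> g" using y(3) fN f max_ideal_generic by blast
      moreover have "uniformly_compatible X D y"
        by (rule compatible_of_prime[OF y(2,1)]) (use splitting_ideal_compatible y(3) in blast)
      ultimately show False using incompat y(1) by blast
    qed
  qed
qed

end

theorem theorem5p3:
  fixes X :: "('x, 'a) ringed_space" and p :: nat and D :: "('x, 'a) graded_maps"
  assumes "separated_scheme X" and "noetherian_scheme X" and "integral_scheme X"
    and "has_prime_char X p" and "F_finite X p"
    and "cartier_subalgebra X p D"
    and "\<exists>e>0. nonzero_degree X D e"
  shows "(sharply_F_pure X D \<longleftrightarrow> (\<forall>\<zeta>\<in>semivaluations X. log_discrepancy X p D \<zeta> \<ge> 0)) \<and>
    (strongly_F_regular X D \<longleftrightarrow>
       (\<forall>\<zeta>\<in>semivaluations X - {triv X (generic_point X)}. log_discrepancy X p D \<zeta> > 0)) \<and>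
    (sharply_F_pure X D \<longleftrightarrow> (\<forall>x\<in>points X. log_discrepancy X p D (triv X x) \<ge> 0)) \<and>
    (strongly_F_regular X D \<longleftrightarrow>
       (\<forall>x\<in>points X - {generic_point X}. log_discrepancy X p D (triv X x) > 0))"
proof -
  have "2 \<le> p" using assms(4) prime_ge_2_nat unfolding has_prime_char_def by blast
  then interpret cartier_space X p D
    by unfold_locales (use assms in auto)
  \<comment> \<open>A trivial semivaluation remembers its home, so removing the generic one removes
    no other point, and the condition on semivaluations specializes to points.\<close>
  have "triv X x \<noteq> triv X g" if "x \<noteq> g" for x using that unfolding triv_def by simp
  then show ?thesis
    using pure_imp_log_discrepancy_nonneg triv_nonneg_imp_pure triv_semivaluation
      regular_imp_log_discrepancy_pos triv_pos_imp_regular[OF assms(7)]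
    by (intro conjI iffI ballI) blast+
qed

end
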